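(* Let $F$ be a field of characteristic $0$ and let $H$ be a finite dimensional (co)semisimple Hopf algebra over $F$. Let $L$ be a finite dimensional semisimple Lie algebra over $F$ that is an $H$-module (respectively, $H$-comodule) Lie algebra, and let $(V,\psi)$ be a finite dimensional $(H,L)$-module in the corresponding sense. Then $V=V_1\oplus V_2\oplus\dots\oplus V_s$ for some irreducible $(H,L)$-submodules $V_i$.
   Context: For a finite dimensional Hopf algebra over a field of characteristic $0$, semisimplicity and cosemisimplicity are equivalent (Larson--Radford); "(co)semisimple" means that these equivalent conditions hold. Sweedler notation: $\Delta(h)=h_{(1)}\otimes h_{(2)}$ for the comultiplication, $\rho(v)=v_{(0)}\otimes v_{(1)}$ for right $H$-coactions. Module version: a Lie algebra $L$ that is a left $H$-module is an $H$-module Lie algebra if $h[a,b]=[h_{(1)}a,h_{(2)}b]$ for all $h\in H$, $a,b\in L$. If $V$ is an $H$-module and $\psi\colon L\to\mathfrak{gl}(V)$ is a representation, $(V,\psi)$ is an $(H,L)$-module if $h(\psi(a)v)=\psi(h_{(1)}a)(h_{(2)}v)$ for all $a\in L$, $h\in H$, $v\in V$. An $(H,L)$-submodule is an $L$-submodule that is also an $H$-submodule; $(V,\psi)$ is irreducible if it has no nontrivial $L$-submodules that are $H$-submodules at the same time. Comodule version: a Lie algebra $L$ that is a right $H$-comodule is an $H$-comodule Lie algebra if $\rho([a,b])=[a_{(0)},b_{(0)}]\otimes a_{(1)}b_{(1)}$ for all $a,b\in L$. If $V$ is a right $H$-comodule with comodule map $\rho_V$ and $\psi\colon L\to\mathfrak{gl}(V)$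 is a representation, $(V,\psi)$ is an $(H,L)$-module if $\rho_V(\psi(a)v)=\psi(a_{(0)})v_{(0)}\otimes a_{(1)}v_{(1)}$ for all $a\in L$, $v\in V$. An $(H,L)$-submodule is an $L$-submodule that is also an $H$-subcomodule (a subspace $W$ with $\rho_V(W)\subseteq W\otimes H$); $(V,\psi)$ is irreducible if it has no nontrivial $L$-submodules that are $H$-subcomodules at the same time. *)

theory Defs
  imports Complex_Main "HOL-Library.Poly_Mapping"
begin

text \<open>
  The library has no tensor products of vector spaces over an arbitrary field. We use the usual
  construction: the tensor product of A and B is the free vector space on the set of pairs, modulo
  the subspace generated by the bilinearity relations. A tensor is given by a representative in the
  free vector space, and equality of tensors is congruence modulo that subspace. In particular a
  linear map into a tensor product is a map to representatives that is linear up to congruence.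
\<close>

subsection \<open>Free vector spaces and tensor products\<close>

definition free_scale :: "'f::field \<Rightarrow> ('i \<Rightarrow>\<^sub>0 'f) \<Rightarrow> ('i \<Rightarrow>\<^sub>0 'f)" where
  "free_scale c = Poly_Mapping.map ((*) c)"

lemma lookup_free_scale [simp]: "Poly_Mapping.lookup (free_scale c t) i = c * Poly_Mapping.lookup t i"
  by (cases "Poly_Mapping.lookup t i = 0") (simp_all add: free_scale_def Poly_Mapping.map.rep_eq when_def)

lemma vector_space_free_scale: "vector_space free_scale"
  by unfold_locales (auto intro!: poly_mapping_eqI simp: lookup_add algebra_simps)

abbreviation gen :: "'i \<Rightarrow> ('i \<Rightarrow>\<^sub>0 'f::field)" where
  "gen i \<equiv> Poly_Mapping.single i 1"

definition free_ext :: "('f::field \<Rightarrow> 'w::ab_group_add \<Rightarrow> 'w) \<Rightarrow> ('i \<Rightarrow> 'w) \<Rightarrow> ('i \<Rightarrow>\<^sub>0 'f) \<Rightarrow> 'w" where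
  "free_ext s g t = (\<Sum>i\<in>Poly_Mapping.keys t. s (Poly_Mapping.lookup t i) (g i))"

text \<open>
  For bilinear \<open>\<beta>\<close>, the Sweedler expression \<open>\<beta>(h\<^sub>1, h\<^sub>2)\<close> is \<open>sweedler s \<beta> (\<Delta> h)\<close>; it depends only on
  the class of \<open>\<Delta> h\<close>, see \<open>sweedler_cong\<close> below.
\<close>

definition sweedler ::
  "('f::field \<Rightarrow> 'w::ab_group_add \<Rightarrow> 'w) \<Rightarrow> ('a \<Rightarrow> 'b \<Rightarrow> 'w) \<Rightarrow> ('a \<times> 'b \<Rightarrow>\<^sub>0 'f) \<Rightarrow> 'w" where
  "sweedler s \<beta> = free_ext s (\<lambda>(a, b). \<beta> a b)"

definition tensor_relations ::
  "('f::field \<Rightarrow> 'a::ab_group_add \<Rightarrow> 'a) \<Rightarrow> ('f \<Rightarrow> 'b::ab_group_add \<Rightarrow> 'b) \<Rightarrow> ('a \<times> 'b \<Rightarrow>\<^sub>0 'f) set" where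
  "tensor_relations sA sB =
     {gen (a + a', b) - gen (a, b) - gen (a', b) | a a' b. True} \<union>
     {gen (a, b + b') - gen (a, b) - gen (a, b') | a b b'. True} \<union>
     {gen (sA c a, b) - free_scale c (gen (a, b)) | c a b. True} \<union>
     {gen (a, sB c b) - free_scale c (gen (a, b)) | c a b. True}"

definition tensor_eq ::
  "('f::field \<Rightarrow> 'a::ab_group_add \<Rightarrow> 'a) \<Rightarrow> ('f \<Rightarrow> 'b::ab_group_add \<Rightarrow> 'b) \<Rightarrow>
   ('a \<times> 'b \<Rightarrow>\<^sub>0 'f) \<Rightarrow> ('a \<times> 'b \<Rightarrow>\<^sub>0 'f) \<Rightarrow> bool" where
  "tensor_eq sA sB t u \<longleftrightarrow> t - u \<in> module.span free_scale (tensor_relations sA sB)"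

definition tensor3_relations ::
  "('f::field \<Rightarrow> 'a::ab_group_add \<Rightarrow> 'a) \<Rightarrow> ('f \<Rightarrow> 'b::ab_group_add \<Rightarrow> 'b) \<Rightarrow>
   ('f \<Rightarrow> 'c::ab_group_add \<Rightarrow> 'c) \<Rightarrow> ('a \<times> 'b \<times> 'c \<Rightarrow>\<^sub>0 'f) set" where
  "tensor3_relations sA sB sC =
     {gen (a + a', b, c) - gen (a, b, c) - gen (a', b, c) | a a' b c. True} \<union>
     {gen (a, b + b', c) - gen (a, b, c) - gen (a, b', c) | a b b' c. True} \<union>
     {gen (a, b, c + c') - gen (a, b, c) - gen (a, b, c') | a b c c'. True} \<union>
     {gen (sA r a, b, c) - free_scale r (gen (a, b, c)) | r a b c. True} \<union>
     {gen (a, sB r b, c) - free_scale r (gen (a, b, c)) | r a b c. True} \<union>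
     {gen (a, b, sC r c) - free_scale r (gen (a, b, c)) | r a b c. True}"

definition tensor3_eq ::
  "('f::field \<Rightarrow> 'a::ab_group_add \<Rightarrow> 'a) \<Rightarrow> ('f \<Rightarrow> 'b::ab_group_add \<Rightarrow> 'b) \<Rightarrow>
   ('f \<Rightarrow> 'c::ab_group_add \<Rightarrow> 'c) \<Rightarrow> ('a \<times> 'b \<times> 'c \<Rightarrow>\<^sub>0 'f) \<Rightarrow> ('a \<times> 'b \<times> 'c \<Rightarrow>\<^sub>0 'f) \<Rightarrow> bool" where
  "tensor3_eq sA sB sC t u \<longleftrightarrow> t - u \<in> module.span free_scale (tensor3_relations sA sB sC)"

text \<open>The maps \<open>\<rho> \<otimes> id\<close> and \<open>id \<otimes> \<rho>\<close> on representatives.\<close>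

definition apply_left ::
  "('a \<Rightarrow> ('d \<times> 'e \<Rightarrow>\<^sub>0 'f::field)) \<Rightarrow> ('a \<times> 'b \<Rightarrow>\<^sub>0 'f) \<Rightarrow> ('d \<times> 'e \<times> 'b \<Rightarrow>\<^sub>0 'f)" where
  "apply_left \<rho> = sweedler free_scale (\<lambda>a b. sweedler free_scale (\<lambda>d e. gen (d, e, b)) (\<rho> a))"

definition apply_right ::
  "('b \<Rightarrow> ('d \<times> 'e \<Rightarrow>\<^sub>0 'f::field)) \<Rightarrow> ('a \<times> 'b \<Rightarrow>\<^sub>0 'f) \<Rightarrow> ('a \<times> 'd \<times> 'e \<Rightarrow>\<^sub>0 'f)" where
  "apply_right \<rho> = sweedler free_scale (\<lambda>a b. sweedler free_scale (\<lambda>d e. gen (a, d, e)) (\<rho> b))"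

text \<open>\<open>tensor_combine f g\<close> sends the tensors \<open>a \<otimes> b\<close> and \<open>c \<otimes> d\<close> to \<open>f a c \<otimes> g b d\<close>.\<close>

definition tensor_combine ::
  "('a \<Rightarrow> 'c \<Rightarrow> 'p) \<Rightarrow> ('b \<Rightarrow> 'd \<Rightarrow> 'q) \<Rightarrow>
   ('a \<times> 'b \<Rightarrow>\<^sub>0 'f::field) \<Rightarrow> ('c \<times> 'd \<Rightarrow>\<^sub>0 'f) \<Rightarrow> ('p \<times> 'q \<Rightarrow>\<^sub>0 'f)" where
  "tensor_combine f g t u =
     sweedler free_scale (\<lambda>a b. sweedler free_scale (\<lambda>c d. gen (f a c, g b d)) u) t"

text \<open>\<open>in_tensor sA sB X Y t\<close>: the tensor \<open>t\<close> lies in the image of \<open>X \<otimes> Y\<close>, for subspaces \<open>X\<close>, \<open>Y\<close>.\<close>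

definition in_tensor ::
  "('f::field \<Rightarrow> 'a::ab_group_add \<Rightarrow> 'a) \<Rightarrow> ('f \<Rightarrow> 'b::ab_group_add \<Rightarrow> 'b) \<Rightarrow>
   'a set \<Rightarrow> 'b set \<Rightarrow> ('a \<times> 'b \<Rightarrow>\<^sub>0 'f) \<Rightarrow> bool" where
  "in_tensor sA sB X Y t \<longleftrightarrow> (\<exists>u. Poly_Mapping.keys u \<subseteq> X \<times> Y \<and> tensor_eq sA sB t u)"

definition bilinear_map ::
  "('f::field \<Rightarrow> 'a::ab_group_add \<Rightarrow> 'a) \<Rightarrow> ('f \<Rightarrow> 'b::ab_group_add \<Rightarrow> 'b) \<Rightarrow>
   ('f \<Rightarrow> 'w::ab_group_add \<Rightarrow> 'w) \<Rightarrow> ('a \<Rightarrow> 'b \<Rightarrow> 'w) \<Rightarrow> bool" where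
  "bilinear_map sA sB sW \<beta> \<longleftrightarrow>
     (\<forall>a. Vector_Spaces.linear sB sW (\<beta> a)) \<and> (\<forall>b. Vector_Spaces.linear sA sW (\<lambda>a. \<beta> a b))"

lemma free_ext_superset:
  assumes "vector_space s" "finite K" "Poly_Mapping.keys t \<subseteq> K"
  shows "free_ext s g t = (\<Sum>i\<in>K. s (Poly_Mapping.lookup t i) (g i))"
proof -
  interpret vector_space s by fact
  show ?thesis unfolding free_ext_def
    by (rule sum.mono_neutral_left) (use assms in \<open>auto simp: in_keys_iff\<close>)
qed

lemma linear_free_ext:
  assumes "vector_space s"
  shows "Vector_Spaces.linear free_scale s (free_ext s g)"
proof -
  interpret vector_space s by fact
  have add: "free_ext s g (t + u) = free_ext s g t + free_ext s g u" for t u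
  proof -
    let ?K = "Poly_Mapping.keys t \<union> Poly_Mapping.keys u"
    have "Poly_Mapping.keys (t + u) \<subseteq> ?K" by (rule keys_add)
    then show ?thesis
      by (simp add: free_ext_superset[OF assms, of ?K] lookup_add scale_left_distrib sum.distrib)
  qed
  have scal: "free_ext s g (free_scale c t) = s c (free_ext s g t)" for c t
  proof -
    have "Poly_Mapping.keys (free_scale c t) \<subseteq> Poly_Mapping.keys t" by (auto simp: in_keys_iff)
    then show ?thesis
      by (simp add: free_ext_superset[OF assms, of "Poly_Mapping.keys t"] scale_sum_right)
  qed
  show ?thesis
    using add scal assms vector_space_free_scale by (auto simp: Vector_Spaces.linear_iff)
qed

lemma sweedler_cong:
  assumes \<beta>: "bilinear_map sA sB sW \<beta>" and eq: "tensor_eq sA sB t u"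
  shows "sweedler sW \<beta> t = sweedler sW \<beta> u"
proof -
  have W: "vector_space sW" using \<beta> by (auto simp: bilinear_map_def Vector_Spaces.linear_iff)
  interpret F: vector_space "free_scale :: 'a \<Rightarrow> ('b \<times> 'c \<Rightarrow>\<^sub>0 'a) \<Rightarrow> _"
    by (rule vector_space_free_scale)
  interpret W: vector_space sW by (rule W)
  interpret E: Vector_Spaces.linear "free_scale :: 'a \<Rightarrow> ('b \<times> 'c \<Rightarrow>\<^sub>0 'a) \<Rightarrow> _" sW "sweedler sW \<beta>"
    unfolding sweedler_def by (rule linear_free_ext[OF W])
  have gen: "sweedler sW \<beta> (gen (a, b)) = \<beta> a b" for a b
    by (simp add: sweedler_def free_ext_def)
  have "sweedler sW \<beta> r = 0" if "r \<in> tensor_relations sA sB" for r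
    using that \<beta> unfolding tensor_relations_def bilinear_map_def Vector_Spaces.linear_iff
    by (auto simp: E.diff E.scale gen)
  then have "sweedler sW \<beta> (t - u) = 0"
    using eq E.eq_0_on_span unfolding tensor_eq_def by blast
  then show ?thesis by (simp add: E.diff)
qed

subsection \<open>Finite dimensional spaces and direct sums\<close>

definition finite_dimensional :: "('f::field \<Rightarrow> 'v::ab_group_add \<Rightarrow> 'v) \<Rightarrow> bool" where
  "finite_dimensional s \<longleftrightarrow> (\<exists>B. finite_dimensional_vector_space s B)"

text \<open>The whole space is the internal direct sum of the subspaces \<open>W 0, \<dots>, W (n - 1)\<close>.\<close>

definition is_direct_sum ::
  "('f::field \<Rightarrow> 'v::ab_group_add \<Rightarrow> 'v) \<Rightarrow> nat \<Rightarrow> (nat \<Rightarrow> 'v set) \<Rightarrow> bool" where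
  "is_direct_sum s n W \<longleftrightarrow>
     (\<forall>i<n. module.subspace s (W i)) \<and>
     (\<forall>v. \<exists>w. (\<forall>i<n. w i \<in> W i) \<and> v = (\<Sum>i<n. w i)) \<and>
     (\<forall>w. (\<forall>i<n. w i \<in> W i) \<and> (\<Sum>i<n. w i) = 0 \<longrightarrow> (\<forall>i<n. w i = 0))"

subsection \<open>Hopf algebras\<close>

locale unital_algebra = vector_space scale
  for scale :: "'f::field \<Rightarrow> 'h::ring_1 \<Rightarrow> 'h" +
  assumes scale_mult_left: "scale c x * y = scale c (x * y)"
    and scale_mult_right: "x * scale c y = scale c (x * y)"
begin

definition left_ideal :: "'h set \<Rightarrow> bool" where
  "left_ideal I \<longleftrightarrow> subspace I \<and> (\<forall>x. \<forall>y\<in>I. x * y \<in> I)"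

definition minimal_left_ideal :: "'h set \<Rightarrow> bool" where
  "minimal_left_ideal I \<longleftrightarrow>
     left_ideal I \<and> I \<noteq> {0} \<and> (\<forall>J. left_ideal J \<and> J \<subseteq> I \<longrightarrow> J = {0} \<or> J = I)"

text \<open>The left regular module is a direct sum of simple modules; a finite sum suffices, since
  a unital ring is finitely generated as a left module over itself.\<close>

definition semisimple :: bool where
  "semisimple \<longleftrightarrow> (\<exists>n I. (\<forall>i<n. minimal_left_ideal (I i)) \<and> is_direct_sum scale n I)"

end

locale coalgebra = vector_space scale
  for scale :: "'f::field \<Rightarrow> 'h::ab_group_add \<Rightarrow> 'h" +
  fixes \<Delta> :: "'h \<Rightarrow> ('h \<times> 'h \<Rightarrow>\<^sub>0 'f)"
    and \<epsilon> :: "'h \<Rightarrow> 'f"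
  assumes comult_add: "tensor_eq scale scale (\<Delta> (x + y)) (\<Delta> x + \<Delta> y)"
    and comult_scale: "tensor_eq scale scale (\<Delta> (scale c x)) (free_scale c (\<Delta> x))"
    and counit_linear: "Vector_Spaces.linear scale (*) \<epsilon>"
    and coassoc: "tensor3_eq scale scale scale (apply_left \<Delta> (\<Delta> x)) (apply_right \<Delta> (\<Delta> x))"
    and counit_left: "sweedler scale (\<lambda>a b. scale (\<epsilon> a) b) (\<Delta> x) = x"
    and counit_right: "sweedler scale (\<lambda>a b. scale (\<epsilon> b) a) (\<Delta> x) = x"
begin

definition subcoalgebra :: "'h set \<Rightarrow> bool" where
  "subcoalgebra D \<longleftrightarrow> subspace D \<and> (\<forall>x\<in>D. in_tensor scale scale D D (\<Delta> x))"

definition simple_subcoalgebra :: "'h set \<Rightarrow> bool" where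
  "simple_subcoalgebra D \<longleftrightarrow>
     subcoalgebra D \<and> D \<noteq> {0} \<and> (\<forall>E. subcoalgebra E \<and> E \<subseteq> D \<longrightarrow> E = {0} \<or> E = D)"

text \<open>Only for finite dimensional coalgebras: there the direct sum is necessarily finite.
  For finite dimensional Hopf algebras in characteristic 0, being \<open>semisimple\<close> and being
  \<open>cosemisimple\<close> are equivalent by a theorem of Larson and Radford.\<close>

definition cosemisimple :: bool where
  "cosemisimple \<longleftrightarrow> (\<exists>n D. (\<forall>i<n. simple_subcoalgebra (D i)) \<and> is_direct_sum scale n D)"

end

locale hopf_algebra = unital_algebra scale + coalgebra scale \<Delta> \<epsilon>
  for scale :: "'f::field \<Rightarrow> 'h::ring_1 \<Rightarrow> 'h"
    and \<Delta> :: "'h \<Rightarrow> ('h \<times> 'h \<Rightarrow>\<^sub>0 'f)"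
    and \<epsilon> :: "'h \<Rightarrow> 'f" +
  fixes S :: "'h \<Rightarrow> 'h"
  assumes comult_mult: "tensor_eq scale scale (\<Delta> (x * y)) (tensor_combine (*) (*) (\<Delta> x) (\<Delta> y))"
    and comult_one: "tensor_eq scale scale (\<Delta> 1) (gen (1, 1))"
    and counit_mult: "\<epsilon> (x * y) = \<epsilon> x * \<epsilon> y"
    and counit_one: "\<epsilon> 1 = 1"
    and antipode_linear: "Vector_Spaces.linear scale scale S"
    and antipode_left: "sweedler scale (\<lambda>a b. S a * b) (\<Delta> x) = scale (\<epsilon> x) 1"
    and antipode_right: "sweedler scale (\<lambda>a b. a * S b) (\<Delta> x) = scale (\<epsilon> x) 1"

subsection \<open>Lie algebras and representations\<close>

locale lie_algebra = vector_space scale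
  for scale :: "'f::field \<Rightarrow> 'l::ab_group_add \<Rightarrow> 'l" +
  fixes br :: "'l \<Rightarrow> 'l \<Rightarrow> 'l"
  assumes bracket_bilinear: "bilinear_map scale scale scale br"
    and bracket_self: "br x x = 0"
    and jacobi: "br x (br y z) + br y (br z x) + br z (br x y) = 0"
begin

definition lie_ideal :: "'l set \<Rightarrow> bool" where
  "lie_ideal I \<longleftrightarrow> subspace I \<and> (\<forall>x. \<forall>y\<in>I. br x y \<in> I)"

definition derived :: "'l set \<Rightarrow> 'l set" where
  "derived U = span {br x y | x y. x \<in> U \<and> y \<in> U}"

definition solvable :: "'l set \<Rightarrow> bool" where
  "solvable U \<longleftrightarrow> (\<exists>n. (derived ^^ n) U = {0})"

definition semisimple_lie :: bool where
  "semisimple_lie \<longleftrightarrow> (\<forall>I. lie_ideal I \<and> solvable I \<longrightarrow> I = {0})"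

end

locale lie_representation = L: lie_algebra sL br + V: vector_space sV
  for sL :: "'f::field \<Rightarrow> 'l::ab_group_add \<Rightarrow> 'l"
    and br :: "'l \<Rightarrow> 'l \<Rightarrow> 'l"
    and sV :: "'f \<Rightarrow> 'v::ab_group_add \<Rightarrow> 'v" +
  fixes \<psi> :: "'l \<Rightarrow> 'v \<Rightarrow> 'v"
  assumes rep_bilinear: "bilinear_map sL sV sV \<psi>"
    and rep_bracket: "\<psi> (br a b) v = \<psi> a (\<psi> b v) - \<psi> b (\<psi> a v)"
begin

definition lie_submodule :: "'v set \<Rightarrow> bool" where
  "lie_submodule W \<longleftrightarrow> V.subspace W \<and> (\<forall>a. \<forall>w\<in>W. \<psi> a w \<in> W)"

end

subsection \<open>Module version\<close>

locale algebra_module = H: unital_algebra sH + V: vector_space sV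
  for sH :: "'f::field \<Rightarrow> 'h::ring_1 \<Rightarrow> 'h"
    and sV :: "'f \<Rightarrow> 'v::ab_group_add \<Rightarrow> 'v" +
  fixes act :: "'h \<Rightarrow> 'v \<Rightarrow> 'v"
  assumes act_bilinear: "bilinear_map sH sV sV act"
    and act_mult: "act (x * y) v = act x (act y v)"
    and act_one: "act 1 v = v"

locale module_lie_algebra =
  H: hopf_algebra sH \<Delta> \<epsilon> S + L: lie_algebra sL br + HL: algebra_module sH sL actL
  for sH :: "'f::field \<Rightarrow> 'h::ring_1 \<Rightarrow> 'h"
    and \<Delta> :: "'h \<Rightarrow> ('h \<times> 'h \<Rightarrow>\<^sub>0 'f)"
    and \<epsilon> :: "'h \<Rightarrow> 'f"
    and S :: "'h \<Rightarrow> 'h"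
    and sL :: "'f \<Rightarrow> 'l::ab_group_add \<Rightarrow> 'l"
    and br :: "'l \<Rightarrow> 'l \<Rightarrow> 'l"
    and actL :: "'h \<Rightarrow> 'l \<Rightarrow> 'l" +
  assumes act_bracket: "actL h (br a b) = sweedler sL (\<lambda>x y. br (actL x a) (actL y b)) (\<Delta> h)"

locale HL_module =
  HLie: module_lie_algebra sH \<Delta> \<epsilon> S sL br actL + HV: algebra_module sH sV actV +
  LV: lie_representation sL br sV \<psi>
  for sH :: "'f::field \<Rightarrow> 'h::ring_1 \<Rightarrow> 'h"
    and \<Delta> :: "'h \<Rightarrow> ('h \<times> 'h \<Rightarrow>\<^sub>0 'f)"
    and \<epsilon> :: "'h \<Rightarrow> 'f"
    and S :: "'h \<Rightarrow> 'h"
    and sL :: "'f \<Rightarrow> 'l::ab_group_add \<Rightarrow> 'l"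
    and br :: "'l \<Rightarrow> 'l \<Rightarrow> 'l"
    and actL :: "'h \<Rightarrow> 'l \<Rightarrow> 'l"
    and sV :: "'f \<Rightarrow> 'v::ab_group_add \<Rightarrow> 'v"
    and actV :: "'h \<Rightarrow> 'v \<Rightarrow> 'v"
    and \<psi> :: "'l \<Rightarrow> 'v \<Rightarrow> 'v" +
  assumes act_rep: "actV h (\<psi> a v) = sweedler sV (\<lambda>x y. \<psi> (actL x a) (actV y v)) (\<Delta> h)"
begin

definition HL_submodule :: "'v set \<Rightarrow> bool" where
  "HL_submodule W \<longleftrightarrow> LV.lie_submodule W \<and> (\<forall>h. \<forall>w\<in>W. actV h w \<in> W)"

definition irreducible_HL_submodule :: "'v set \<Rightarrow> bool" where
  "irreducible_HL_submodule W \<longleftrightarrow>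
     HL_submodule W \<and> W \<noteq> {0} \<and> (\<forall>U. HL_submodule U \<and> U \<subseteq> W \<longrightarrow> U = {0} \<or> U = W)"

end

subsection \<open>Comodule version\<close>

locale coalgebra_comodule = H: coalgebra sH \<Delta> \<epsilon> + V: vector_space sV
  for sH :: "'f::field \<Rightarrow> 'h::ab_group_add \<Rightarrow> 'h"
    and \<Delta> :: "'h \<Rightarrow> ('h \<times> 'h \<Rightarrow>\<^sub>0 'f)"
    and \<epsilon> :: "'h \<Rightarrow> 'f"
    and sV :: "'f \<Rightarrow> 'v::ab_group_add \<Rightarrow> 'v" +
  fixes \<rho> :: "'v \<Rightarrow> ('v \<times> 'h \<Rightarrow>\<^sub>0 'f)"
  assumes coact_add: "tensor_eq sV sH (\<rho> (v + w)) (\<rho> v + \<rho> w)"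
    and coact_scale: "tensor_eq sV sH (\<rho> (sV c v)) (free_scale c (\<rho> v))"
    and coact_coassoc: "tensor3_eq sV sH sH (apply_left \<rho> (\<rho> v)) (apply_right \<Delta> (\<rho> v))"
    and coact_counit: "sweedler sV (\<lambda>w h. sV (\<epsilon> h) w) (\<rho> v) = v"

locale comodule_lie_algebra =
  H: hopf_algebra sH \<Delta> \<epsilon> S + L: lie_algebra sL br + HL: coalgebra_comodule sH \<Delta> \<epsilon> sL \<rho>L
  for sH :: "'f::field \<Rightarrow> 'h::ring_1 \<Rightarrow> 'h"
    and \<Delta> :: "'h \<Rightarrow> ('h \<times> 'h \<Rightarrow>\<^sub>0 'f)"
    and \<epsilon> :: "'h \<Rightarrow> 'f"
    and S :: "'h \<Rightarrow> 'h"
    and sL :: "'f \<Rightarrow> 'l::ab_group_add \<Rightarrow> 'l"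
    and br :: "'l \<Rightarrow> 'l \<Rightarrow> 'l"
    and \<rho>L :: "'l \<Rightarrow> ('l \<times> 'h \<Rightarrow>\<^sub>0 'f)" +
  assumes coact_bracket: "tensor_eq sL sH (\<rho>L (br a b)) (tensor_combine br (*) (\<rho>L a) (\<rho>L b))"

locale HL_comodule =
  HLie: comodule_lie_algebra sH \<Delta> \<epsilon> S sL br \<rho>L + HV: coalgebra_comodule sH \<Delta> \<epsilon> sV \<rho>V +
  LV: lie_representation sL br sV \<psi>
  for sH :: "'f::field \<Rightarrow> 'h::ring_1 \<Rightarrow> 'h"
    and \<Delta> :: "'h \<Rightarrow> ('h \<times> 'h \<Rightarrow>\<^sub>0 'f)"
    and \<epsilon> :: "'h \<Rightarrow> 'f"
    and S :: "'h \<Rightarrow> 'h"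
    and sL :: "'f \<Rightarrow> 'l::ab_group_add \<Rightarrow> 'l"
    and br :: "'l \<Rightarrow> 'l \<Rightarrow> 'l"
    and \<rho>L :: "'l \<Rightarrow> ('l \<times> 'h \<Rightarrow>\<^sub>0 'f)"
    and sV :: "'f \<Rightarrow> 'v::ab_group_add \<Rightarrow> 'v"
    and \<rho>V :: "'v \<Rightarrow> ('v \<times> 'h \<Rightarrow>\<^sub>0 'f)"
    and \<psi> :: "'l \<Rightarrow> 'v \<Rightarrow> 'v" +
  assumes coact_rep: "tensor_eq sV sH (\<rho>V (\<psi> a v)) (tensor_combine \<psi> (*) (\<rho>L a) (\<rho>V v))"
begin

definition HL_subcomodule :: "'v set \<Rightarrow> bool" where
  "HL_subcomodule W \<longleftrightarrow> LV.lie_submodule W \<and> (\<forall>w\<in>W. in_tensor sV sH W UNIV (\<rho>V w))"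

definition irreducible_HL_subcomodule :: "'v set \<Rightarrow> bool" where
  "irreducible_HL_subcomodule W \<longleftrightarrow>
     HL_subcomodule W \<and> W \<noteq> {0} \<and> (\<forall>U. HL_subcomodule U \<and> U \<subseteq> W \<longrightarrow> U = {0} \<or> U = W)"

end

end

theory Submission
  imports Defs "HOL-Library.Function_Algebras" "HOL-Algebra.Algebraic_Closure_Type"
begin

text \<open>
  Let \<open>W\<close> be an \<open>(H, L)\<close>-submodule of \<open>V\<close>. Weyl's theorem gives an \<open>L\<close>-linear projection \<open>p\<close> of \<open>V\<close> onto \<open>W\<close>,
  and for an integral \<open>t\<close> of \<open>H\<close> with \<open>\<epsilon>(t) = 1\<close> the average \<open>v \<mapsto> S(t\<^sub>1) p(t\<^sub>2 v)\<close> is a projection onto \<open>W\<close> that is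
  linear over \<open>L\<close> and over \<open>H\<close>; its kernel is a complement. Averaging in this order, instead of \<open>t\<^sub>1 p(S(t\<^sub>2) v)\<close>,
  keeps \<open>L\<close>-linearity for every Hopf algebra, so that \<open>S\<^sup>2 = id\<close> is not needed. A comodule is treated as a module
  over the dual Hopf algebra, both being given by structure constants in a basis of \<open>H\<close>.

  Weyl's theorem is obtained for an arbitrary field of characteristic 0 from the vanishing of the first
  cohomology. A perfect Lie algebra of operators with zero trace form consists of nilpotent operators (Cartan's
  criterion, over the algebraic closure), so by Engel's theorem trace forms of semisimple Lie algebras are
  nondegenerate wherever the representation is faithful; this yields the Casimir operators.
\<close>

section \<open>Traces and generalised eigenvectors\<close>

text \<open>The order of the average matters because \<open>act_rep\<close> puts the first Sweedler
  leg on the Lie algebra. In S(t_1) p(t_2 v) the leg t_2 splits at \<psi>(a) into t_2 and t_3, p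
  commutes with \<psi>(t_2 a), and S(t_1) \<psi>(t_2 a) collapses to \<psi>(a) S(t_1) because the
  two legs are adjacent. In t_1 p(S(t_2) v) the antipode reverses the legs, and legs that are not
  adjacent would have to cancel. Linearity over H then comes from the fact that p \<mapsto> S(k_1)
  \<circ> p \<circ> k_2 is a right action of H on operators, so that a right integral projects onto
  its invariants. Perfect algebras are the right setting for Cartan's criterion: every ideal
  contains a perfect term of its derived series, and this term is zero exactly when the ideal is
  solvable. A perfect algebra is also spanned by commutators, which lets an auxiliary operator from
  outside the algebra be moved across a trace. Quotients are replaced by pairs of subspaces
  throughout: V/U by a pair U \<subseteq> V, and Hom(V/W, W) by maps into W that vanish on
  W.\<close>

lemma linear_funpow:
  assumes "Vector_Spaces.linear s s T"
  shows "Vector_Spaces.linear s s (T ^^ k)"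
proof (induction k)
  case 0
  from assms show ?case by (simp add: Vector_Spaces.linear_iff)
next
  case (Suc k)
  from assms Suc show ?case by (simp add: Vector_Spaces.linear_iff)
qed

lemma funpow_invariant: "T ` M \<subseteq> M \<Longrightarrow> v \<in> M \<Longrightarrow> (T ^^ k) v \<in> M"
  by (induction k) auto

text \<open>A copy of \<open>vector_space\<close> without interpretations: names defined in \<open>vector_space\<close> itself would resolve to
  their instances for \<open>real_vector\<close>.\<close>

locale vspace = vector_space scale for scale :: "'a::field \<Rightarrow> 'b::ab_group_add \<Rightarrow> 'b"
begin

text \<open>Finiteness is a property of a subset, not of the type: spaces of operators are handled
  inside full function types, which need not be finite dimensional. A spanning set that may lie
  outside \<open>M\<close> makes the notion pass to subsets at once.\<close>

definition fdim :: "'b set \<Rightarrow> bool" where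
  "fdim M \<longleftrightarrow> (\<exists>B. finite B \<and> M \<subseteq> span B)"

definition basis_of :: "'b set \<Rightarrow> 'b set \<Rightarrow> bool" where
  "basis_of M B \<longleftrightarrow> finite B \<and> independent B \<and> span B = M"

lemma fdim_mono: "fdim M \<Longrightarrow> W \<subseteq> M \<Longrightarrow> fdim W"
  unfolding fdim_def by blast

lemma fdim_span: "finite B \<Longrightarrow> fdim (span B)"
  unfolding fdim_def by blast

lemma basis_of_fdim: "basis_of M B \<Longrightarrow> fdim M"
  unfolding basis_of_def by (auto simp: fdim_span)

lemma basis_of_subspace: "basis_of M B \<Longrightarrow> subspace M"
  unfolding basis_of_def by auto

lemma basis_of_subset: "basis_of M B \<Longrightarrow> B \<subseteq> M"
  unfolding basis_of_def by (auto simp: span_base)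

lemma basis_of_extend:
  assumes "subspace M" "fdim M" "independent C" "C \<subseteq> M"
  obtains B where "basis_of M B" "C \<subseteq> B"
proof -
  obtain B where B: "C \<subseteq> B" "B \<subseteq> M" "independent B" "M \<subseteq> span B"
    using maximal_independent_subset_extend[OF assms(4,3)] by metis
  obtain G where G: "finite G" "M \<subseteq> span G" using assms(2) unfolding fdim_def by blast
  have "finite B" using independent_span_bound[OF G(1) B(3)] B(2) G(2) by auto
  moreover have "span B = M" using B assms(1) by (simp add: span_minimal subset_antisym)
  ultimately show ?thesis using that B unfolding basis_of_def by auto
qed

lemma basis_of_exists:
  assumes "subspace M" "fdim M"
  obtains B where "basis_of M B"
  using basis_of_extend[OF assms independent_empty] by auto

lemma basis_of_subset_exists:
  assumes "subspace M" "fdim M" "S \<subseteq> M" "M \<subseteq> span S"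
  obtains B where "basis_of M B" "B \<subseteq> S"
proof -
  obtain B where B: "B \<subseteq> S" "independent B" "S \<subseteq> span B"
    using maximal_independent_subset[of S] by metis
  obtain G where G: "finite G" "M \<subseteq> span G" using assms(2) unfolding fdim_def by blast
  have BM: "B \<subseteq> M" using B assms by auto
  have "finite B" using independent_span_bound[OF G(1) B(2)] BM G(2) by auto
  moreover have "span B = M"
    using B BM assms by (metis span_minimal span_mono span_span subset_antisym subset_trans)
  ultimately show ?thesis using that B unfolding basis_of_def by auto
qed

lemma basis_of_dim: "basis_of M B \<Longrightarrow> dim M = card B"
  unfolding basis_of_def using dim_span_eq_card_independent by auto

lemma dim_subset_fdim:
  assumes "subspace W" "subspace M" "fdim M" "W \<subseteq> M"
  shows "dim W \<le> dim M" and "W \<noteq> M \<Longrightarrow> dim W < dim M"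
proof -
  obtain C where C: "basis_of W C" using basis_of_exists assms fdim_mono by metis
  obtain B where B: "basis_of M B" "C \<subseteq> B"
    using basis_of_extend[OF assms(2,3), of C] C assms(4) basis_of_subset[OF C]
    by (metis basis_of_def subset_trans)
  have fB: "finite B" using B basis_of_def by auto
  show "dim W \<le> dim M" using B C fB by (simp add: basis_of_dim card_mono)
  assume "W \<noteq> M"
  then have "C \<noteq> B" using B C unfolding basis_of_def by auto
  then show "dim W < dim M" using B C fB by (simp add: basis_of_dim psubset_card_mono)
qed

lemma representation_expand:
  assumes "basis_of M B" "v \<in> M"
  shows "(\<Sum>b\<in>B. scale (representation B v b) b) = v"
  using assms sum_representation_eq[of B v B] unfolding basis_of_def by auto

section \<open>Traces on invariant subspaces\<close>

lemma sum_over_bases: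
  assumes B: "basis_of M B" and C: "basis_of N C"
    and S: "Vector_Spaces.linear scale scale S" "S ` N \<subseteq> M"
    and T: "T ` M \<subseteq> N"
  shows "(\<Sum>b\<in>B. representation B (S (T b)) b)
       = (\<Sum>b\<in>B. \<Sum>c\<in>C. representation C (T b) c * representation B (S c) b)"
proof (rule sum.cong[OF refl])
  fix b assume b: "b \<in> B"
  interpret S: Vector_Spaces.linear scale scale S by fact
  have bM: "b \<in> M" using b basis_of_subset[OF B] by auto
  have iB: "independent B" and sB: "span B = M" using B by (auto simp: basis_of_def)
  have Sc: "S c \<in> span B" if "c \<in> C" for c
    using that basis_of_subset[OF C] S(2) sB by auto
  have "T b \<in> N" using T bM by auto
  then have "T b = (\<Sum>c\<in>C. scale (representation C (T b) c) c)"
    using representation_expand[OF C] by simp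
  then have "S (T b) = S (\<Sum>c\<in>C. scale (representation C (T b) c) c)" by simp
  also have "\<dots> = (\<Sum>c\<in>C. scale (representation C (T b) c) (S c))"
    by (simp add: S.sum S.scale)
  finally have "representation B (S (T b)) b
      = representation B (\<Sum>c\<in>C. scale (representation C (T b) c) (S c)) b" by simp
  also have "\<dots> = (\<Sum>c\<in>C. representation B (scale (representation C (T b) c) (S c)) b)"
    using Sc by (subst representation_sum[OF iB]) (auto intro: span_scale)
  also have "\<dots> = (\<Sum>c\<in>C. representation C (T b) c * representation B (S c) b)"
    using Sc by (simp add: representation_scale[OF iB])
  finally show "representation B (S (T b)) b
      = (\<Sum>c\<in>C. representation C (T b) c * representation B (S c) b)" .
qed

text \<open>Both sides are the same double sum of products of matrix entries. With one map the
  identity this is independence of the trace from the basis; with one space it is cyclicity.\<close>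

lemma sum_over_bases_commute:
  assumes B: "basis_of M B" and C: "basis_of N C"
    and S: "Vector_Spaces.linear scale scale S" "S ` N \<subseteq> M"
    and T: "Vector_Spaces.linear scale scale T" "T ` M \<subseteq> N"
  shows "(\<Sum>b\<in>B. representation B (S (T b)) b) = (\<Sum>c\<in>C. representation C (T (S c)) c)"
  unfolding sum_over_bases[OF B C S T(2)] sum_over_bases[OF C B T S(2)]
  by (subst sum.swap) (simp add: mult.commute)

definition trace_on :: "'b set \<Rightarrow> ('b \<Rightarrow> 'b) \<Rightarrow> 'a" where
  "trace_on M T = (let B = SOME B. basis_of M B in \<Sum>b\<in>B. representation B (T b) b)"

lemma linear_identity: "Vector_Spaces.linear scale scale (\<lambda>x. x)"
  using linear_id by (simp add: id_def)

lemma trace_on_eq: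
  assumes B: "basis_of M B" and T: "Vector_Spaces.linear scale scale T" "T ` M \<subseteq> M"
  shows "trace_on M T = (\<Sum>b\<in>B. representation B (T b) b)"
proof -
  define C where "C = (SOME B. basis_of M B)"
  have C: "basis_of M C" unfolding C_def using B by (rule someI)
  have "(\<Sum>b\<in>C. representation C (T b) b) = (\<Sum>b\<in>B. representation B (T b) b)"
    using sum_over_bases_commute[OF C B T linear_identity] by auto
  then show ?thesis unfolding trace_on_def C_def Let_def by simp
qed

lemma trace_on_cong:
  assumes "subspace M" "fdim M" "\<And>v. v \<in> M \<Longrightarrow> T v = T' v"
  shows "trace_on M T = trace_on M T'"
proof -
  define C where "C = (SOME B. basis_of M B)"
  have C: "basis_of M C" unfolding C_def using basis_of_exists[OF assms(1,2)] by (metis someI)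
  show ?thesis unfolding trace_on_def C_def[symmetric] Let_def
    using basis_of_subset[OF C] assms(3) by (intro sum.cong) auto
qed

lemma trace_on_commute:
  assumes "subspace M" "fdim M" "Vector_Spaces.linear scale scale S" "S ` M \<subseteq> M"
    "Vector_Spaces.linear scale scale T" "T ` M \<subseteq> M"
  shows "trace_on M (\<lambda>v. S (T v)) = trace_on M (\<lambda>v. T (S v))"
proof -
  obtain B where B: "basis_of M B" using basis_of_exists assms by metis
  have 1: "Vector_Spaces.linear scale scale (\<lambda>v. S (T v))" "Vector_Spaces.linear scale scale (\<lambda>v. T (S v))"
    using assms by (auto simp: Vector_Spaces.linear_iff)
  have 2: "(\<lambda>v. S (T v)) ` M \<subseteq> M" "(\<lambda>v. T (S v)) ` M \<subseteq> M" using assms by auto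
  show ?thesis using trace_on_eq[OF B 1(1) 2(1)] trace_on_eq[OF B 1(2) 2(2)]
    sum_over_bases_commute[OF B B assms(3-6)] by simp
qed

lemma trace_on_add:
  assumes "subspace M" "fdim M" "Vector_Spaces.linear scale scale S" "S ` M \<subseteq> M"
    "Vector_Spaces.linear scale scale T" "T ` M \<subseteq> M"
  shows "trace_on M (\<lambda>v. S v + T v) = trace_on M S + trace_on M T"
proof -
  obtain B where B: "basis_of M B" using basis_of_exists assms by metis
  have 1: "Vector_Spaces.linear scale scale (\<lambda>v. S v + T v)"
    using assms by (auto simp: Vector_Spaces.linear_iff algebra_simps)
  have 2: "(\<lambda>v. S v + T v) ` M \<subseteq> M" using assms by (auto simp: image_subset_iff subspace_add)
  have "S b \<in> span B" "T b \<in> span B" if "b \<in> B" for b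
    using that B assms basis_of_subset[OF B] unfolding basis_of_def by blast+
  then show ?thesis using B
    by (simp add: trace_on_eq[OF B 1 2] trace_on_eq[OF B assms(3,4)] trace_on_eq[OF B assms(5,6)]
      representation_add basis_of_def sum.distrib)
qed

lemma trace_on_scale:
  assumes "subspace M" "fdim M" "Vector_Spaces.linear scale scale S" "S ` M \<subseteq> M"
  shows "trace_on M (\<lambda>v. scale c (S v)) = c * trace_on M S"
proof -
  obtain B where B: "basis_of M B" using basis_of_exists assms by metis
  have 1: "Vector_Spaces.linear scale scale (\<lambda>v. scale c (S v))"
    using assms by (auto simp: Vector_Spaces.linear_iff algebra_simps)
  have 2: "(\<lambda>v. scale c (S v)) ` M \<subseteq> M" using assms by (auto simp: image_subset_iff subspace_scale)
  have "S b \<in> span B" if "b \<in> B" for b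
    using that B assms basis_of_subset[OF B] unfolding basis_of_def by auto
  then show ?thesis using B
    by (simp add: trace_on_eq[OF B 1 2] trace_on_eq[OF B assms(3,4)] 
      representation_scale basis_of_def sum_distrib_left)
qed

lemma trace_on_sum:
  assumes "subspace M" "fdim M" "finite I" "\<And>i. i \<in> I \<Longrightarrow> Vector_Spaces.linear scale scale (S i)"
    "\<And>i. i \<in> I \<Longrightarrow> S i ` M \<subseteq> M"
  shows "trace_on M (\<lambda>v. \<Sum>i\<in>I. S i v) = (\<Sum>i\<in>I. trace_on M (S i))"
    and "Vector_Spaces.linear scale scale (\<lambda>v. \<Sum>i\<in>I. S i v)"
proof -
  have zero: "Vector_Spaces.linear scale scale (\<lambda>v. 0)"
    by (simp add: Vector_Spaces.linear_iff vector_space_axioms)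
  have "trace_on M (\<lambda>v. 0) = 0"
    using trace_on_scale[OF assms(1,2) zero, of 0] assms(1) subspace_0 by (auto simp: image_subset_iff)
  with assms(3-5) zero have "trace_on M (\<lambda>v. \<Sum>i\<in>I. S i v) = (\<Sum>i\<in>I. trace_on M (S i))
      \<and> Vector_Spaces.linear scale scale (\<lambda>v. \<Sum>i\<in>I. S i v)"
  proof (induction I rule: finite_induct)
    case (insert i I)
    have 1: "(\<lambda>v. \<Sum>i\<in>I. S i v) ` M \<subseteq> M"
      using insert.prems assms(1) by (auto intro!: subspace_sum)
    have 2: "Vector_Spaces.linear scale scale (\<lambda>v. \<Sum>i\<in>I. S i v)" using insert by simp
    have 3: "Vector_Spaces.linear scale scale (\<lambda>v. S i v + (\<Sum>i\<in>I. S i v))"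
      using insert.prems(1)[of i] 2 by (simp add: Vector_Spaces.linear_iff algebra_simps)
    show ?case using insert 1 2 3 trace_on_add[OF assms(1,2) _ _ 2 1, of "S i"] by simp
  qed simp
  then show "trace_on M (\<lambda>v. \<Sum>i\<in>I. S i v) = (\<Sum>i\<in>I. trace_on M (S i))"
    "Vector_Spaces.linear scale scale (\<lambda>v. \<Sum>i\<in>I. S i v)" by auto
qed

text \<open>Extend a basis \<open>C\<close> of \<open>W\<close> to one of \<open>M\<close>: all
  images lie in the span of \<open>C\<close>, so the added basis vectors have diagonal entry
  zero.\<close>

lemma trace_on_range:
  assumes M: "subspace M" "fdim M" and W: "subspace W" "T ` M \<subseteq> W" "W \<subseteq> M"
    and T: "Vector_Spaces.linear scale scale T"
  shows "trace_on M T = trace_on W T"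
proof -
  obtain C where C: "basis_of W C" using basis_of_exists assms fdim_mono by metis
  obtain B where B: "basis_of M B" "C \<subseteq> B"
    using basis_of_extend[OF M, of C] C W(3) basis_of_subset[OF C]
    by (metis basis_of_def subset_trans)
  have iB: "independent B" and fB: "finite B" using B by (auto simp: basis_of_def)
  have TW: "T b \<in> span C" if "b \<in> B" for b
    using that basis_of_subset[OF B(1)] W C unfolding basis_of_def by auto
  have rep: "representation B (T b) = representation C (T b)" if "b \<in> B" for b
    using representation_extend[OF iB] TW[OF that] B by metis
  have zero: "representation C (T b) b' = 0" if "b' \<notin> C" for b b'
    using that representation_ne_zero by blast
  have "trace_on M T = (\<Sum>b\<in>B. representation C (T b) b)"
    using trace_on_eq[OF B(1) T] assms rep by (auto intro!: sum.cong)
  also have "\<dots> = (\<Sum>b\<in>C. representation C (T b) b)"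
    using B fB zero by (intro sum.mono_neutral_right) auto
  also have "\<dots> = trace_on W T" using trace_on_eq[OF C T] W by (metis image_mono subset_trans)
  finally show ?thesis .
qed

lemma subspace_linear_image: "Vector_Spaces.linear scale scale T \<Longrightarrow> subspace M \<Longrightarrow> subspace (T ` M)"
proof -
  assume "Vector_Spaces.linear scale scale T" and M: "subspace M"
  then interpret T: Vector_Spaces.linear scale scale T by simp
  show ?thesis using T.subspace_image[OF M] .
qed

lemma nilpotent_uniform:
  assumes M: "subspace M" "fdim M" and T: "Vector_Spaces.linear scale scale T"
    and nil: "\<And>v. v \<in> M \<Longrightarrow> \<exists>k. (T ^^ k) v = 0"
  obtains N where "\<And>v. v \<in> M \<Longrightarrow> (T ^^ N) v = 0"
proof -
  obtain B where B: "basis_of M B" using basis_of_exists M by metis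
  have "\<forall>b\<in>B. \<exists>k. (T ^^ k) b = 0" using nil basis_of_subset[OF B] by auto
  then obtain k where k: "\<And>b. b \<in> B \<Longrightarrow> (T ^^ k b) b = 0" by metis
  \<comment> \<open>A common exponent for all basis vectors; the sum is a convenient bound in place
    of the maximum.\<close>
  define N where "N = (\<Sum>b\<in>B. k b)"
  interpret TN: Vector_Spaces.linear scale scale "T ^^ N" by (rule linear_funpow[OF T])
  have "(T ^^ N) b = 0" if "b \<in> B" for b
  proof -
    have "k b \<le> N" unfolding N_def using that B by (intro member_le_sum) (auto simp: basis_of_def)
    then have "N = (N - k b) + k b" by simp
    then have "(T ^^ N) b = (T ^^ (N - k b)) ((T ^^ k b) b)" by (metis funpow_add comp_apply)
    also have "\<dots> = 0" using k[OF that] linear_funpow[OF T, of "N - k b"]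
      by (metis Vector_Spaces.linear_iff scale_zero_left)
    finally show ?thesis .
  qed
  then have "(T ^^ N) v = 0" if "v \<in> M" for v
    using TN.eq_0_on_span that B unfolding basis_of_def by blast
  then show ?thesis using that by blast
qed

lemma trace_on_funpow_image:
  assumes M: "subspace M" "fdim M" and T: "Vector_Spaces.linear scale scale T" "T ` M \<subseteq> M"
  shows "trace_on M T = trace_on ((T ^^ k) ` M) T"
proof (induction k)
  case (Suc k)
  have sub: "subspace ((T ^^ j) ` M)" for j using subspace_linear_image[OF linear_funpow[OF T(1)] M(1)] .
  have le: "(T ^^ j) ` M \<subseteq> M" for j using funpow_invariant[OF T(2)] by blast
  have "(T ^^ Suc k) ` M \<subseteq> (T ^^ k) ` M" using T(2) by (auto simp del: funpow.simps simp: funpow_Suc_right)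
  then have "trace_on ((T ^^ k) ` M) T = trace_on ((T ^^ Suc k) ` M) T"
    by (intro trace_on_range[OF sub fdim_mono[OF M(2) le] sub _ _ T(1)]) auto
  with Suc show ?case by simp
qed simp

text \<open>Passing to the image of a power leaves the trace unchanged, and some power has image
  zero. This takes the place of a triangular basis.\<close>

lemma trace_on_nilpotent:
  assumes M: "subspace M" "fdim M" and T: "Vector_Spaces.linear scale scale T" "T ` M \<subseteq> M"
    and nil: "\<And>v. v \<in> M \<Longrightarrow> \<exists>k. (T ^^ k) v = 0"
  shows "trace_on M T = 0"
proof -
  obtain N where N: "\<And>v. v \<in> M \<Longrightarrow> (T ^^ N) v = 0" using nilpotent_uniform[OF M T(1) nil] by blast
  have "(T ^^ N) ` M = {0}" using N subspace_0[OF M(1)] by force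
  moreover have "basis_of {0} {}" by (simp add: basis_of_def independent_empty)
  moreover have "T 0 = 0" using T(1) by (metis Vector_Spaces.linear_iff scale_zero_left)
  ultimately show ?thesis using trace_on_funpow_image[OF M T, of N] trace_on_eq[of "{0}" "{}" T] T by simp
qed

text \<open>The exponent depends on the vector and may be 0, so the zero vector qualifies for every
  \<open>c\<close>. Nilpotency on a vector is the case \<open>c = 0\<close>.\<close>

definition geig :: "('b \<Rightarrow> 'b) \<Rightarrow> 'a \<Rightarrow> 'b \<Rightarrow> bool" where
  "geig T c v \<longleftrightarrow> (\<exists>k. ((\<lambda>w. T w - scale c w) ^^ k) v = 0)"

lemma linear_shift:
  "Vector_Spaces.linear scale scale T \<Longrightarrow> Vector_Spaces.linear scale scale (\<lambda>w. T w - scale c w)"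
  by (auto simp: Vector_Spaces.linear_iff algebra_simps)

lemma funpow_zero:
  assumes "Vector_Spaces.linear scale scale T" shows "(T ^^ k) 0 = 0"
  using linear_funpow[OF assms, of k] by (metis Vector_Spaces.linear_iff scale_zero_left)

lemma geig_0: "Vector_Spaces.linear scale scale T \<Longrightarrow> geig T c 0"
  unfolding geig_def by (rule exI[of _ 0]) simp

lemma geig_add:
  assumes T: "Vector_Spaces.linear scale scale T" and "geig T c v" "geig T c w"
  shows "geig T c (v + w)"
proof -
  let ?D = "\<lambda>w. T w - scale c w"
  obtain k l where k: "(?D ^^ k) v = 0" "(?D ^^ l) w = 0" using assms unfolding geig_def by blast
  have L: "Vector_Spaces.linear scale scale ?D" by (rule linear_shift[OF T])
  have "(?D ^^ (k + l)) v = 0" using k(1) funpow_zero[OF L] by (simp add: add.commute[of k] funpow_add)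
  moreover have "(?D ^^ (k + l)) w = 0" using k(2) funpow_zero[OF L] by (simp add: funpow_add)
  ultimately have "(?D ^^ (k + l)) (v + w) = 0"
    using linear_funpow[OF L, of "k + l"] by (simp add: Vector_Spaces.linear_iff)
  then show ?thesis unfolding geig_def by blast
qed

lemma geig_scale:
  assumes T: "Vector_Spaces.linear scale scale T" and "geig T c v"
  shows "geig T c (scale r v)"
  using assms(2) linear_funpow[OF linear_shift[OF T, of c]] unfolding geig_def
  by (metis Vector_Spaces.linear_iff scale_zero_right)

lemma geig_sum:
  assumes T: "Vector_Spaces.linear scale scale T" and "\<And>i. i \<in> I \<Longrightarrow> geig T c (v i)"
  shows "geig T c (\<Sum>i\<in>I. v i)"
  using assms(2) by (induction I rule: infinite_finite_induct) (auto simp: geig_0[OF T] geig_add[OF T])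

lemma geig_SucI: "geig T c (T v - scale c v) \<Longrightarrow> geig T c v"
  unfolding geig_def by (metis comp_apply funpow_Suc_right)

text \<open>On an eigenvector for \<open>d\<close> the operator T - c is the nonzero scalar d - c,
  so no power of it kills a nonzero vector.\<close>

lemma geig_inj:
  assumes T: "Vector_Spaces.linear scale scale T" and "geig T c v" "c \<noteq> d" "T v = scale d v"
  shows "v = 0"
proof -
  let ?D = "\<lambda>w. T w - scale c w"
  obtain k where k: "(?D ^^ k) v = 0" using assms unfolding geig_def by blast
  have "(?D ^^ k) v = scale ((d - c) ^ k) v" for k
  proof (induction k)
    case (Suc k)
    have "(?D ^^ Suc k) v = T (scale ((d - c) ^ k) v) - scale c (scale ((d - c) ^ k) v)"
      using Suc by simp
    also have "T (scale ((d - c) ^ k) v) = scale ((d - c) ^ k) (scale d v)"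
      using T assms(4) by (simp add: Vector_Spaces.linear_iff)
    finally have "(?D ^^ Suc k) v = scale ((d - c) ^ k * d) v - scale (c * (d - c) ^ k) v" by simp
    also have "\<dots> = scale ((d - c) ^ k * d - c * (d - c) ^ k) v" by (rule scale_left_diff_distrib[symmetric])
    also have "(d - c) ^ k * d - c * (d - c) ^ k = (d - c) ^ Suc k" by (simp add: algebra_simps)
    finally show ?case .
  qed simp
  with k assms(3) show ?thesis by simp
qed

lemma geig_shift_invariant:
  assumes T: "Vector_Spaces.linear scale scale T" and "geig T c v"
  shows "geig T c (((\<lambda>w. T w - scale d w) ^^ j) v)"
proof (induction j)
  case 0 with assms show ?case by simp
next
  case (Suc j)
  let ?D = "\<lambda>w. T w - scale c w"
  define u where "u = ((\<lambda>w. T w - scale d w) ^^ j) v"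
  have u: "geig T c u" using Suc u_def by simp
  have L: "Vector_Spaces.linear scale scale ?D" by (rule linear_shift[OF T])
  obtain k where k: "(?D ^^ k) u = 0" using u unfolding geig_def by blast
  have "(?D ^^ k) (?D u) = 0" using k L funpow_swap1[of ?D k u]
    by (metis Vector_Spaces.linear_iff scale_zero_left)
  then have "geig T c (?D u)" unfolding geig_def by blast
  moreover have "T u - scale d u = ?D u + scale (c - d) u" by (simp add: algebra_simps)
  ultimately have "geig T c (T u - scale d u)" using geig_add[OF T] geig_scale[OF T] u by metis
  then show ?case by (simp add: u_def)
qed

text \<open>A power of T - c0 kills the summand for \<open>c0\<close> and keeps the others
  generalised eigenvectors for their own \<open>c\<close>, so their images vanish by induction. As T
  - c0 is injective on generalised eigenvectors for \<open>c \<noteq> c0\<close>, the summands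
  vanish themselves.\<close>

lemma geig_independent:
  assumes T: "Vector_Spaces.linear scale scale T" and "finite C"
    and "\<And>c. c \<in> C \<Longrightarrow> geig T c (w c)" "(\<Sum>c\<in>C. w c) = 0" "c \<in> C"
  shows "w c = 0"
  using assms(2-)
proof (induction C arbitrary: w c rule: finite_induct)
  case (insert c0 C)
  let ?D = "\<lambda>w. T w - scale c0 w"
  have L: "Vector_Spaces.linear scale scale ?D" by (rule linear_shift[OF T])
  obtain k where k: "(?D ^^ k) (w c0) = 0" using insert.prems(1)[of c0] unfolding geig_def by auto
  interpret Dk: Vector_Spaces.linear scale scale "?D ^^ k" by (rule linear_funpow[OF L])
  have "(?D ^^ k) (w c0 + (\<Sum>c\<in>C. w c)) = 0"
    using insert by (simp add: funpow_zero[OF L])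
  then have s: "(\<Sum>c\<in>C. (?D ^^ k) (w c)) = 0" using k by (simp add: Dk.add Dk.sum)
  have z: "w c = 0" if c: "c \<in> C" for c
  proof -
    have "(?D ^^ k) (w c) = 0"
      by (rule insert.IH[OF _ s c]) (use insert.prems geig_shift_invariant[OF T] in auto)
    moreover have "(?D ^^ j) (w c) = 0 \<Longrightarrow> w c = 0" for j
    proof (induction j)
      case (Suc j)
      have "geig T c ((?D ^^ j) (w c))" using insert.prems(1) c geig_shift_invariant[OF T] by auto
      then have "(?D ^^ j) (w c) = 0" using Suc.prems insert.hyps c by (intro geig_inj[OF T, of c _ c0]) auto
      then show ?case using Suc.IH by simp
    qed simp
    ultimately show ?thesis by blast
  qed
  then have "w c0 = 0" using insert.prems(2) insert.hyps by simp
  with z show ?case using insert.prems(3) by auto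
qed simp

lemma geig_shift_surj:
  assumes T: "Vector_Spaces.linear scale scale T" and N: "subspace N" "T ` N \<subseteq> N"
    and v: "geig T c v" "v \<in> N" "c \<noteq> d"
  shows "\<exists>w\<in>N. geig T c w \<and> T w - scale d w = v"
proof -
  let ?D = "\<lambda>w. T w - scale c w"
  have "\<And>v. v \<in> N \<Longrightarrow> (?D ^^ k) v = 0 \<Longrightarrow> \<exists>w\<in>N. geig T c w \<and> T w - scale d w = v" for k
  proof (induction k)
    case 0
    then show ?case using geig_0[OF T, of c] T subspace_0[OF N(1)]
      by (intro bexI[of _ 0]) (auto simp: Vector_Spaces.linear_iff, metis scale_zero_left)
  next
    case (Suc k)
    have D: "?D v \<in> N" using Suc.prems N by (auto simp: subspace_diff subspace_scale)
    have "(?D ^^ k) (?D v) = 0" using Suc.prems by (metis comp_apply funpow_Suc_right)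
    from Suc.IH[OF D this] obtain w where w: "w \<in> N" "geig T c w" "T w - scale d w = ?D v" by blast
    have gv: "geig T c v" using Suc.prems unfolding geig_def by blast
    \<comment> \<open>Apply T - d to v - w: the result is (T - c) v + (c - d) v - (T - c) v, so only
      the scalar c - d has to be divided out.\<close>
    define u where "u = scale (inverse (c - d)) (v - w)"
    have "T u = scale (inverse (c - d)) (T v - T w)"
      using T unfolding u_def by (simp add: Vector_Spaces.linear_iff
        module_hom.diff[OF T[unfolded linear_iff_module_hom]])
    then have "T u - scale d u = scale (inverse (c - d)) ((T v - scale d v) - (T w - scale d w))"
      unfolding u_def by (simp add: algebra_simps)
    also have "(T v - scale d v) - (T w - scale d w) = scale (c - d) v"
      using w(3) by (simp add: algebra_simps)
    also have "scale (inverse (c - d)) (scale (c - d) v) = v" using v(3) by simp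
    finally have "T u - scale d u = v" .
    moreover have "u \<in> N" using Suc.prems w N by (simp add: u_def subspace_diff subspace_scale)
    moreover have "v - w = v + scale (-1) w" by simp
    then have "geig T c u" unfolding u_def using gv w geig_add[OF T] geig_scale[OF T] by metis
    ultimately show ?case by blast
  qed
  then show ?thesis using v unfolding geig_def by blast
qed

end

lemma (in vspace) in_span_powers:
  "x \<in> span ((\<lambda>i. g i) ` {..<n::nat}) \<Longrightarrow> \<exists>r. x = (\<Sum>i<n. scale (r i) (g i))"
proof (induction n arbitrary: x)
  case (Suc n)
  then obtain k where "x - scale k (g n) \<in> span (g ` {..<n})"
    by (auto simp: lessThan_Suc span_breakdown_eq)
  with Suc.IH obtain r where "x - scale k (g n) = (\<Sum>i<n. scale (r i) (g i))" by blast
  then have "x = (\<Sum>i<Suc n. scale ((r(n := k)) i) (g i))" by (simp add: algebra_simps)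
  then show ?case by blast
qed simp

text \<open>Otherwise the vectors T^i v would be independent and outnumber a spanning set. The
  relation amounts to a monic polynomial in T annihilating \<open>v\<close>.\<close>

lemma (in vspace) power_relation:
  assumes "fdim N" and TN: "T ` N \<subseteq> N" and v: "v \<in> N"
  obtains n r where "(T ^^ n) v = (\<Sum>i<n. scale (r i) ((T ^^ i) v))"
proof -
  have "\<exists>n. (T ^^ n) v \<in> span ((\<lambda>i. (T ^^ i) v) ` {..<n})"
  proof (rule ccontr)
    let ?g = "\<lambda>i. (T ^^ i) v"
    assume no: "\<not> ?thesis"
    have ind: "independent (?g ` {..<n}) \<and> card (?g ` {..<n}) = n" for n
    proof (induction n)
      case (Suc n)
      have "?g n \<notin> span (?g ` {..<n})" using no by blast
      moreover from this have "?g n \<notin> ?g ` {..<n}" using span_base[of "?g n" "?g ` {..<n}"] by (rule contrapos_nn)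
      ultimately show ?case using Suc by (simp add: lessThan_Suc independent_insertI)
    qed (simp add: independent_empty)
    obtain G where G: "finite G" "N \<subseteq> span G" using assms(1) fdim_def by auto
    have "?g ` {..<Suc (card G)} \<subseteq> span G" using G funpow_invariant[OF TN v] by auto
    then have "card (?g ` {..<Suc (card G)}) \<le> card G"
      using independent_span_bound[OF G(1)] ind by blast
    then show False using ind by simp
  qed
  then obtain n where "(T ^^ n) v \<in> span ((\<lambda>i. (T ^^ i) v) ` {..<n})" by blast
  from in_span_powers[OF this] show ?thesis using that by blast
qed

text \<open>Induction on a bound for the degree of a polynomial annihilating \<open>v\<close>. A
  root \<open>x\<close> gives p = (X - x) q, and q annihilates (T - x) v, which decomposes by
  induction; its components for eigenvalues other than \<open>x\<close> lift through T - x by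
  \<open>geig_shift_surj\<close>.\<close>

lemma geig_decomposition_poly:
  fixes s :: "'k::alg_closed_field \<Rightarrow> 'v::ab_group_add \<Rightarrow> 'v"
  assumes "vspace s" and T: "Vector_Spaces.linear s s T"
    and N: "module.subspace s N" "T ` N \<subseteq> N"
  shows "p \<noteq> 0 \<Longrightarrow> degree p \<le> n \<Longrightarrow> v \<in> N \<Longrightarrow> (\<Sum>i\<le>n. s (coeff p i) ((T ^^ i) v)) = 0 \<Longrightarrow>
    \<exists>C w. finite C \<and> (\<forall>c\<in>C. w c \<in> N \<and> vspace.geig s T c (w c)) \<and> v = (\<Sum>c\<in>C. w c)"
proof (induction n arbitrary: p v)
  case 0
  interpret vspace s by fact
  from 0 have "v = 0" by (auto elim!: degree_eq_zeroE)
  then show ?case by (intro exI[of _ "{}"]) auto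
next
  case (Suc n)
  interpret vspace s by fact
  interpret T: Vector_Spaces.linear s s T by fact
  show ?case
  proof (cases "degree p \<le> n")
    case True
    then have "coeff p (Suc n) = 0" by (simp add: coeff_eq_0)
    then show ?thesis using Suc.prems by (intro Suc.IH[OF Suc.prems(1) True]) auto
  next
    case False
    then have deg: "degree p = Suc n" using Suc.prems by simp
    then obtain x where x: "poly p x = 0" using alg_closed_imp_poly_has_root[of p] by auto
    then obtain q where pq: "p = [:-x, 1:] * q" by (meson dvdE poly_eq_0_iff_dvd)
    have q0: "q \<noteq> 0" using Suc.prems pq by auto
    have dq: "degree q = n" using deg unfolding pq using q0 by (subst (asm) degree_mult_eq) auto
    define u where "u = T v - s x v"
    have Tu: "(T ^^ i) u = (T ^^ Suc i) v - s x ((T ^^ i) v)" for i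
    proof -
      interpret Ti: Vector_Spaces.linear s s "T ^^ i" by (rule linear_funpow[OF T])
      show ?thesis by (simp add: u_def Ti.diff Ti.scale funpow_swap1)
    qed
    have c0: "coeff p 0 = - x * coeff q 0" by (simp add: pq)
    have cS: "coeff p (Suc i) = coeff q i - x * coeff q (Suc i)" for i by (simp add: pq)
    have "(\<Sum>i\<le>n. s (coeff q i) ((T ^^ i) u))
        = (\<Sum>i\<le>n. s (coeff q i) ((T ^^ Suc i) v)) - (\<Sum>i\<le>n. s (x * coeff q i) ((T ^^ i) v))"
      by (simp add: Tu scale_right_diff_distrib sum_subtractf mult.commute del: funpow.simps)
    also have "(\<Sum>i\<le>n. s (x * coeff q i) ((T ^^ i) v)) = (\<Sum>i\<le>Suc n. s (x * coeff q i) ((T ^^ i) v))"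
      by (simp add: coeff_eq_0 dq)
    also have "\<dots> = s (x * coeff q 0) v + (\<Sum>i\<le>n. s (x * coeff q (Suc i)) ((T ^^ Suc i) v))"
      by (subst sum.atMost_Suc_shift) simp
    also have "(\<Sum>i\<le>n. s (coeff q i) ((T ^^ Suc i) v)) - (s (x * coeff q 0) v
        + (\<Sum>i\<le>n. s (x * coeff q (Suc i)) ((T ^^ Suc i) v)))
        = s (coeff p 0) v + (\<Sum>i\<le>n. s (coeff p (Suc i)) ((T ^^ Suc i) v))"
      unfolding c0 cS by (simp add: scale_left_diff_distrib sum_subtractf del: funpow.simps)
    also have "\<dots> = (\<Sum>i\<le>Suc n. s (coeff p i) ((T ^^ i) v))"
      unfolding sum.atMost_Suc_shift by (simp del: funpow.simps)
    also have "\<dots> = 0" by (rule Suc.prems)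
    finally have 0: "(\<Sum>i\<le>n. s (coeff q i) ((T ^^ i) u)) = 0" .
    have uN: "u \<in> N" using N Suc.prems by (auto simp: u_def subspace_diff subspace_scale)
    obtain C w where C: "finite C" "\<And>c. c \<in> C \<Longrightarrow> w c \<in> N \<and> geig T c (w c)" "u = (\<Sum>c\<in>C. w c)"
      using Suc.IH[OF q0 _ uN 0] dq by auto
    have "\<forall>c\<in>C - {x}. \<exists>z\<in>N. geig T c z \<and> T z - s x z = w c"
      using C geig_shift_surj[OF T N] by (metis Diff_iff insertCI)
    then obtain z where z: "\<And>c. c \<in> C - {x} \<Longrightarrow> z c \<in> N \<and> geig T c (z c) \<and> T (z c) - s x (z c) = w c" by metis
    \<comment> \<open>The part of \<open>v\<close> not covered by the lifted components. Its image
      under T - x is the component of \<open>u\<close> for \<open>x\<close>, or 0 if there is none,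
      so \<open>geig_SucI\<close> applies.\<close>
    define z0 where "z0 = v - (\<Sum>c\<in>C - {x}. z c)"
    have "T z0 - s x z0 = u - (\<Sum>c\<in>C - {x}. T (z c) - s x (z c))"
      by (simp add: z0_def T.diff T.sum u_def algebra_simps scale_sum_right sum_subtractf)
    also have "\<dots> = u - (\<Sum>c\<in>C - {x}. w c)" using z by simp
    also have "\<dots> = (if x \<in> C then w x else 0)" using C by (simp add: sum.remove)
    finally have "geig T x (T z0 - s x z0)" using C geig_0[OF T] by auto
    then have gz0: "geig T x z0" by (rule geig_SucI)
    have z0N: "z0 \<in> N" unfolding z0_def using z N Suc.prems by (auto intro!: subspace_diff subspace_sum)
    show ?thesis
    proof (intro exI[of _ "insert x C"] exI[of _ "\<lambda>c. if c = x then z0 else z c"] conjI ballI)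
      show "finite (insert x C)" using C by simp
      show "(if c = x then z0 else z c) \<in> N" "geig T c (if c = x then z0 else z c)" if "c \<in> insert x C" for c
        using that z z0N gz0 by auto
      have "(\<Sum>c\<in>insert x C. if c = x then z0 else z c) = z0 + (\<Sum>c\<in>C - {x}. if c = x then z0 else z c)"
        using C by (simp add: sum.insert_remove)
      also have "(\<Sum>c\<in>C - {x}. if c = x then z0 else z c) = (\<Sum>c\<in>C - {x}. z c)" by (intro sum.cong) auto
      finally show "v = (\<Sum>c\<in>insert x C. if c = x then z0 else z c)" by (simp add: z0_def)
    qed
  qed
qed

lemma geig_decomposition:
  fixes s :: "'k::alg_closed_field \<Rightarrow> 'v::ab_group_add \<Rightarrow> 'v"
  assumes s: "vspace s" and T: "Vector_Spaces.linear s s T"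
    and N: "module.subspace s N" "vspace.fdim s N" "T ` N \<subseteq> N" and v: "v \<in> N"
  obtains C w where "finite C" "\<And>c. c \<in> C \<Longrightarrow> w c \<in> N" "\<And>c. c \<in> C \<Longrightarrow> vspace.geig s T c (w c)"
    "v = (\<Sum>c\<in>C. w c)"
proof -
  interpret vspace s by fact
  obtain n r where r: "(T ^^ n) v = (\<Sum>i<n. s (r i) ((T ^^ i) v))"
    using power_relation[OF N(2,3) v] by blast
  define p where "p = monom 1 n - (\<Sum>i<n. monom (r i) i)"
  have cf: "coeff p i = (if i = n then 1 else if i < n then - r i else 0)" for i
  proof -
    have "(\<Sum>j<n. coeff (monom (r j) j) i) = (\<Sum>j<n. if j = i then r i else 0)"
      by (intro sum.cong) auto
    then show ?thesis by (simp add: p_def coeff_sum)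
  qed
  have "p \<noteq> 0" using cf[of n] by auto
  moreover have "degree p \<le> n" by (rule degree_le) (auto simp: cf)
  moreover have "(\<Sum>i\<le>n. s (coeff p i) ((T ^^ i) v)) = (\<Sum>i<n. s (coeff p i) ((T ^^ i) v)) + (T ^^ n) v"
    by (simp add: lessThan_Suc_atMost[symmetric] cf)
  moreover have "(\<Sum>i<n. s (coeff p i) ((T ^^ i) v)) = - (\<Sum>i<n. s (r i) ((T ^^ i) v))"
    unfolding sum_negf[symmetric] by (intro sum.cong) (auto simp: cf)
  ultimately show ?thesis
    using geig_decomposition_poly[OF s T N(1,3), of p n v] v r that by (metis add.left_inverse)
qed

section \<open>Cartan's criterion\<close>

text \<open>Function types become vector spaces again, so the results on generalised eigenvectors
  apply also to \<open>commutator A\<close>, an operator on operators.\<close>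

definition fun_scale :: "('f \<Rightarrow> 'u \<Rightarrow> 'u) \<Rightarrow> 'f \<Rightarrow> ('a \<Rightarrow> 'u) \<Rightarrow> ('a \<Rightarrow> 'u)" where
  "fun_scale s c f = (\<lambda>x. s c (f x))"

lemma fun_scale_apply [simp]: "fun_scale s c f x = s c (f x)"
  by (simp add: fun_scale_def)

lemma vspace_fun_scale:
  assumes "vspace s" shows "vspace (fun_scale s)"
proof -
  interpret vspace s by fact
  show ?thesis by unfold_locales (auto simp: fun_eq_iff algebra_simps)
qed

lemma sum_fun_apply [simp]: "(\<Sum>i\<in>I. f i) x = (\<Sum>i\<in>I. f i x)"
  by (induction I rule: infinite_finite_induct) auto

definition commutator :: "('u \<Rightarrow> 'u) \<Rightarrow> ('u \<Rightarrow> 'u) \<Rightarrow> ('u::ab_group_add \<Rightarrow> 'u)" where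
  "commutator a b = (\<lambda>u. a (b u) - b (a u))"

text \<open>The field is a vector space over the rationals in which {l} is independent. Rational
  values are the point: a sum of squares of such values vanishes only termwise.\<close>

lemma rational_functional:
  fixes l :: "'k::field_char_0"
  assumes "l \<noteq> 0"
  obtains f :: "'k \<Rightarrow> rat" where "\<And>x y. f (x + y) = f x + f y" "\<And>q x. f (of_rat q * x) = q * f x" "f l = 1"
proof -
  interpret p: vector_space_pair "\<lambda>q (x::'k). of_rat q * x" "(*) :: rat \<Rightarrow> rat \<Rightarrow> rat"
    by unfold_locales (auto simp: algebra_simps of_rat_add of_rat_mult)
  have "p.vs1.independent {l}" using assms by simp
  from p.linear_independent_extend[OF this, of "\<lambda>_. 1"] obtain f where
    f: "Vector_Spaces.linear (\<lambda>q (x::'k). of_rat q * x) (*) f" "f l = 1" by auto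
  then show ?thesis using that by (auto simp: Vector_Spaces.linear_iff)
qed

context vspace
begin

lemma linear_on_basis:
  assumes "basis_of U B"
  obtains y where "Vector_Spaces.linear scale scale y" "\<And>b. b \<in> B \<Longrightarrow> y b = g b"
proof -
  interpret p: vector_space_pair scale scale by unfold_locales
  show ?thesis using p.linear_independent_extend[of B g] assms that unfolding basis_of_def by auto
qed

lemma linear_eq_on_basis:
  assumes "basis_of U B" "Vector_Spaces.linear scale scale f" "Vector_Spaces.linear scale scale g"
    "\<And>b. b \<in> B \<Longrightarrow> f b = g b" "u \<in> U"
  shows "f u = g u"
proof -
  interpret p: vector_space_pair scale scale by unfold_locales
  show ?thesis using p.linear_eq_on[OF assms(2,3), of u B] assms(1,4,5) unfolding basis_of_def by auto
qed

lemma linear_image_on_basis: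
  assumes "basis_of U B" "Vector_Spaces.linear scale scale f" "\<And>b. b \<in> B \<Longrightarrow> f b \<in> W" "subspace W"
  shows "f ` U \<subseteq> W"
proof -
  interpret f: Vector_Spaces.linear scale scale f by fact
  have "f ` U = span (f ` B)" using assms(1) f.span_image unfolding basis_of_def by auto
  also have "\<dots> \<subseteq> W" using assms by (intro span_minimal) auto
  finally show ?thesis .
qed

text \<open>\<open>y\<close> is prescribed only on a basis of generalised eigenvectors, but it is
  the scalar \<open>g c\<close> on every generalised eigenvector for \<open>c\<close>: by
  \<open>geig_independent\<close> such a vector equals the part of its expansion that belongs to
  \<open>c\<close>.\<close>

lemma eigenvalue_map:
  assumes T: "Vector_Spaces.linear scale scale T"
    and B: "basis_of U B" "\<And>b. b \<in> B \<Longrightarrow> geig T (lam b) b"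
    and y: "Vector_Spaces.linear scale scale y" "\<And>b. b \<in> B \<Longrightarrow> y b = scale (g (lam b)) b"
    and v: "v \<in> U" "geig T c v"
  shows "y v = scale (g c) v"
proof -
  interpret y: Vector_Spaces.linear scale scale y by fact
  have fB: "finite B" using B by (simp add: basis_of_def)
  define r where "r = representation B v"
  define W where "W = (\<lambda>q. \<Sum>b\<in>{b \<in> B. lam b = q}. scale (r b) b)"
  have gW: "geig T q (W q)" for q
    unfolding W_def by (intro geig_sum[OF T] geig_scale[OF T]) (use B in auto)
  define C where "C = insert c (lam ` B)"
  have "(\<Sum>q\<in>C. W q) = (\<Sum>b\<in>B. scale (r b) b)"
    unfolding W_def C_def using fB by (intro sum.group) auto
  also have "\<dots> = v" unfolding r_def by (rule representation_expand[OF B(1) v(1)])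
  finally have s: "(\<Sum>q\<in>C. W q) = v" .
  \<comment> \<open>Subtracting \<open>v\<close> from the group for \<open>c\<close> gives a
    vanishing sum of generalised eigenvectors for distinct eigenvalues. The set \<open>C\<close>
    contains \<open>c\<close> even if no basis vector belongs to it.\<close>
  define Z where "Z = (\<lambda>q. W q + scale (-1) (if q = c then v else 0))"
  have "geig T q (Z q)" for q
    unfolding Z_def by (intro geig_add[OF T] geig_scale[OF T] gW) (use v geig_0[OF T] in auto)
  moreover have "(\<Sum>q\<in>C. Z q) = 0" using s fB
    by (simp add: Z_def sum_subtractf C_def sum.delta)
  moreover have "finite C" "c \<in> C" using fB by (auto simp: C_def)
  ultimately have "Z c = 0" using geig_independent[OF T, of C Z c] by blast
  then have vW: "v = W c" by (simp add: Z_def)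
  have "y (W c) = (\<Sum>b\<in>{b \<in> B. lam b = c}. scale (r b) (scale (g c) b))"
    unfolding W_def y.sum y.scale using y(2) by (intro sum.cong) auto
  also have "\<dots> = scale (g c) (W c)" unfolding W_def scale_sum_right by (simp add: mult.commute)
  finally show ?thesis using vW by simp
qed

text \<open>Weights add: (A - l - c) z v = ([A, z] - c z) v + z (A - l) v, and each term on the
  right has a smaller total exponent. Hence the induction on \<open>j + k\<close>; if an exponent is
  0, then z or v is already 0.\<close>

lemma geig_commutator:
  assumes A: "Vector_Spaces.linear scale scale A"
    and lin: "\<And>b. b \<in> B \<Longrightarrow> Vector_Spaces.linear scale scale b"
    and clo: "\<And>b. b \<in> B \<Longrightarrow> commutator A b \<in> B" and B: "module.subspace (fun_scale scale) B"
    and z: "z \<in> B" "vspace.geig (fun_scale scale) (commutator A) c z" and v: "geig A l v"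
  shows "geig A (l + c) (z v)"
proof -
  interpret F: vspace "fun_scale scale" by (rule vspace_fun_scale) unfold_locales
  let ?D = "\<lambda>b. commutator A b - fun_scale scale c b" and ?E = "\<lambda>u. A u - scale l u"
  have main: "\<And>j k z v. j + k = n \<Longrightarrow> z \<in> B \<Longrightarrow> (?D ^^ j) z = 0 \<Longrightarrow> (?E ^^ k) v = 0 \<Longrightarrow> geig A (l + c) (z v)" for n
  proof (induction n)
    case 0
    then show ?case using geig_0[OF A] by simp
  next
    case (Suc n)
    interpret z: Vector_Spaces.linear scale scale z using lin Suc.prems by simp
    have Dz: "?D z \<in> B" using Suc.prems clo B by (intro F.subspace_diff F.subspace_scale) auto
    have 1: "geig A (l + c) (?D z v)"
    proof (cases j)
      case 0 with Suc.prems show ?thesis using geig_0[OF A]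
        by (simp add: commutator_def fun_eq_iff) (metis Vector_Spaces.linear_iff A scale_zero_right scale_zero_left diff_zero)
    next
      case (Suc j')
      then have "(?D ^^ j') (?D z) = 0" using Suc.prems(3) by (metis comp_apply funpow_Suc_right)
      moreover have "j' + k = n" using Suc Suc.prems(1) by simp
      ultimately show ?thesis by (rule Suc.IH[OF _ Dz _ Suc.prems(4), rotated])
    qed
    have 2: "geig A (l + c) (z (?E v))"
    proof (cases k)
      case 0 with Suc.prems show ?thesis using geig_0[OF A] A
        by (simp add: Vector_Spaces.linear_iff) (metis scale_zero_right scale_zero_left z.scale)
    next
      case (Suc k')
      then have "(?E ^^ k') (?E v) = 0" using Suc.prems(4) by (metis comp_apply funpow_Suc_right)
      moreover have "j + k' = n" using Suc Suc.prems(1) by simp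
      ultimately show ?thesis by (rule Suc.IH[OF _ Suc.prems(2,3), rotated])
    qed
    have "A (z v) - scale (l + c) (z v) = ?D z v + z (?E v)"
      by (simp add: commutator_def z.diff z.scale algebra_simps)
    then have "geig A (l + c) (A (z v) - scale (l + c) (z v))" using geig_add[OF A 1 2] by simp
    then show ?case by (rule geig_SucI)
  qed
  obtain j k where "(?D ^^ j) z = 0" "(?E ^^ k) v = 0"
    using z(2) v unfolding F.geig_def geig_def by blast
  with main z(1) show ?thesis by blast
qed

end

lemma geig_basis:
  fixes s :: "'k::alg_closed_field \<Rightarrow> 'u::ab_group_add \<Rightarrow> 'u"
  assumes s: "vspace s" and U: "module.subspace s U" "vspace.fdim s U"
    and A: "Vector_Spaces.linear s s A" "A ` U \<subseteq> U"
  obtains B lam where "vspace.basis_of s U B" "\<And>b. b \<in> B \<Longrightarrow> vspace.geig s A (lam b) b"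
proof -
  interpret vspace s by fact
  let ?G = "{v \<in> U. \<exists>c. geig A c v}"
  have "U \<subseteq> span ?G"
  proof
    fix v assume "v \<in> U"
    from geig_decomposition[OF s A(1) U A(2) this] obtain C w where
      "\<And>c. c \<in> C \<Longrightarrow> w c \<in> U" "\<And>c. c \<in> C \<Longrightarrow> geig A c (w c)" "v = (\<Sum>c\<in>C. w c)" by metis
    then show "v \<in> span ?G" by (metis (mono_tags, lifting) mem_Collect_eq span_sum span_base)
  qed
  then obtain B where B: "basis_of U B" "B \<subseteq> ?G"
    using basis_of_subset_exists[OF U, of ?G] by auto
  then have "\<forall>b\<in>B. \<exists>c. geig A c b" by auto
  then show ?thesis using that B by metis
qed

text \<open>For an additive \<open>f\<close> from the field to the rationals let \<open>y\<close> act on the generalised eigenspace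
  of \<open>A\<close> to the eigenvalue \<open>c\<close> as \<open>f c\<close>. Bracketing with \<open>y\<close> preserves the operator space, so perfectness
  gives \<open>tr (A y) = 0\<close>, that is \<open>\<Sum> \<lambda> f(\<lambda>) = 0\<close>, hence \<open>\<Sum> f(\<lambda>)\<^sup>2 = 0\<close>.\<close>

lemma perfect_trace_zero_nilpotent:
  fixes s :: "'k::{alg_closed_field, field_char_0} \<Rightarrow> 'u::ab_group_add \<Rightarrow> 'u"
  assumes s: "vspace s" and U: "module.subspace s U" "vspace.fdim s U"
    and B: "module.subspace (fun_scale s) B" "vspace.fdim (fun_scale s) B"
    and lin: "\<And>b. b \<in> B \<Longrightarrow> Vector_Spaces.linear s s b"
    and inv: "\<And>b. b \<in> B \<Longrightarrow> b ` U \<subseteq> U"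
    and clo: "\<And>a b. a \<in> B \<Longrightarrow> b \<in> B \<Longrightarrow> commutator a b \<in> B"
    and perfect: "B \<subseteq> module.span (fun_scale s) {commutator a b | a b. a \<in> B \<and> b \<in> B}"
    and tr: "\<And>a b. a \<in> B \<Longrightarrow> b \<in> B \<Longrightarrow> vspace.trace_on s U (\<lambda>u. a (b u)) = 0"
    and A: "A \<in> B" and u: "u \<in> U"
  shows "\<exists>k. (A ^^ k) u = 0"
proof -
  interpret vspace s by fact
  interpret F: vspace "fun_scale s" by (rule vspace_fun_scale) fact
  note lX = lin[OF A] and iX = inv[OF A]
  have lD: "Vector_Spaces.linear (fun_scale s) (fun_scale s) (commutator A)"
    using lX by (auto simp: Vector_Spaces.linear_iff commutator_def fun_eq_iff F.vector_space_axioms algebra_simps)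
  obtain E lam where E: "basis_of U E" "\<And>b. b \<in> E \<Longrightarrow> geig A (lam b) b"
    using geig_basis[OF s U lX iX] by blast
  have fE: "finite E" and EU: "E \<subseteq> U" and iE: "independent E"
    using E basis_of_subset by (auto simp: basis_of_def)
  have sum0: "(\<Sum>b\<in>E. of_rat (f (lam b)) * lam b) = 0"
    if f: "\<And>x y. f (x + y) = f x + f y" for f :: "'k \<Rightarrow> rat"
  proof -
    define g where "g = (\<lambda>x. of_rat (f x) :: 'k)"
    have g: "g (x + y) = g x + g y" for x y by (simp add: g_def f of_rat_add)
    obtain y where y: "Vector_Spaces.linear s s y" "\<And>b. b \<in> E \<Longrightarrow> y b = s (g (lam b)) b"
      using linear_on_basis[OF E(1), of "\<lambda>b. s (g (lam b)) b"] by blast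
    obtain d where d: "Vector_Spaces.linear s s d" "\<And>b. b \<in> E \<Longrightarrow> d b = s (lam b) b"
      using linear_on_basis[OF E(1), of "\<lambda>b. s (lam b) b"] by blast
    interpret y: Vector_Spaces.linear s s y by (rule y(1))
    interpret d: Vector_Spaces.linear s s d by (rule d(1))
    interpret A: Vector_Spaces.linear s s A by (rule lX)
    have yv: "y v = s (g c) v" if "v \<in> U" "geig A c v" for c v
      by (rule eigenvalue_map[OF lX E y that])
    have dv: "d v = s c v" if "v \<in> U" "geig A c v" for c v
      by (rule eigenvalue_map[OF lX E d that])
    have yU: "y ` U \<subseteq> U" by (rule linear_image_on_basis[OF E(1) y(1) _ U(1)])
      (use y(2) EU U(1) in \<open>auto simp: subspace_scale\<close>)
    have dU: "d ` U \<subseteq> U" by (rule linear_image_on_basis[OF E(1) d(1) _ U(1)])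
      (use d(2) EU U(1) in \<open>auto simp: subspace_scale\<close>)
    \<comment> \<open>A component \<open>w c\<close> of \<open>b\<close> under
      \<open>commutator A\<close> moves generalised eigenvectors for l to ones for l + c, where
      \<open>y\<close> differs by g (l + c) - g l = g c. So \<open>b'\<close> is the sum of the
      components rescaled by \<open>g c\<close>, all of which lie in \<open>B\<close>.\<close>
    have yb: "\<exists>b'\<in>B. \<forall>u\<in>U. y (b u) - b (y u) = b' u" if b: "b \<in> B" for b
    proof -
      have "commutator A ` B \<subseteq> B" using clo A by auto
      from geig_decomposition[OF F.vspace_axioms lD B this b] obtain C w where
        w: "finite C" "\<And>c. c \<in> C \<Longrightarrow> w c \<in> B" "\<And>c. c \<in> C \<Longrightarrow> F.geig (commutator A) c (w c)"
          "b = (\<Sum>c\<in>C. w c)" by metis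
      define b' where "b' = (\<Sum>c\<in>C. fun_scale s (g c) (w c))"
      have b': "b' \<in> B" unfolding b'_def using w B by (intro F.subspace_sum F.subspace_scale) auto
      have lb: "Vector_Spaces.linear s s (\<lambda>u. y (b u) - b (y u))"
        using lin[OF b] y(1) by (auto simp: Vector_Spaces.linear_iff algebra_simps)
      have on_E: "y (b e) - b (y e) = b' e" if e: "e \<in> E" for e
      proof -
        have eU: "e \<in> U" using e EU by auto
        have 1: "y (w c e) - w c (y e) = s (g c) (w c e)" if c: "c \<in> C" for c
        proof -
          interpret w: Vector_Spaces.linear s s "w c" using lin w(2)[OF c] by simp
          have "w c e \<in> U" using inv[OF w(2)[OF c]] eU by auto
          moreover have "geig A (lam e + c) (w c e)"
            using geig_commutator[OF lX lin clo[OF A] B(1) w(2)[OF c] w(3)[OF c] E(2)[OF e]] by blast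
          ultimately show ?thesis
            using yv[of "w c e" "lam e + c"] y(2)[OF e] by (simp add: w.scale g algebra_simps)
        qed
        have "y (b e) - b (y e) = (\<Sum>c\<in>C. y (w c e) - w c (y e))"
          by (simp add: w(4) y.sum sum_subtractf)
        also have "\<dots> = b' e" using 1 by (simp add: b'_def)
        finally show ?thesis .
      qed
      show ?thesis using linear_eq_on_basis[OF E(1) lb lin[OF b'] on_E] b' by blast
    qed
    \<comment> \<open>Orthogonality to \<open>y\<close> under the trace is a linear condition, so it
      may be checked on commutators, of which \<open>A\<close> is a combination.\<close>
    let ?Z = "{Z. Vector_Spaces.linear s s Z \<and> Z ` U \<subseteq> U \<and> trace_on U (\<lambda>u. Z (y u)) = 0}"
    have lc: "Vector_Spaces.linear s s (\<lambda>u. Z (y u))" "(\<lambda>u. Z (y u)) ` U \<subseteq> U"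
      if "Vector_Spaces.linear s s Z" "Z ` U \<subseteq> U" for Z
      using that y(1) yU by (auto simp: Vector_Spaces.linear_iff)
    have "F.subspace ?Z"
    proof (rule F.subspaceI)
      have z: "Vector_Spaces.linear s s (\<lambda>u. 0)" by (simp add: Vector_Spaces.linear_iff vector_space_axioms)
      then have "trace_on U (\<lambda>u. 0) = 0" using trace_on_scale[OF U z, of 0] subspace_0[OF U(1)] by auto
      then show "0 \<in> ?Z" using z subspace_0[OF U(1)] by (auto simp: zero_fun_def)
      show "a + b \<in> ?Z" if "a \<in> ?Z" "b \<in> ?Z" for a b
      proof -
        have "trace_on U (\<lambda>u. a (y u) + b (y u)) = 0"
          using that trace_on_add[OF U lc[of a] lc[of b]] by simp
        moreover have "Vector_Spaces.linear s s (a + b)"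
          using that by (simp add: Vector_Spaces.linear_iff algebra_simps)
        moreover have "(a + b) ` U \<subseteq> U"
          using that subspace_add[OF U(1)] by (auto simp: image_subset_iff)
        ultimately show ?thesis by simp
      qed
      show "fun_scale s c a \<in> ?Z" if "a \<in> ?Z" for c a
      proof -
        have "trace_on U (\<lambda>u. s c (a (y u))) = 0"
          using that trace_on_scale[OF U lc[of a]] by simp
        moreover have "Vector_Spaces.linear s s (fun_scale s c a)"
          using that by (auto simp: Vector_Spaces.linear_iff algebra_simps)
        moreover have "(fun_scale s c a) ` U \<subseteq> U"
          using that subspace_scale[OF U(1)] by (auto simp: image_subset_iff)
        ultimately show ?thesis by simp
      qed
    qed
    moreover have "commutator a b \<in> ?Z" if a: "a \<in> B" and b: "b \<in> B" for a b
    proof -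
      obtain b' where b': "b' \<in> B" "\<And>u. u \<in> U \<Longrightarrow> y (b u) - b (y u) = b' u" using yb[OF b] by blast
      interpret a: Vector_Spaces.linear s s a using lin[OF a] .
      interpret b: Vector_Spaces.linear s s b using lin[OF b] .
      interpret b': Vector_Spaces.linear s s b' using lin[OF b'(1)] .
      have lay: "Vector_Spaces.linear s s (\<lambda>u. a (y u))" "(\<lambda>u. a (y u)) ` U \<subseteq> U"
        using lc[OF lin[OF a] inv[OF a]] .
      have l1: "Vector_Spaces.linear s s (\<lambda>u. s (-1) (b (a (y u))))" 
        "Vector_Spaces.linear s s (\<lambda>u. a (b (y u)))" "Vector_Spaces.linear s s (\<lambda>u. s (-1) (a (y (b u))))"
        "Vector_Spaces.linear s s (\<lambda>u. b (a (y u)))" "Vector_Spaces.linear s s (\<lambda>u. a (y (b u)))"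
        "Vector_Spaces.linear s s (\<lambda>u. a (b' u))"
        using lin[OF a] lin[OF b] lin[OF b'(1)] y(1) by (auto simp: Vector_Spaces.linear_iff algebra_simps)
      have m: "a u \<in> U" "b u \<in> U" "y u \<in> U" "b' u \<in> U" if "u \<in> U" for u
        using that inv[OF a] inv[OF b] inv[OF b'(1)] yU by auto
      have i1: "(\<lambda>u. s (-1) (b (a (y u)))) ` U \<subseteq> U" "(\<lambda>u. a (b (y u))) ` U \<subseteq> U"
        "(\<lambda>u. s (-1) (a (y (b u)))) ` U \<subseteq> U" "(\<lambda>u. b (a (y u))) ` U \<subseteq> U"  "(\<lambda>u. a (y (b u))) ` U \<subseteq> U"
        "(\<lambda>u. a (b' u)) ` U \<subseteq> U"
        using m U(1) by (auto simp: subspace_scale subspace_neg)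
      \<comment> \<open>By cyclicity tr([a, b] y) = tr(a [b, y]), and [b, y] agrees on
        \<open>U\<close> with the negative of \<open>b'\<close>, so the hypothesis on traces
        applies.\<close>
      have "trace_on U (\<lambda>u. commutator a b (y u)) = trace_on U (\<lambda>u. a (b (y u)) + s (-1) (b (a (y u))))"
        by (simp add: commutator_def)
      also have "\<dots> = trace_on U (\<lambda>u. a (b (y u))) - trace_on U (\<lambda>u. b (a (y u)))"
        by (subst trace_on_add[OF U l1(2) i1(2) l1(1) i1(1)], subst trace_on_scale[OF U l1(4) i1(4)]) simp
      also have "trace_on U (\<lambda>u. b (a (y u))) = trace_on U (\<lambda>u. a (y (b u)))"
        by (rule trace_on_commute[OF U lin[OF b] inv[OF b] lay])
      also have "trace_on U (\<lambda>u. a (b (y u))) - trace_on U (\<lambda>u. a (y (b u)))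
          = trace_on U (\<lambda>u. a (b (y u)) + s (-1) (a (y (b u))))"
        by (subst trace_on_add[OF U l1(2) i1(2) l1(3) i1(3)], subst trace_on_scale[OF U l1(5) i1(5)]) simp
      also have "\<dots> = trace_on U (\<lambda>u. s (-1) (a (b' u)))"
        by (rule trace_on_cong[OF U]) (simp add: b'(2)[symmetric] a.diff)
      also have "\<dots> = 0" using trace_on_scale[OF U l1(6) i1(6), of "-1"] tr[OF a b'(1)] by simp
      finally show ?thesis
        using lin[OF clo[OF a b]] inv[OF clo[OF a b]] by simp
    qed
    ultimately have "F.span {commutator a b | a b. a \<in> B \<and> b \<in> B} \<subseteq> ?Z"
      by (intro F.span_minimal) auto
    then have trXy: "trace_on U (\<lambda>u. A (y u)) = 0" using perfect A by auto
    \<comment> \<open>\<open>d\<close> is the diagonal part of \<open>A\<close>. On generalised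
      eigenvectors for \<open>c\<close> the operator \<open>R\<close> is g c times A - c, hence
      nilpotent, and tr(A y) reduces to tr(d y).\<close>
    define R where "R = (\<lambda>u. A (y u) - d (y u))"
    have lR: "Vector_Spaces.linear s s R" unfolding R_def
      using lX d(1) y(1) by (auto simp: Vector_Spaces.linear_iff algebra_simps)
    interpret R: Vector_Spaces.linear s s R by (rule lR)
    have RU: "R ` U \<subseteq> U" unfolding R_def using iX dU yU U(1) by (auto simp: image_subset_iff intro!: subspace_diff)
    have R_pow: "v \<in> U \<Longrightarrow> geig A c v \<Longrightarrow> ((\<lambda>u. A u - s c u) ^^ k) v = 0 \<Longrightarrow> geig R 0 v" for c v k
    proof (induction k arbitrary: v)
      case 0 then show ?case using geig_0[OF lR] by simp
    next
      case (Suc k)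
      let ?v = "A v - s c v"
      have vU: "?v \<in> U" using Suc.prems iX U(1) by (auto intro!: subspace_diff subspace_scale)
      have gv: "geig A c ?v" using geig_shift_invariant[OF lX Suc.prems(2), where d = c and j = 1] by simp
      have "R v - s 0 v = s (g c) ?v"
        using yv[OF Suc.prems(1,2)] dv[OF Suc.prems(1,2)]
        by (simp add: R_def A.scale d.scale scale_right_diff_distrib)
      moreover have "((\<lambda>u. A u - s c u) ^^ k) ?v = 0" using Suc.prems(3) by (metis comp_apply funpow_Suc_right)
      then have "geig R 0 ?v" by (rule Suc.IH[OF vU gv])
      ultimately show ?case using geig_scale[OF lR] geig_SucI by metis
    qed
    have RE: "geig R 0 e" if "e \<in> E" for e
      using R_pow[of e] E(2)[OF that] EU that unfolding geig_def[of A] by blast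
    have "\<exists>k. (R ^^ k) v = 0" if "v \<in> U" for v
    proof -
      have "geig R 0 (\<Sum>b\<in>E. s (representation E v b) b)"
        by (intro geig_sum[OF lR] geig_scale[OF lR] RE)
      then show ?thesis using representation_expand[OF E(1) that] by (simp add: geig_def)
    qed
    then have trR: "trace_on U R = 0" using trace_on_nilpotent[OF U lR RU] by blast
    have ldy: "Vector_Spaces.linear s s (\<lambda>u. d (y u))" "(\<lambda>u. d (y u)) ` U \<subseteq> U" using lc[OF d(1) dU] .
    have "trace_on U (\<lambda>u. A (y u)) = trace_on U (\<lambda>u. R u + d (y u))" by (simp add: R_def)
    also have "\<dots> = trace_on U R + trace_on U (\<lambda>u. d (y u))" by (rule trace_on_add[OF U lR RU ldy])
    finally have "trace_on U (\<lambda>u. d (y u)) = 0" using trXy trR by simp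
    moreover have "trace_on U (\<lambda>u. d (y u)) = (\<Sum>b\<in>E. g (lam b) * lam b)"
      unfolding trace_on_eq[OF E(1) ldy]
      using y(2) d(2) d.scale by (intro sum.cong) (auto simp: representation_scale[OF iE] span_base
          representation_basis[OF iE] span_scale)
    ultimately show ?thesis by (simp add: g_def)
  qed
  have "lam b = 0" if b: "b \<in> E" for b
  proof (rule ccontr)
    assume "lam b \<noteq> 0"
    then obtain f :: "'k \<Rightarrow> rat" where f: "\<And>x y. f (x + y) = f x + f y"
      "\<And>q x. f (of_rat q * x) = q * f x" "f (lam b) = 1" using rational_functional by blast
    have f0: "f 0 = 0" using f(1)[of 0 0] by simp
    have fs: "f (\<Sum>i\<in>I. h i) = (\<Sum>i\<in>I. f (h i))" for I :: "'u set" and h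
      by (induction I rule: infinite_finite_induct) (auto simp: f0 f(1))
    \<comment> \<open>Apply \<open>f\<close> to the relation \<open>sum0\<close>: its coefficients
      f(lam b) are rational and can be pulled out.\<close>
    have "(\<Sum>b\<in>E. f (lam b) * f (lam b)) = 0"
      using sum0[of f, OF f(1)] fs[of "\<lambda>b. of_rat (f (lam b)) * lam b" E] f0 by (simp add: f(2))
    then have "f (lam b) * f (lam b) = 0" using fE b by (subst (asm) sum_nonneg_eq_0_iff) auto
    then show False using f(3) by simp
  qed
  then have "geig A 0 e" if "e \<in> E" for e using E(2)[OF that] that by simp
  then have "geig A 0 (\<Sum>b\<in>E. s (representation E u b) b)"
    by (intro geig_sum[OF lX] geig_scale[OF lX])
  then show ?thesis using representation_expand[OF E(1) u] by (simp add: geig_def)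
qed

section \<open>Base change to the algebraic closure\<close>

definition delta :: "'m \<Rightarrow> 'm \<Rightarrow> 'k::zero_neq_one" where
  "delta b = (\<lambda>x. if x = b then 1 else 0)"

lemma vspace_mult: "vspace ((*) :: 'k::field \<Rightarrow> 'k \<Rightarrow> 'k)"
  by unfold_locales (auto simp: algebra_simps)

lemma vspace_coord: "vspace (fun_scale ((*) :: 'k::field \<Rightarrow> 'k \<Rightarrow> 'k))"
  by (rule vspace_fun_scale[OF vspace_mult])

lemma coord_expand:
  fixes u :: "'m \<Rightarrow> 'k::field"
  assumes "finite B" "\<And>x. x \<notin> B \<Longrightarrow> u x = 0"
  shows "(\<Sum>b\<in>B. fun_scale (*) (u b) (delta b)) = u"
proof
  fix x
  have "(\<Sum>b\<in>B. u b * delta b x) = (\<Sum>b\<in>B. if x = b then u b else 0)"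
    by (intro sum.cong) (auto simp: delta_def)
  then show "(\<Sum>b\<in>B. fun_scale (*) (u b) (delta b)) x = u x"
    using assms by (auto simp: sum.delta)
qed

lemma coord_basis:
  assumes "finite B"
  shows "vspace.basis_of (fun_scale ((*) :: 'k::field \<Rightarrow> 'k \<Rightarrow> 'k)) {u. \<forall>x. x \<notin> B \<longrightarrow> u x = 0} (delta ` B)"
    and "u \<in> {u. \<forall>x. x \<notin> B \<longrightarrow> u x = 0} \<Longrightarrow> b \<in> B \<Longrightarrow>
      module.representation (fun_scale ((*) :: 'k \<Rightarrow> 'k \<Rightarrow> 'k)) (delta ` B) u (delta b) = u b"
proof -
  interpret K: vspace "fun_scale ((*) :: 'k \<Rightarrow> 'k \<Rightarrow> 'k)" by (rule vspace_coord)
  let ?U = "{u :: _ \<Rightarrow> 'k. \<forall>x. x \<notin> B \<longrightarrow> u x = 0}"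
  have inj: "inj_on (delta :: _ \<Rightarrow> _ \<Rightarrow> 'k) B"
    by (auto simp: inj_on_def delta_def fun_eq_iff)
  have ind: "K.independent (delta ` B)"
  proof (rule K.independent_if_scalars_zero)
    show "finite (delta ` B :: (_ \<Rightarrow> 'k) set)" using assms by simp
    fix f :: "(_ \<Rightarrow> 'k) \<Rightarrow> 'k" and x :: "_ \<Rightarrow> 'k"
    assume z: "(\<Sum>x\<in>delta ` B. fun_scale (*) (f x) x) = 0" and "x \<in> delta ` B"
    then obtain b where b: "b \<in> B" "x = delta b" by auto
    have "(\<Sum>c\<in>B. f (delta c) * delta c b) = 0"
      using fun_cong[OF z, of b] inj by (simp add: sum.reindex)
    moreover have "(\<Sum>c\<in>B. f (delta c) * delta c b) = (\<Sum>c\<in>B. if b = c then f (delta c) else 0)"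
      by (intro sum.cong) (auto simp: delta_def)
    ultimately show "f x = 0" using assms b by (simp add: sum.delta)
  qed
  have sub: "K.subspace ?U" by (rule K.subspaceI) auto
  have "?U \<subseteq> K.span (delta ` B)"
  proof
    fix u :: "_ \<Rightarrow> 'k" assume "u \<in> ?U"
    then have "u = (\<Sum>b\<in>B. fun_scale (*) (u b) (delta b))" using coord_expand[OF assms, of u] by simp
    also have "\<dots> \<in> K.span (delta ` B)" by (intro K.span_sum K.span_scale K.span_base imageI)
    finally show "u \<in> K.span (delta ` B)" .
  qed
  moreover have "K.span (delta ` B) \<subseteq> ?U"
    by (rule K.span_minimal[OF _ sub]) (auto simp: delta_def)
  ultimately show "K.basis_of ?U (delta ` B)" using assms ind by (simp add: K.basis_of_def)
  assume u: "u \<in> ?U" and b: "b \<in> B"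
  have "K.representation (delta ` B) u = K.representation (delta ` B) (\<Sum>b\<in>B. fun_scale (*) (u b) (delta b))"
    using coord_expand[OF assms, of u] u by simp
  also have "\<dots> = (\<lambda>d. \<Sum>b\<in>B. u b * K.representation (delta ` B) (delta b) d)"
  proof -
    have sp: "delta b \<in> K.span (delta ` B)" if "b \<in> B" for b using that by (intro K.span_base imageI)
    have "K.representation (delta ` B) (\<Sum>b\<in>B. fun_scale (*) (u b) (delta b))
        = (\<lambda>d. \<Sum>b\<in>B. K.representation (delta ` B) (fun_scale (*) (u b) (delta b)) d)"
      by (rule K.representation_sum[OF ind]) (intro K.span_scale sp)
    then show ?thesis
      using K.representation_scale[OF ind sp] by (simp add: fun_eq_iff)
  qed
  finally have "K.representation (delta ` B) u (delta b)
      = (\<Sum>c\<in>B. u c * K.representation (delta ` B) (delta c) (delta b))" by simp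
  also have "\<dots> = (\<Sum>c\<in>B. if b = c then u c else 0)"
    using inj b by (intro sum.cong) (auto simp: K.representation_basis[OF ind] inj_on_def)
  finally show "K.representation (delta ` B) u (delta b) = u b" using assms b by (simp add: sum.delta)
qed

context vspace
begin

text \<open>Extension of scalars by matrices: a coordinate vector is a function that vanishes
  outside \<open>B\<close>, and T acts by its matrix in the basis \<open>B\<close> with entries
  embedded in the algebraic closure. The outer condition keeps values supported on
  \<open>B\<close>.\<close>

definition base_change :: "'b set \<Rightarrow> ('b \<Rightarrow> 'b) \<Rightarrow> ('b \<Rightarrow> 'a alg_closure) \<Rightarrow> ('b \<Rightarrow> 'a alg_closure)" where
  "base_change B T u = (\<lambda>x. if x \<in> B then \<Sum>b\<in>B. to_ac (representation B (T b) x) * u b else 0)"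

lemma base_change_linear: "Vector_Spaces.linear (fun_scale (*)) (fun_scale (*)) (base_change B T)"
  using vspace_coord[where 'k = "'a alg_closure"]
  by (auto simp: Vector_Spaces.linear_iff base_change_def vspace_def fun_eq_iff algebra_simps
    sum.distrib sum_distrib_left)

lemma base_change_cong: "(\<And>b. b \<in> B \<Longrightarrow> T b = T' b) \<Longrightarrow> base_change B T = base_change B T'"
  by (auto simp: base_change_def fun_eq_iff)

lemma base_change_comp:
  assumes B: "basis_of M B" and T: "Vector_Spaces.linear scale scale T" "T ` M \<subseteq> M" and T': "T' ` M \<subseteq> M"
  shows "base_change B T (base_change B T' u) = base_change B (\<lambda>v. T (T' v)) u"
proof
  fix x
  interpret T: Vector_Spaces.linear scale scale T by (rule T)
  have iB: "independent B" and BM: "B \<subseteq> M" using B basis_of_subset by (auto simp: basis_of_def)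
  have rep: "representation B (T (T' b)) x = (\<Sum>c\<in>B. representation B (T c) x * representation B (T' b) c)"
    if "b \<in> B" for b
  proof -
    have "T' b \<in> M" using that T' BM by auto
    then have "T (T' b) = T (\<Sum>c\<in>B. scale (representation B (T' b) c) c)"
      using representation_expand[OF B] by simp
    also have "\<dots> = (\<Sum>c\<in>B. scale (representation B (T' b) c) (T c))" by (simp add: T.sum T.scale)
    also have "representation B \<dots> x = (\<Sum>c\<in>B. representation B (T c) x * representation B (T' b) c)"
    proof -
      have "T c \<in> span B" if "c \<in> B" for c using that BM T B by (auto simp: basis_of_def)
      then show ?thesis
        by (subst representation_sum[OF iB]) (auto simp: span_scale representation_scale[OF iB] mult.commute)
    qed
    finally show ?thesis .
  qed
  show "base_change B T (base_change B T' u) x = base_change B (\<lambda>v. T (T' v)) u x"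
  proof (cases "x \<in> B")
    case True
    have "(\<Sum>b\<in>B. to_ac (representation B (T (T' b)) x) * u b)
      = (\<Sum>b\<in>B. \<Sum>c\<in>B. to_ac (representation B (T c) x) * (to_ac (representation B (T' b) c) * u b))"
      by (intro sum.cong) (auto simp: rep to_ac_sum sum_distrib_right mult.assoc)
    also have "\<dots> = (\<Sum>c\<in>B. to_ac (representation B (T c) x) * (\<Sum>b\<in>B. to_ac (representation B (T' b) c) * u b))"
      by (subst sum.swap) (simp add: sum_distrib_left)
    finally show ?thesis using True by (simp add: base_change_def)
  qed (simp add: base_change_def)
qed

lemma base_change_add:
  assumes "basis_of M B" "T ` M \<subseteq> M" "T' ` M \<subseteq> M"
  shows "base_change B (\<lambda>v. T v + T' v) = base_change B T + base_change B T'"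
proof -
  have "T b \<in> span B" "T' b \<in> span B" if "b \<in> B" for b
    using that assms basis_of_subset[OF assms(1)] unfolding basis_of_def by blast+
  then show ?thesis using assms(1)
    by (auto simp: base_change_def fun_eq_iff basis_of_def representation_add algebra_simps sum.distrib)
qed

lemma base_change_diff:
  assumes "basis_of M B" "T ` M \<subseteq> M" "T' ` M \<subseteq> M"
  shows "base_change B (\<lambda>v. T v - T' v) u = base_change B T u - base_change B T' u"
proof -
  have "T b \<in> span B" "T' b \<in> span B" if "b \<in> B" for b
    using that assms basis_of_subset[OF assms(1)] unfolding basis_of_def by blast+
  then show ?thesis using assms(1)
    by (auto simp: base_change_def fun_eq_iff basis_of_def representation_diff algebra_simps sum_subtractf)
qed

lemma base_change_scale:
  assumes "basis_of M B" "T ` M \<subseteq> M"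
  shows "base_change B (\<lambda>v. scale c (T v)) = fun_scale (fun_scale (*)) (to_ac c) (base_change B T)"
proof -
  have "T b \<in> span B" if "b \<in> B" for b
    using that assms basis_of_subset[OF assms(1)] by (auto simp: basis_of_def)
  then show ?thesis using assms(1)
    by (auto simp: base_change_def fun_eq_iff basis_of_def representation_scale sum_distrib_left mult.assoc)
qed

lemma base_change_trace:
  assumes B: "basis_of M B" and T: "Vector_Spaces.linear scale scale T" "T ` M \<subseteq> M"
  shows "vspace.trace_on (fun_scale (*)) {u. \<forall>x. x \<notin> B \<longrightarrow> u x = 0} (base_change B T) = to_ac (trace_on M T)"
proof -
  interpret K: vspace "fun_scale ((*) :: 'a alg_closure \<Rightarrow> _ \<Rightarrow> _)" by (rule vspace_coord)
  have fB: "finite B" using B by (simp add: basis_of_def)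
  let ?U = "{u :: _ \<Rightarrow> 'a alg_closure. \<forall>x. x \<notin> B \<longrightarrow> u x = 0}"
  have inj: "inj_on (delta :: _ \<Rightarrow> _ \<Rightarrow> 'a alg_closure) B"
    by (auto simp: inj_on_def delta_def fun_eq_iff)
  have im: "base_change B T u \<in> ?U" for u by (auto simp: base_change_def)
  then have "K.trace_on ?U (base_change B T)
      = (\<Sum>b\<in>B. K.representation (delta ` B) (base_change B T (delta b)) (delta b))"
    using K.trace_on_eq[OF coord_basis(1)[OF fB] base_change_linear[of B T]] inj by (auto simp: sum.reindex)
  also have "\<dots> = (\<Sum>b\<in>B. base_change B T (delta b) b)"
    using coord_basis(2)[OF fB im] by simp
  also have "\<dots> = (\<Sum>b\<in>B. to_ac (representation B (T b) b))"
  proof (rule sum.cong[OF refl])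
    fix b assume b: "b \<in> B"
    have "(\<Sum>c\<in>B. to_ac (representation B (T c) b) * delta b c)
        = (\<Sum>c\<in>B. if b = c then to_ac (representation B (T c) b) else 0)"
      by (intro sum.cong) (auto simp: delta_def)
    then show "base_change B T (delta b) b = to_ac (representation B (T b) b)"
      using b fB by (simp add: base_change_def sum.delta)
  qed
  finally show ?thesis by (simp add: trace_on_eq[OF B T] to_ac_sum)
qed

text \<open>Restricted to positive powers: power 0 is the identity on all functions, whereas the
  base change of the identity cuts a function down to \<open>B\<close>.\<close>

lemma base_change_funpow:
  assumes B: "basis_of M B" and T: "Vector_Spaces.linear scale scale T" "T ` M \<subseteq> M"
  shows "(base_change B T ^^ Suc k) u = base_change B (T ^^ Suc k) u"
proof (induction k)
  case (Suc k)
  have "(T ^^ Suc k) ` M \<subseteq> M" using funpow_invariant[OF T(2)] by blast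
  from base_change_comp[OF B T this, of u] Suc show ?case by (simp add: comp_def)
qed simp

text \<open>The embedding into the closure is injective, so a power of the matrix that kills the
  unit vector at \<open>b\<close> comes from a power of T that kills \<open>b\<close>.\<close>

lemma base_change_nilpotent:
  assumes B: "basis_of M B" and T: "Vector_Spaces.linear scale scale T" "T ` M \<subseteq> M"
    and nil: "\<And>b. b \<in> B \<Longrightarrow> \<exists>k. (base_change B T ^^ k) (delta b) = 0" and m: "m \<in> M"
  shows "\<exists>k. (T ^^ k) m = 0"
proof -
  have fB: "finite B" using B by (simp add: basis_of_def)
  have E: "geig T 0 b" if b: "b \<in> B" for b
  proof -
    obtain k where k: "(base_change B T ^^ k) (delta b) = 0" using nil[OF b] by blast
    have "base_change B T 0 = 0" by (auto simp: base_change_def fun_eq_iff)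
    then have "base_change B (T ^^ Suc k) (delta b) = 0"
      using k base_change_funpow[OF B T, of k "delta b"] by simp
    then have "representation B ((T ^^ Suc k) b) x = 0" if "x \<in> B" for x
    proof -
      have "(\<Sum>c\<in>B. to_ac (representation B ((T ^^ Suc k) c) x) * delta b c)
        = (\<Sum>c\<in>B. if b = c then to_ac (representation B ((T ^^ Suc k) c) x) else 0)"
        by (intro sum.cong) (auto simp: delta_def)
      also have "\<dots> = to_ac (representation B ((T ^^ Suc k) b) x)" using b fB by (simp add: sum.delta)
      finally show ?thesis using fun_cong[OF \<open>base_change B (T ^^ Suc k) (delta b) = 0\<close>, of x] that
        by (simp add: base_change_def)
    qed
    then have "(T ^^ Suc k) b = 0"
      using representation_expand[OF B funpow_invariant[OF T(2)], of b "Suc k"] basis_of_subset[OF B] b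
      by (auto simp del: funpow.simps)
    then show ?thesis unfolding geig_def by (intro exI[of _ "Suc k"]) simp
  qed
  have "geig T 0 (\<Sum>b\<in>B. scale (representation B m b) b)"
    by (intro geig_sum[OF T(1)] geig_scale[OF T(1)] E)
  then show ?thesis using representation_expand[OF B m] by (simp add: geig_def)
qed

lemma operators_subspace:
  assumes U: "subspace U"
  shows "module.subspace (fun_scale scale) {Z. Vector_Spaces.linear scale scale Z \<and> Z ` U \<subseteq> U}"
proof -
  interpret F: vspace "fun_scale scale" by (rule vspace_fun_scale) unfold_locales
  show ?thesis
  proof (rule F.subspaceI)
    show "0 \<in> {Z. Vector_Spaces.linear scale scale Z \<and> Z ` U \<subseteq> U}"
      using subspace_0[OF U] by (auto simp: Vector_Spaces.linear_iff vector_space_axioms)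
  qed (use subspace_add[OF U] subspace_scale[OF U] in
      \<open>auto simp: Vector_Spaces.linear_iff image_subset_iff algebra_simps\<close>)
qed

end

section \<open>Finite dimensional Lie algebras and modules on a subspace\<close>

locale fd_lie_algebra = lie_algebra scale br + vspace scale
  for scale :: "'f::field_char_0 \<Rightarrow> 'l::ab_group_add \<Rightarrow> 'l" and br +
  assumes fdim_UNIV: "fdim UNIV"
begin

lemma br_linear: "Vector_Spaces.linear scale scale (br x)" "Vector_Spaces.linear scale scale (\<lambda>x. br x y)"
  using bracket_bilinear by (auto simp: bilinear_map_def)

lemma br_simps: "br (x + y) z = br x z + br y z" "br x (y + z) = br x y + br x z"
  "br (scale c x) z = scale c (br x z)" "br x (scale c z) = scale c (br x z)"
  using br_linear by (auto simp: Vector_Spaces.linear_iff)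

lemma fdim_any: "fdim W"
  using fdim_UNIV fdim_mono by blast

end

text \<open>The representation identities are only required on \<open>M\<close>: in the proof of Weyl's theorem \<open>M\<close> consists of
  linear maps inside a full function space, where they fail for nonlinear functions.\<close>

locale lie_module_on = L: fd_lie_algebra sL br + V: vspace sV
  for sL :: "'f::field_char_0 \<Rightarrow> 'l::ab_group_add \<Rightarrow> 'l" and br
    and sV :: "'f \<Rightarrow> 'm::ab_group_add \<Rightarrow> 'm" +
  fixes M :: "'m set" and \<psi> :: "'l \<Rightarrow> 'm \<Rightarrow> 'm"
  assumes M: "V.subspace M" "V.fdim M"
    and rep_linear: "Vector_Spaces.linear sV sV (\<psi> a)"
    and rep_mem: "m \<in> M \<Longrightarrow> \<psi> a m \<in> M"
    and rep_add: "m \<in> M \<Longrightarrow> \<psi> (a + b) m = \<psi> a m + \<psi> b m"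
    and rep_scale: "m \<in> M \<Longrightarrow> \<psi> (sL c a) m = sV c (\<psi> a m)"
    and rep_br: "m \<in> M \<Longrightarrow> \<psi> (br a b) m = \<psi> a (\<psi> b m) - \<psi> b (\<psi> a m)"
begin

lemma rep_image: "\<psi> a ` M \<subseteq> M"
  using rep_mem by blast

definition form :: "'l \<Rightarrow> 'l \<Rightarrow> 'f" where
  "form x y = V.trace_on M (\<lambda>m. \<psi> x (\<psi> y m))"

text \<open>The operators \<psi> x for x in \<open>P\<close>, written as matrices over the algebraic
  closure, span a perfect Lie algebra \<open>C\<close> with vanishing trace form. Cartan's criterion
  applies to \<open>C\<close>, and nilpotency of a matrix does not depend on the field.\<close>

theorem perfect_form_zero_nilpotent:
  assumes P: "L.subspace P" "L.derived P = P" and tr: "\<And>x y. x \<in> P \<Longrightarrow> y \<in> P \<Longrightarrow> form x y = 0"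
    and x: "x \<in> P" and m: "m \<in> M"
  shows "\<exists>k. (\<psi> x ^^ k) m = 0"
proof -
  obtain B where B: "V.basis_of M B" using V.basis_of_exists M by blast
  have fB: "finite B" and BM: "B \<subseteq> M" using B V.basis_of_subset by (auto simp: V.basis_of_def)
  let ?s = "fun_scale (*) :: 'f alg_closure \<Rightarrow> ('m \<Rightarrow> 'f alg_closure) \<Rightarrow> _"
  let ?ss = "fun_scale ?s"
  interpret K: vspace ?s by (rule vspace_coord)
  interpret F: vspace ?ss by (rule vspace_fun_scale) unfold_locales
  define U where "U = {u :: 'm \<Rightarrow> 'f alg_closure. \<forall>x. x \<notin> B \<longrightarrow> u x = 0}"
  define E where "E a = V.base_change B (\<psi> a)" for a
  define G where "G = E ` P"
  define C where "C = F.span G"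
  have Ub: "K.basis_of U (delta ` B)" unfolding U_def by (rule coord_basis(1)[OF fB])
  have U: "K.subspace U" "K.fdim U" using Ub K.basis_of_subspace K.basis_of_fdim by auto
  have E_add: "E (a + b) = E a + E b" for a b
    unfolding E_def V.base_change_add[OF B rep_image rep_image, symmetric]
    using BM by (intro V.base_change_cong) (auto simp: rep_add)
  have E_scale: "E (sL c a) = ?ss (to_ac c) (E a)" for c a
    unfolding E_def V.base_change_scale[OF B rep_image, symmetric]
    using BM by (intro V.base_change_cong) (auto simp: rep_scale)
  have E_0: "E 0 = 0" using E_scale[of 0 0] by (simp add: fun_eq_iff)
  have E_br: "E (br a b) = commutator (E a) (E b)" for a b
  proof -
    have i: "(\<lambda>v. \<psi> a (\<psi> b v)) ` M \<subseteq> M" for a b using rep_mem by auto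
    have "E (br a b) = V.base_change B (\<lambda>v. \<psi> a (\<psi> b v) - \<psi> b (\<psi> a v))"
      unfolding E_def using BM by (intro V.base_change_cong) (auto simp: rep_br)
    also have "\<dots> = commutator (E a) (E b)"
      by (auto simp: fun_eq_iff commutator_def E_def V.base_change_comp[OF B rep_linear rep_image rep_image]
        V.base_change_diff[OF B i i])
    finally show ?thesis .
  qed
  have sum_G: "a \<in> L.span S \<Longrightarrow> E a \<in> F.span (E ` S)" for a S
  proof (induction rule: L.span_induct_alt)
    case base show ?case by (simp only: E_0 F.span_zero)
  next
    case (step c x y) then show ?case by (simp only: E_add E_scale F.span_add F.span_scale F.span_base imageI)
  qed
  have opC: "Vector_Spaces.linear ?s ?s b \<and> b ` U \<subseteq> U" if "b \<in> C" for b
  proof -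
    have "G \<subseteq> {Z. Vector_Spaces.linear ?s ?s Z \<and> Z ` U \<subseteq> U}"
      using V.base_change_linear by (auto simp: G_def E_def U_def V.base_change_def)
    then show ?thesis using F.span_minimal[OF _ K.operators_subspace[OF U(1)]] that unfolding C_def by blast
  qed
  have GC: "G \<subseteq> C" unfolding C_def using F.span_base by blast
  \<comment> \<open>Conditions linear in each argument extend from the matrices \<open>E x\<close>
    to their span, one argument at a time. Closure under brackets and vanishing of traces are both
    obtained in this way.\<close>
  have bilin: "R a b" if a: "a \<in> C" and b: "b \<in> C"
    and sub1: "\<And>a. a \<in> C \<Longrightarrow> F.subspace {b \<in> C. R a b}" and sub2: "\<And>b. b \<in> C \<Longrightarrow> F.subspace {a \<in> C. R a b}"
    and gen: "\<And>x y. x \<in> P \<Longrightarrow> y \<in> P \<Longrightarrow> R (E x) (E y)" for R a b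
  proof -
    have 1: "R g b" if "g \<in> G" for g
    proof -
      have "G \<subseteq> {b \<in> C. R g b}" using gen that GC by (auto simp: G_def)
      then have "C \<subseteq> {b \<in> C. R g b}" unfolding C_def using that GC sub1
        by (intro F.span_minimal) (auto simp: C_def)
      then show ?thesis using b by auto
    qed
    have "G \<subseteq> {a \<in> C. R a b}" using 1 GC by auto
    then have "C \<subseteq> {a \<in> C. R a b}" unfolding C_def using sub2 b
      by (intro F.span_minimal) (auto simp: C_def)
    then show ?thesis using a by auto
  qed
  have sC: "F.subspace C" unfolding C_def by simp
  have brP: "br x y \<in> P" if "x \<in> P" "y \<in> P" for x y
  proof -
    have "br x y \<in> L.derived P" unfolding L.derived_def using that by (intro L.span_base) blast
    then show ?thesis using P by simp
  qed
  have clo: "commutator a b \<in> C" if "a \<in> C" "b \<in> C" for a b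
  proof (rule bilin[OF that])
    show "commutator (E x) (E y) \<in> C" if "x \<in> P" "y \<in> P" for x y
      using brP[OF that] GC unfolding E_br[symmetric] G_def by blast
    show "F.subspace {b \<in> C. commutator a b \<in> C}" if "a \<in> C" for a
    proof -
      interpret a: Vector_Spaces.linear ?s ?s a using opC[OF that] by simp
      have "commutator a 0 = 0" "commutator a (b + c) = commutator a b + commutator a c"
        "commutator a (?ss r b) = ?ss r (commutator a b)" for b c r
        by (auto simp only: commutator_def fun_eq_iff plus_fun_apply fun_scale_apply zero_fun_apply
          a.add a.scale a.zero K.scale_right_diff_distrib add_diff_add diff_self)
      then show ?thesis
        by (intro F.subspaceI) (auto simp only: mem_Collect_eq F.subspace_0[OF sC] F.subspace_add[OF sC] F.subspace_scale[OF sC])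
    qed
    show "F.subspace {a \<in> C. commutator a b \<in> C}" if "b \<in> C" for b
    proof -
      interpret b: Vector_Spaces.linear ?s ?s b using opC[OF that] by simp
      have "commutator 0 b = 0" "commutator (a + c) b = commutator a b + commutator c b"
        "commutator (?ss r a) b = ?ss r (commutator a b)" for a c r
        by (auto simp only: commutator_def fun_eq_iff plus_fun_apply fun_scale_apply zero_fun_apply
          b.add b.scale b.zero K.scale_right_diff_distrib add_diff_add diff_self)
      then show ?thesis
        by (intro F.subspaceI) (auto simp only: mem_Collect_eq F.subspace_0[OF sC] F.subspace_add[OF sC] F.subspace_scale[OF sC])
    qed
  qed
  have tr0: "K.trace_on U (\<lambda>u. a (b u)) = 0" if "a \<in> C" "b \<in> C" for a b
  proof (rule bilin[OF that])
    have cmp: "Vector_Spaces.linear ?s ?s (\<lambda>u. a (b u)) \<and> (\<lambda>u. a (b u)) ` U \<subseteq> U"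
      if "a \<in> C" "b \<in> C" for a b
    proof -
      have a: "Vector_Spaces.linear ?s ?s a" "a ` U \<subseteq> U" and b: "Vector_Spaces.linear ?s ?s b" "b ` U \<subseteq> U"
        using opC that by auto
      show ?thesis using Vector_Spaces.linear_compose[OF b(1) a(1)] a(2) b(2) by (auto simp: comp_def)
    qed
    have z: "K.trace_on U (\<lambda>u. 0) = 0"
    proof -
      have l: "Vector_Spaces.linear ?s ?s (\<lambda>u. 0)" by (simp add: Vector_Spaces.linear_iff K.vector_space_axioms)
      moreover have "(\<lambda>u. 0) ` U \<subseteq> U" using K.subspace_0[OF U(1)] by auto
      ultimately show ?thesis using K.trace_on_scale[OF U l, of 0] by simp
    qed
    show "K.trace_on U (\<lambda>u. E x (E y u)) = 0" if "x \<in> P" "y \<in> P" for x y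
    proof -
      have "Vector_Spaces.linear sV sV (\<lambda>v. \<psi> x (\<psi> y v))" "(\<lambda>v. \<psi> x (\<psi> y v)) ` M \<subseteq> M"
        using Vector_Spaces.linear_compose[OF rep_linear[of y] rep_linear[of x]] rep_mem by (auto simp: comp_def)
      from V.base_change_trace[OF B this] show ?thesis
        unfolding E_def V.base_change_comp[OF B rep_linear rep_image rep_image] U_def
        using tr[OF that] by (simp add: form_def)
    qed
    show "F.subspace {b \<in> C. K.trace_on U (\<lambda>u. a (b u)) = 0}" if a: "a \<in> C" for a
    proof (rule F.subspaceI)
      interpret a: Vector_Spaces.linear ?s ?s a using opC[OF that] by simp
      show "0 \<in> {b \<in> C. K.trace_on U (\<lambda>u. a (b u)) = 0}"
        using F.subspace_0[OF sC] z by (simp only: mem_Collect_eq zero_fun_apply a.zero simp_thms)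
      fix b c r
      assume b: "b \<in> {b \<in> C. K.trace_on U (\<lambda>u. a (b u)) = 0}"
      then have bC: "b \<in> C" and b0: "K.trace_on U (\<lambda>u. a (b u)) = 0" by auto
      have "K.trace_on U (\<lambda>u. ?s r (a (b u))) = 0"
        using K.trace_on_scale[OF U, of "\<lambda>u. a (b u)" r] cmp[OF a bC] b0 by simp
      then show "?ss r b \<in> {b \<in> C. K.trace_on U (\<lambda>u. a (b u)) = 0}"
        using F.subspace_scale[OF sC bC] by (simp only: mem_Collect_eq fun_scale_apply[of ?s] a.scale simp_thms)
      assume c: "c \<in> {b \<in> C. K.trace_on U (\<lambda>u. a (b u)) = 0}"
      then have cC: "c \<in> C" and c0: "K.trace_on U (\<lambda>u. a (c u)) = 0" by auto
      have "K.trace_on U (\<lambda>u. a (b u) + a (c u)) = 0"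
        using K.trace_on_add[OF U, of "\<lambda>u. a (b u)" "\<lambda>u. a (c u)"] cmp[OF a bC] cmp[OF a cC] b0 c0 by simp
      then show "b + c \<in> {b \<in> C. K.trace_on U (\<lambda>u. a (b u)) = 0}"
        using F.subspace_add[OF sC bC cC] by (simp only: mem_Collect_eq plus_fun_apply[of b c] a.add simp_thms)
    qed
    show "F.subspace {a \<in> C. K.trace_on U (\<lambda>u. a (b u)) = 0}" if b: "b \<in> C" for b
    proof (rule F.subspaceI)
      show "0 \<in> {a \<in> C. K.trace_on U (\<lambda>u. a (b u)) = 0}"
        using F.subspace_0[OF sC] z by (simp only: mem_Collect_eq zero_fun_apply simp_thms)
      fix a c r
      assume "a \<in> {a \<in> C. K.trace_on U (\<lambda>u. a (b u)) = 0}"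
      then have aC: "a \<in> C" and a0: "K.trace_on U (\<lambda>u. a (b u)) = 0" by auto
      have "K.trace_on U (\<lambda>u. ?s r (a (b u))) = 0"
        using K.trace_on_scale[OF U, of "\<lambda>u. a (b u)" r] cmp[OF aC b] a0 by simp
      then show "?ss r a \<in> {a \<in> C. K.trace_on U (\<lambda>u. a (b u)) = 0}"
        using F.subspace_scale[OF sC aC] by (simp only: mem_Collect_eq fun_scale_apply[of ?s] simp_thms)
      assume "c \<in> {a \<in> C. K.trace_on U (\<lambda>u. a (b u)) = 0}"
      then have cC: "c \<in> C" and c0: "K.trace_on U (\<lambda>u. c (b u)) = 0" by auto
      have "K.trace_on U (\<lambda>u. a (b u) + c (b u)) = 0"
        using K.trace_on_add[OF U, of "\<lambda>u. a (b u)" "\<lambda>u. c (b u)"] cmp[OF aC b] cmp[OF cC b] a0 c0 by simp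
      then show "a + c \<in> {a \<in> C. K.trace_on U (\<lambda>u. a (b u)) = 0}"
        using F.subspace_add[OF sC aC cC] by (simp only: mem_Collect_eq plus_fun_apply[of a c] simp_thms)
    qed
  qed
  have perf: "C \<subseteq> F.span {commutator a b | a b. a \<in> C \<and> b \<in> C}"
  proof -
    have "E x \<in> F.span {commutator a b | a b. a \<in> C \<and> b \<in> C}" if "x \<in> P" for x
    proof -
      have "x \<in> L.span {br a b | a b. a \<in> P \<and> b \<in> P}" using P that by (simp add: L.derived_def)
      from sum_G[OF this] have "E x \<in> F.span (E ` {br a b | a b. a \<in> P \<and> b \<in> P})" .
      also have "\<dots> \<subseteq> F.span {commutator a b | a b. a \<in> C \<and> b \<in> C}"
        using GC by (intro F.span_mono) (auto simp only: E_br G_def image_subset_iff, blast)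
      finally show ?thesis .
    qed
    then show ?thesis unfolding C_def by (intro F.span_minimal) (auto simp: G_def C_def)
  qed
  have fdC: "F.fdim C"
  proof -
    obtain D where D: "L.basis_of P D" using L.basis_of_exists[OF P(1)] L.fdim_any by blast
    have "G \<subseteq> F.span (E ` D)" using sum_G[of _ D] D by (auto simp: G_def L.basis_of_def)
    then have "C \<subseteq> F.span (E ` D)" unfolding C_def by (intro F.span_minimal) auto
    then show ?thesis using F.fdim_mono F.fdim_span D unfolding L.basis_of_def by blast
  qed
  have ExC: "E x \<in> C" using x GC by (auto simp: G_def)
  have "\<exists>k. (E x ^^ k) (delta b) = 0" if "b \<in> B" for b
  proof (rule perfect_trace_zero_nilpotent[where s = ?s and U = U and B = C and A = "E x"])
    show "delta b \<in> U" using that by (auto simp: U_def delta_def)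
    show "Vector_Spaces.linear ?s ?s b" "b ` U \<subseteq> U" if "b \<in> C" for b using opC[OF that] by auto
  qed (fact K.vspace_axioms U sC fdC clo perf tr0 ExC)+
  then show ?thesis unfolding E_def
    by (rule V.base_change_nilpotent[OF B rep_linear rep_image _ m])
qed

end

section \<open>Engel's theorem and trace forms\<close>

context fd_lie_algebra
begin

lemma br_0 [simp]: "br 0 x = 0" "br x 0 = 0"
  using br_simps(3)[of 0 0 x] br_simps(4)[of x 0 0] by auto

lemma br_anticommute: "br x y = - br y x"
proof -
  have "br (x + y) (x + y) = br x x + br y x + (br x y + br y y)" by (simp only: br_simps)
  then have "br x y + br y x = 0" by (simp add: bracket_self add.commute)
  then show ?thesis by (simp add: eq_neg_iff_add_eq_0)
qed

lemma br_neg: "br (- x) y = - br x y" "br x (- y) = - br x y"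
  using br_simps(3)[of "-1" x y] br_simps(4)[of x "-1" y] by auto

lemma br_derivation: "br x (br y z) = br (br x y) z + br y (br x z)"
proof -
  have "br x (br y z) + br y (br z x) + br z (br x y) = 0" by (rule jacobi)
  moreover have "br y (br z x) = - br y (br x z)" using br_anticommute[of z x] by (simp add: br_neg)
  moreover have "br z (br x y) = - br (br x y) z" by (rule br_anticommute)
  ultimately show ?thesis by (simp add: algebra_simps)
qed

lemma br_commute_mem: "subspace W \<Longrightarrow> br x y \<in> W \<Longrightarrow> br y x \<in> W"
  using br_anticommute[of y x] subspace_neg by simp

lemma span_insertE:
  assumes "subspace h" "y \<in> span (insert x h)"
  obtains k c where "k \<in> h" "y = k + scale c x"
proof -
  have "span h = h" using assms(1) by (simp add: span_eq_iff)
  moreover have "\<exists>c. y - scale c x \<in> span h" using assms(2) by (simp add: span_breakdown_eq)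
  ultimately obtain c where "y - scale c x \<in> h" by metis
  then show ?thesis using that[of "y - scale c x" c] by simp
qed

text \<open>Engel's theorem with the pair \<open>U \<subseteq> V\<close> standing for the module
  V/U, and nilpotency assumed only modulo the ideal \<open>K\<close>. The induction on dim g uses a
  maximal proper subalgebra \<open>h\<close>, which turns out to have codimension one: the vectors
  that \<open>h\<close> maps into \<open>U\<close> are preserved by a further element x, which acts
  nilpotently modulo \<open>U\<close>.\<close>

lemma engel_vector:
  assumes P: "subspace P" and K: "subspace K" "K \<subseteq> P"
    and KP: "\<And>x y. x \<in> P \<Longrightarrow> y \<in> K \<Longrightarrow> br x y \<in> K"
    and nil: "\<And>x y. x \<in> P \<Longrightarrow> y \<in> P \<Longrightarrow> \<exists>n. (br x ^^ n) y \<in> K"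
    and g: "subspace g" "K \<subseteq> g" "g \<subseteq> P" "\<And>x y. x \<in> g \<Longrightarrow> y \<in> g \<Longrightarrow> br x y \<in> g"
    and UV: "subspace U" "subspace V" "K \<subseteq> U" "U \<subseteq> V" "U \<noteq> V" "V \<subseteq> P"
    and inv: "\<And>x y. x \<in> g \<Longrightarrow> y \<in> U \<Longrightarrow> br x y \<in> U" "\<And>x y. x \<in> g \<Longrightarrow> y \<in> V \<Longrightarrow> br x y \<in> V"
  shows "\<exists>v\<in>V - U. \<forall>x\<in>g. br x v \<in> U"
  using g UV inv
proof (induction "dim g" arbitrary: g U V rule: less_induct)
  case less
  note g = less.prems(1-4) and UV = less.prems(5-10) and inv = less.prems(11,12)
  show ?case
  proof (cases "g = K")
    case True
    obtain v where v: "v \<in> V - U" using UV by blast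
    have "br x v \<in> K" if "x \<in> K" for x
    proof (rule br_commute_mem[OF K(1)])
      show "br v x \<in> K" using KP[of v x] v UV(6) that by auto
    qed
    then show ?thesis using v True UV(3) by blast
  next
    case False
    define sub where "sub h \<longleftrightarrow> subspace h \<and> K \<subseteq> h \<and> h \<subseteq> g \<and> h \<noteq> g \<and> (\<forall>x\<in>h. \<forall>y\<in>h. br x y \<in> h)" for h
    have "br x y \<in> K" if "x \<in> K" "y \<in> K" for x y using KP K(2) that by auto
    then have "sub K" unfolding sub_def using K(1) g(2) False by auto
    moreover have bound: "\<forall>h. sub h \<longrightarrow> dim h < dim g"
      unfolding sub_def using dim_subset_fdim(2)[OF _ g(1) fdim_any] by auto
    ultimately obtain h where h: "sub h" and hmax: "\<And>h'. sub h' \<Longrightarrow> dim h' \<le> dim h"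
      using ex_has_greatest_nat[of sub K dim "dim g"] by metis
    have hs: "subspace h" "K \<subseteq> h" "h \<subseteq> g" "h \<noteq> g" "\<And>x y. x \<in> h \<Longrightarrow> y \<in> h \<Longrightarrow> br x y \<in> h"
      using h unfolding sub_def by auto
    have dh: "dim h < dim g" using bound h by simp
    have hP: "h \<subseteq> P" using hs g by auto
    have hg: "br x y \<in> g" if "x \<in> h" "y \<in> g" for x y using g(4) hs(3) that by auto
    \<comment> \<open>Induction for \<open>h\<close> acting on the pair
      \<open>h \<subseteq> g\<close> gives an element that normalises \<open>h\<close>. Adjoining it
      yields a larger subalgebra, which is \<open>g\<close> by maximality.\<close>
    obtain x where x: "x \<in> g - h" "\<And>k. k \<in> h \<Longrightarrow> br k x \<in> h"
      using less.hyps[OF dh hs(1,2) hP hs(5) hs(1) g(1) hs(2,3,4) g(3) hs(5) hg] by auto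
    have x': "br x k \<in> h" if "k \<in> h" for k by (rule br_commute_mem[OF hs(1) x(2)[OF that]])
    define h' where "h' = span (insert x h)"
    have hh': "h \<subseteq> h'" "x \<in> h'" "subspace h'" unfolding h'_def using span_superset[of "insert x h"] by auto
    have "h' \<subseteq> g" unfolding h'_def using x hs g by (intro span_minimal) auto
    moreover have "br a b \<in> h'" if ah: "a \<in> h'" and bh: "b \<in> h'" for a b
    proof -
      obtain k c where a: "k \<in> h" "a = k + scale c x" using ah unfolding h'_def by (rule span_insertE[OF hs(1)])
      obtain l d where b: "l \<in> h" "b = l + scale d x" using bh unfolding h'_def by (rule span_insertE[OF hs(1)])
      have "br a b = br k l + scale d (br k x) + scale c (br x l)"
        unfolding a b by (simp add: br_simps bracket_self)
      moreover have "\<dots> \<in> h" using hs x x' a b by (intro subspace_add subspace_scale) auto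
      ultimately show ?thesis using hh' by auto
    qed
    moreover have "dim h < dim h'" using dim_subset_fdim(2)[OF hs(1) hh'(3) fdim_any hh'(1)] hh'(2) x(1) by auto
    moreover have "K \<subseteq> h'" using hs(2) hh'(1) by auto
    ultimately have gh': "g = h'" using hmax[of h'] hh'(3) unfolding sub_def by (metis linorder_not_le)
    \<comment> \<open>Induction for \<open>h\<close> on the given pair puts a vector of
      \<open>W\<close> outside \<open>U\<close>; \<open>W\<close> is stable under x because x
      normalises \<open>h\<close>.\<close>
    define W where "W = {v \<in> V. \<forall>k\<in>h. br k v \<in> U}"
    obtain v where v: "v \<in> W - U"
    proof -
      have "br x y \<in> U" if "x \<in> h" "y \<in> U" for x y using inv(1) hs(3) that by auto
      moreover have "br x y \<in> V" if "x \<in> h" "y \<in> V" for x y using inv(2) hs(3) that by auto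
      ultimately show ?thesis using less.hyps[OF dh hs(1,2) hP hs(5) UV] that unfolding W_def by auto
    qed
    have Wx: "br x w \<in> W" if w: "w \<in> W" for w
    proof -
      have "br k (br x w) \<in> U" if k: "k \<in> h" for k
      proof -
        have "br (br k x) w \<in> U" using w x(2)[OF k] by (auto simp: W_def)
        moreover have "br x (br k w) \<in> U" using inv(1)[of x] w x k by (auto simp: W_def)
        ultimately show ?thesis using br_derivation[of k x w] subspace_add[OF UV(1)] by simp
      qed
      moreover have "br x w \<in> V" using w x inv(2) by (auto simp: W_def)
      ultimately show ?thesis by (auto simp: W_def)
    qed
    have "x \<in> P" "v \<in> P" using x g v UV by (auto simp: W_def)
    then have ex: "\<exists>n. (br x ^^ n) v \<in> U" using nil[of x v] UV(3) by auto
    \<comment> \<open>The iterate just before the first entry into \<open>U\<close> is the desired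
      vector: x maps it into \<open>U\<close>, and \<open>h\<close> does so because it lies in
      \<open>W\<close>.\<close>
    define n where "n = (LEAST n. (br x ^^ n) v \<in> U)"
    have n: "(br x ^^ n) v \<in> U" unfolding n_def using ex by (rule LeastI_ex)
    have "n \<noteq> 0"
    proof
      assume "n = 0" then show False using n v by simp
    qed
    then obtain m where m: "n = Suc m" by (cases n) auto
    define v' where "v' = (br x ^^ m) v"
    have "v' \<notin> U" unfolding v'_def using not_less_Least[of m "\<lambda>n. (br x ^^ n) v \<in> U"] m n_def by simp
    moreover have "v' \<in> W" unfolding v'_def using funpow_invariant[of "br x" W v m] Wx v by blast
    moreover have xv': "br x v' \<in> U" using n m by (simp add: v'_def)
    moreover have "br a v' \<in> U" if a: "a \<in> g" for a
    proof -
      obtain k c where k: "k \<in> h" "a = k + scale c x"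
        using a unfolding gh' h'_def by (rule span_insertE[OF hs(1)])
      have "br k v' \<in> U" using k \<open>v' \<in> W\<close> by (auto simp: W_def)
      then show ?thesis unfolding k using xv' UV by (simp add: br_simps subspace_add subspace_scale)
    qed
    ultimately show ?thesis by (auto simp: W_def)
  qed
qed

lemma derived_bracket: "derived P = P \<Longrightarrow> x \<in> P \<Longrightarrow> y \<in> P \<Longrightarrow> br x y \<in> P"
  using span_base[of "br x y" "{br x y | x y. x \<in> P \<and> y \<in> P}"] unfolding derived_def by blast

text \<open>Let U be a proper ideal of \<open>P\<close> containing \<open>K\<close>, of maximal
  dimension. Engel's theorem gives v outside U with [P, v] in U; by maximality U and v span
  \<open>P\<close>, so all brackets lie in U, against perfectness.\<close>

lemma perfect_nilpotent_mod:
  assumes P: "subspace P" "derived P = P" and K: "subspace K" "K \<subseteq> P"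
    and KP: "\<And>x y. x \<in> P \<Longrightarrow> y \<in> K \<Longrightarrow> br x y \<in> K"
    and nil: "\<And>x y. x \<in> P \<Longrightarrow> y \<in> P \<Longrightarrow> \<exists>n. (br x ^^ n) y \<in> K"
  shows "K = P"
proof (rule ccontr)
  assume KP': "K \<noteq> P"
  note brP = derived_bracket[OF P(2)]
  define good where "good U \<longleftrightarrow> subspace U \<and> K \<subseteq> U \<and> U \<subseteq> P \<and> U \<noteq> P \<and> (\<forall>x\<in>P. \<forall>y\<in>U. br x y \<in> U)" for U
  have "br x y \<in> K" if "x \<in> P" "y \<in> K" for x y using KP K(2) that by auto
  then have "good K" unfolding good_def using K KP' by auto
  moreover have "\<forall>U. good U \<longrightarrow> dim U < dim P"
    unfolding good_def using dim_subset_fdim(2)[OF _ P(1) fdim_any] by auto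
  ultimately obtain U where U: "good U" and Umax: "\<And>U'. good U' \<Longrightarrow> dim U' \<le> dim U"
    using ex_has_greatest_nat[of good K dim "dim P"] by metis
  then have Us: "subspace U" "K \<subseteq> U" "U \<subseteq> P" "U \<noteq> P" "\<And>x y. x \<in> P \<Longrightarrow> y \<in> U \<Longrightarrow> br x y \<in> U"
    unfolding good_def by auto
  obtain v where v: "v \<in> P - U" "\<And>x. x \<in> P \<Longrightarrow> br x v \<in> U"
    using engel_vector[OF P(1) K KP nil P(1) K(2) subset_refl brP Us(1) P(1) Us(2,3,4) subset_refl Us(5) brP] by auto
  define U' where "U' = span (insert v U)"
  have U': "U \<subseteq> U'" "v \<in> U'" "subspace U'" unfolding U'_def using span_superset[of "insert v U"] by auto
  have U'P: "U' \<subseteq> P" unfolding U'_def using v Us P by (intro span_minimal) auto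
  have brU: "br x y \<in> U" if x: "x \<in> P" and y: "y \<in> U'" for x y
  proof -
    obtain k c where "k \<in> U" "y = k + scale c v" using y unfolding U'_def by (rule span_insertE[OF Us(1)])
    then show ?thesis using Us x v by (simp add: br_simps subspace_add subspace_scale)
  qed
  have "dim U < dim U'" using dim_subset_fdim(2)[OF Us(1) U'(3) fdim_any U'(1)] U'(2) v(1) by auto
  then have "\<not> good U'" using Umax[of U'] by auto
  moreover have "br x y \<in> U'" if "x \<in> P" "y \<in> U'" for x y using brU[OF that] U'(1) by auto
  moreover have "K \<subseteq> U'" using Us(2) U'(1) by auto
  ultimately have "U' = P" using U'(3) U'P unfolding good_def by auto
  then have "derived P \<subseteq> U" unfolding derived_def using brU by (intro span_minimal[OF _ Us(1)]) auto
  then show False using P(2) Us(3,4) by auto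
qed

lemma derived_subspace: "subspace (derived U)"
  unfolding derived_def by simp

lemma derived_mono: "U \<subseteq> W \<Longrightarrow> derived U \<subseteq> derived W"
  unfolding derived_def by (intro span_mono) auto

lemma derived_le: "subspace U \<Longrightarrow> (\<And>x y. x \<in> U \<Longrightarrow> y \<in> U \<Longrightarrow> br x y \<in> U) \<Longrightarrow> derived U \<subseteq> U"
  unfolding derived_def by (intro span_minimal) auto

text \<open>Dimensions drop strictly until the series is stationary; the stationary term is perfect,
  and it is zero only if \<open>Q\<close> is solvable.\<close>

lemma derived_series_stable:
  assumes Q: "subspace Q" "\<And>x y. x \<in> Q \<Longrightarrow> y \<in> Q \<Longrightarrow> br x y \<in> Q"
  obtains n where "subspace ((derived ^^ n) Q)" "(derived ^^ n) Q \<subseteq> Q"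
    "derived ((derived ^^ n) Q) = (derived ^^ n) Q"
proof -
  have sub: "subspace ((derived ^^ n) Q)" for n using Q(1) derived_subspace by (cases n) auto
  have step: "derived ((derived ^^ n) Q) \<subseteq> (derived ^^ n) Q" for n
  proof (induction n)
    case 0 show ?case using derived_le[OF Q] by simp
  next
    case (Suc n) then show ?case using derived_mono by simp
  qed
  have le: "(derived ^^ n) Q \<subseteq> Q" for n
  proof (induction n)
    case (Suc n) then show ?case using step[of n] by simp
  qed simp
  have "\<exists>n. derived ((derived ^^ n) Q) = (derived ^^ n) Q"
  proof (rule ccontr)
    assume no: "\<not> ?thesis"
    have "dim ((derived ^^ n) Q) + n \<le> dim Q" for n
    proof (induction n)
      case (Suc n)
      have "dim (derived ((derived ^^ n) Q)) < dim ((derived ^^ n) Q)"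
        using dim_subset_fdim(2)[OF derived_subspace sub fdim_any step] no by blast
      with Suc show ?case by simp
    qed simp
    from this[of "Suc (dim Q)"] show False by simp
  qed
  then show ?thesis using that sub le by blast
qed

end

context lie_module_on
begin

text \<open>Nilpotency of \<open>\<psi> x\<close> makes \<open>ad x\<close> nilpotent modulo the kernel of \<open>\<psi>\<close>.\<close>

lemma rep_ad_power:
  "m \<in> M \<Longrightarrow> \<psi> ((br x ^^ k) y) m \<in> V.span {(\<psi> x ^^ i) (\<psi> y ((\<psi> x ^^ j) m)) | i j. i + j = k}"
proof (induction k arbitrary: m)
  case 0
  then show ?case by (auto intro!: V.span_base)
next
  case (Suc k)
  let ?S = "\<lambda>k m. {(\<psi> x ^^ i) (\<psi> y ((\<psi> x ^^ j) m)) | i j. i + j = k}"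
  interpret x: Vector_Spaces.linear sV sV "\<psi> x" by (rule rep_linear)
  let ?z = "(br x ^^ k) y"
  have "\<psi> x ` ?S k m \<subseteq> ?S (Suc k) m"
  proof safe
    fix i j assume "k = i + j"
    then show "\<exists>i' j'. \<psi> x ((\<psi> x ^^ i) (\<psi> y ((\<psi> x ^^ j) m))) = (\<psi> x ^^ i') (\<psi> y ((\<psi> x ^^ j') m)) \<and> i' + j' = Suc (i + j)"
      by (intro exI[of _ "Suc i"] exI[of _ j]) simp
  qed
  then have "\<psi> x (\<psi> ?z m) \<in> V.span (?S (Suc k) m)"
    using Suc.IH[OF Suc.prems] x.span_image[of "?S k m"] V.span_mono[of "\<psi> x ` ?S k m" "?S (Suc k) m"] by blast
  moreover have "?S k (\<psi> x m) \<subseteq> ?S (Suc k) m"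
  proof safe
    fix i j assume "k = i + j"
    then show "\<exists>i' j'. (\<psi> x ^^ i) (\<psi> y ((\<psi> x ^^ j) (\<psi> x m))) = (\<psi> x ^^ i') (\<psi> y ((\<psi> x ^^ j') m)) \<and> i' + j' = Suc (i + j)"
      by (intro exI[of _ i] exI[of _ "Suc j"]) (simp add: funpow_swap1)
  qed
  then have "\<psi> ?z (\<psi> x m) \<in> V.span (?S (Suc k) m)"
    using Suc.IH[OF rep_mem[OF Suc.prems]] V.span_mono by blast
  ultimately show ?case using Suc.prems by (simp add: rep_br V.span_diff)
qed

text \<open>As every \<psi> x is nilpotent, \<open>P\<close> is nilpotent modulo the kernel of
  \<psi>; being perfect, it coincides with that kernel.\<close>

lemma perfect_form_zero_trivial:
  assumes P: "L.subspace P" "L.derived P = P" and tr: "\<And>x y. x \<in> P \<Longrightarrow> y \<in> P \<Longrightarrow> form x y = 0"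
    and x: "x \<in> P" and m: "m \<in> M"
  shows "\<psi> x m = 0"
proof -
  define K where "K = {x \<in> P. \<forall>m\<in>M. \<psi> x m = 0}"
  note brP = L.derived_bracket[OF P(2)]
  have z: "\<psi> x 0 = 0" for x using rep_linear[of x] by (metis Vector_Spaces.linear_iff V.scale_zero_left)
  have z': "m \<in> M \<Longrightarrow> \<psi> 0 m = 0" for m using rep_scale[of m 0 0] by simp
  have "L.subspace K" unfolding K_def
    by (rule L.subspaceI) (auto simp: z' rep_add rep_scale L.subspace_0[OF P(1)] L.subspace_add[OF P(1)] L.subspace_scale[OF P(1)])
  moreover have "br x y \<in> K" if "x \<in> P" "y \<in> K" for x y
    using that brP by (auto simp: K_def rep_br z rep_mem)
  moreover have "\<exists>n. (br x ^^ n) y \<in> K" if x: "x \<in> P" and y: "y \<in> P" for x y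
  proof -
    obtain N where N: "\<And>m. m \<in> M \<Longrightarrow> (\<psi> x ^^ N) m = 0"
      using V.nilpotent_uniform[OF M rep_linear perfect_form_zero_nilpotent[OF P tr x]] by blast
    have N': "(\<psi> x ^^ i) m = 0" if "N \<le> i" "m \<in> M" for i m
    proof -
      have "(\<psi> x ^^ i) m = (\<psi> x ^^ (i - N)) ((\<psi> x ^^ N) m)"
        using that(1) by (metis comp_apply funpow_add le_add_diff_inverse2)
      then show ?thesis using N that V.funpow_zero[OF rep_linear] by simp
    qed
    \<comment> \<open>In each spanning term of \<open>rep_ad_power\<close> the two exponents add up
      to 2N, so one of them reaches N and the term vanishes.\<close>
    have "\<psi> ((br x ^^ (N + N)) y) m = 0" if m: "m \<in> M" for m
    proof -
      let ?S = "{(\<psi> x ^^ i) (\<psi> y ((\<psi> x ^^ j) m)) | i j. i + j = N + N}"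
      have "(\<psi> x ^^ i) (\<psi> y ((\<psi> x ^^ j) m)) = 0" if "i + j = N + N" for i j
      proof (cases "N \<le> j")
        case True then show ?thesis using N'[OF True m] z V.funpow_zero[OF rep_linear] by simp
      next
        case False
        then have "N \<le> i" using that by simp
        then show ?thesis using N' rep_mem funpow_invariant[OF rep_image m] by blast
      qed
      then have "?S \<subseteq> {0}" by auto
      then have "V.span ?S \<subseteq> {0}" by (intro V.span_minimal) auto
      then show ?thesis using rep_ad_power[OF m, where x = x and k = "N + N" and y = y] by blast
    qed
    moreover have "(br x ^^ (N + N)) y \<in> P" using funpow_invariant[of "br x" P y] brP x y by blast
    ultimately show ?thesis unfolding K_def by blast
  qed
  moreover have "K \<subseteq> P" by (auto simp: K_def)
  ultimately have "K = P" using L.perfect_nilpotent_mod[OF P] by blast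
  then show ?thesis using x m unfolding K_def by auto
qed

text \<open>The stationary term of the derived series of \<open>Q\<close> is perfect, so it acts by
  zero, and faithfulness makes it 0. Thus \<open>Q\<close> is a solvable ideal.\<close>

lemma ideal_form_zero:
  assumes ss: "L.semisimple_lie" and Q: "L.lie_ideal Q" and tr: "\<And>x y. x \<in> Q \<Longrightarrow> y \<in> Q \<Longrightarrow> form x y = 0"
    and faithful: "\<And>x. x \<in> Q \<Longrightarrow> (\<And>m. m \<in> M \<Longrightarrow> \<psi> x m = 0) \<Longrightarrow> x = 0"
  shows "Q = {0}"
proof -
  have Q': "L.subspace Q" "\<And>x y. x \<in> Q \<Longrightarrow> y \<in> Q \<Longrightarrow> br x y \<in> Q" using Q unfolding L.lie_ideal_def by auto
  obtain n where n: "L.subspace ((L.derived ^^ n) Q)" "(L.derived ^^ n) Q \<subseteq> Q"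
    "L.derived ((L.derived ^^ n) Q) = (L.derived ^^ n) Q" using L.derived_series_stable[OF Q'] by blast
  have "x = 0" if x: "x \<in> (L.derived ^^ n) Q" for x
  proof (rule faithful)
    show "x \<in> Q" using x n(2) by auto
    show "\<psi> x m = 0" if "m \<in> M" for m
      by (rule perfect_form_zero_trivial[OF n(1,3) _ x that]) (use tr n(2) in auto)
  qed
  then have "(L.derived ^^ n) Q = {0}" using L.subspace_0[OF n(1)] by auto
  then have "L.solvable Q" unfolding L.solvable_def by blast
  then show ?thesis using ss Q unfolding L.semisimple_lie_def by blast
qed

end

section \<open>Weyl's theorem\<close>

context lie_module_on
begin

lemma rep_0 [simp]: "\<psi> x 0 = 0"
  using rep_linear[of x] by (metis Vector_Spaces.linear_iff V.scale_zero_left)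

lemma rep_zero: "m \<in> M \<Longrightarrow> \<psi> 0 m = 0"
  using rep_scale[of m 0 0] by simp

lemma rep_linear_left: "m \<in> M \<Longrightarrow> Vector_Spaces.linear sL sV (\<lambda>x. \<psi> x m)"
  by (simp add: Vector_Spaces.linear_iff L.vector_space_axioms V.vector_space_axioms rep_add rep_scale)

lemma rep_comp: "Vector_Spaces.linear sV sV (\<lambda>m. \<psi> x (\<psi> y m))" "(\<lambda>m. \<psi> x (\<psi> y m)) ` M \<subseteq> M"
  using Vector_Spaces.linear_compose[OF rep_linear[of y] rep_linear[of x]] rep_mem by (auto simp: comp_def)

lemma form_commute: "form x y = form y x"
  unfolding form_def by (rule V.trace_on_commute[OF M rep_linear rep_image rep_linear rep_image])

lemma form_linear: "form (x + y) z = form x z + form y z" "form (sL c x) z = c * form x z"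
proof -
  have "form (x + y) z = V.trace_on M (\<lambda>m. \<psi> x (\<psi> z m) + \<psi> y (\<psi> z m))"
    unfolding form_def by (rule V.trace_on_cong[OF M]) (simp add: rep_add rep_mem)
  then show "form (x + y) z = form x z + form y z"
    unfolding form_def by (simp add: V.trace_on_add[OF M rep_comp rep_comp])
  have "form (sL c x) z = V.trace_on M (\<lambda>m. sV c (\<psi> x (\<psi> z m)))"
    unfolding form_def by (rule V.trace_on_cong[OF M]) (simp add: rep_scale rep_mem)
  then show "form (sL c x) z = c * form x z"
    unfolding form_def by (simp add: V.trace_on_scale[OF M rep_comp])
qed

lemma form_linear_right: "form z (x + y) = form z x + form z y" "form z (sL c x) = c * form z x"
  using form_linear form_commute by metis+

lemma form_zero [simp]: "form 0 x = 0" "form x 0 = 0"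
  using form_linear(2)[of 0 0 x] form_linear_right(2)[of x 0 0] by auto

lemma form_neg: "form (- x) y = - form x y" "form x (- y) = - form x y"
  using form_linear(2)[of "-1" x y] form_linear_right(2)[of x "-1" y] by auto

lemma form_sum: "form x (\<Sum>i\<in>A. h i) = (\<Sum>i\<in>A. form x (h i))" "form (\<Sum>i\<in>A. h i) x = (\<Sum>i\<in>A. form (h i) x)"
  by (induction A rule: infinite_finite_induct) (auto simp: form_linear form_linear_right)

text \<open>Both sides contain tr(x y z); the remaining terms tr(y x z) and tr(x z y) agree by
  cyclicity.\<close>

lemma form_invariant: "form (br x y) z = form x (br y z)"
proof -
  let ?t = "\<lambda>a b c. V.trace_on M (\<lambda>m. \<psi> a (\<psi> b (\<psi> c m)))"
  have t: "V.trace_on M (\<lambda>m. \<psi> a (\<psi> b (\<psi> c m)) + sV (-1) (\<psi> a' (\<psi> b' (\<psi> c' m)))) = ?t a b c - ?t a' b' c'" for a b c a' b' c'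
  proof -
    have l: "Vector_Spaces.linear sV sV (\<lambda>m. \<psi> a (\<psi> b (\<psi> c m)))" for a b c
      using Vector_Spaces.linear_compose[OF rep_comp(1)[of b c] rep_linear[of a]] by (simp add: comp_def)
    have i: "(\<lambda>m. \<psi> a (\<psi> b (\<psi> c m))) ` M \<subseteq> M" for a b c using rep_mem by auto
    have l': "Vector_Spaces.linear sV sV (\<lambda>m. sV (-1) (\<psi> a' (\<psi> b' (\<psi> c' m))))"
      using l[of a' b' c'] by (simp add: Vector_Spaces.linear_iff)
    have i': "(\<lambda>m. sV (-1) (\<psi> a' (\<psi> b' (\<psi> c' m)))) ` M \<subseteq> M" using i M(1) V.subspace_scale by blast
    show ?thesis by (subst V.trace_on_add[OF M l i l' i'], subst V.trace_on_scale[OF M l i]) simp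
  qed
  have d: "\<psi> a (u - v) = \<psi> a u - \<psi> a v" for a u v
  proof -
    interpret a: Vector_Spaces.linear sV sV "\<psi> a" by (rule rep_linear)
    show ?thesis by (rule a.diff)
  qed
  have "form (br x y) z = V.trace_on M (\<lambda>m. \<psi> x (\<psi> y (\<psi> z m)) + sV (-1) (\<psi> y (\<psi> x (\<psi> z m))))"
    unfolding form_def by (rule V.trace_on_cong[OF M]) (simp add: rep_br rep_mem)
  moreover have "form x (br y z) = V.trace_on M (\<lambda>m. \<psi> x (\<psi> y (\<psi> z m)) + sV (-1) (\<psi> x (\<psi> z (\<psi> y m))))"
    unfolding form_def by (rule V.trace_on_cong[OF M]) (simp add: rep_br rep_mem d)
  moreover have "?t y x z = ?t x z y"
    using V.trace_on_commute[OF M rep_linear rep_image rep_comp] by simp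
  ultimately show ?thesis unfolding t by simp
qed

end

section \<open>The Killing form of a semisimple Lie algebra\<close>

lemma (in fd_lie_algebra) adjoint_module: "lie_module_on scale br scale UNIV br"
proof unfold_locales
  show "br (br a b) m = br a (br b m) - br b (br a m)" for a b m
    using br_derivation[of a b m] by simp
qed (auto simp: fdim_UNIV br_linear br_simps)

locale semisimple_lie_algebra = fd_lie_algebra +
  assumes ss: "semisimple_lie"
begin

sublocale ad: lie_module_on scale br scale UNIV br
  by (rule adjoint_module)

text \<open>The center is an abelian ideal. Its vanishing is the faithfulness of the adjoint
  representation.\<close>

lemma center_zero:
  assumes "\<And>y. br x y = 0" shows "x = 0"
proof -
  let ?Z = "{x. \<forall>y. br x y = 0}"
  have sub: "subspace ?Z" by (rule subspaceI) (auto simp: br_simps)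
  have "br y x = 0" if "x \<in> ?Z" for x y using that br_anticommute[of y x] by simp
  then have "lie_ideal ?Z" unfolding lie_ideal_def using sub by auto
  moreover have "derived ?Z \<subseteq> {0}" unfolding derived_def by (rule span_minimal) auto
  then have "(derived ^^ 1) ?Z = {0}" using subspace_0[OF derived_subspace] by auto
  then have "solvable ?Z" unfolding solvable_def by blast
  ultimately have "?Z = {0}" using ss unfolding semisimple_lie_def by blast
  then show ?thesis using assms by auto
qed

text \<open>By invariance form([q, x], y) = form(q, [x, y]), and [x, y] stays in the ideal
  \<open>I\<close>.\<close>

lemma lie_ideal_perp:
  assumes "lie_module_on scale br sV M \<psi>" "lie_ideal I" "lie_ideal J"
  shows "lie_ideal {x \<in> J. \<forall>y\<in>I. lie_module_on.form sV M \<psi> x y = 0}"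
proof -
  interpret lie_module_on scale br sV M \<psi> by fact
  note I = assms(2)[unfolded lie_ideal_def] and J = assms(3)[unfolded lie_ideal_def]
  have "form (br x q) y = 0" if "\<forall>y\<in>I. form q y = 0" "y \<in> I" for x q y
    using that I br_anticommute[of x q] form_invariant[of q x y] by (simp add: form_neg)
  moreover have "subspace {x \<in> J. \<forall>y\<in>I. form x y = 0}"
    using J by (intro subspaceI) (auto simp: form_linear subspace_0 subspace_add subspace_scale)
  ultimately show ?thesis unfolding lie_ideal_def using J by auto
qed

lemma ideal_UNIV: "lie_ideal UNIV"
  by (simp add: lie_ideal_def)

lemma killing_nondegenerate:
  assumes "\<And>y. ad.form x y = 0" shows "x = 0"
proof -
  have "{x \<in> UNIV. \<forall>y\<in>UNIV. ad.form x y = 0} = {0}"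
    by (rule ad.ideal_form_zero[OF ss lie_ideal_perp[OF adjoint_module ideal_UNIV ideal_UNIV]])
      (use center_zero in auto)
  then show ?thesis using assms by auto
qed

end

context fd_lie_algebra
begin

text \<open>The map x \<mapsto> \<Sum> \<beta>(x, b) b of \<open>W\<close> into itself is injective
  by nondegeneracy, hence surjective by dimension; a preimage of \<Sum> g(b) b has the prescribed
  values.\<close>

lemma nondegenerate_dual:
  assumes B: "basis_of W B"
    and lin: "\<And>y x x'. \<beta> (x + x') y = \<beta> x y + \<beta> x' y" "\<And>c y x. \<beta> (scale c x) y = c * \<beta> x y"
      "\<And>y x x'. \<beta> y (x + x') = \<beta> y x + \<beta> y x'" "\<And>c y x. \<beta> y (scale c x) = c * \<beta> y x"
    and nd: "\<And>x. x \<in> W \<Longrightarrow> (\<And>y. y \<in> W \<Longrightarrow> \<beta> x y = 0) \<Longrightarrow> x = 0"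
  shows "\<exists>x\<in>W. \<forall>b\<in>B. \<beta> x b = g b"
proof -
  have fB: "finite B" and iB: "independent B" and BW: "B \<subseteq> W" and W: "subspace W" and sB: "span B = W"
    using B basis_of_subset basis_of_subspace by (auto simp: basis_of_def)
  define T where "T x = (\<Sum>b\<in>B. scale (\<beta> x b) b)" for x
  have lT: "Vector_Spaces.linear scale scale T"
    by (auto simp: Vector_Spaces.linear_iff vector_space_axioms T_def lin scale_left_distrib sum.distrib scale_sum_right)
  interpret T: Vector_Spaces.linear scale scale T by (rule lT)
  have coeff: "h b = h' b" if "(\<Sum>b\<in>B. scale (h b) b) = (\<Sum>b\<in>B. scale (h' b) b)" "b \<in> B" for h h' b
  proof -
    have "(\<Sum>b\<in>B. scale (h b - h' b) b) = 0" using that(1) by (simp add: scale_left_diff_distrib sum_subtractf)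
    then show ?thesis using iB fB that(2) independent_explicit_finite_subsets[of B]
      by (metis eq_iff_diff_eq_0 subset_refl)
  qed
  have ext: "\<beta> x y = 0" if "\<And>b. b \<in> B \<Longrightarrow> \<beta> x b = 0" "y \<in> W" for x y
  proof -
    have "y \<in> span B" using that sB by simp
    then show ?thesis
      by (induction rule: span_induct_alt) (use lin(3)[of x 0 0] in \<open>auto simp: lin that\<close>)
  qed
  have inj: "inj_on T W"
  proof (rule inj_onI)
    fix x y assume xy: "x \<in> W" "y \<in> W" "T x = T y"
    have xyW: "x - y \<in> W" using xy W by (simp add: subspace_diff)
    have "T (x - y) = 0" using xy by (simp add: T.diff)
    then have "\<beta> (x - y) b = 0" if "b \<in> B" for b
      using coeff[of "\<beta> (x - y)" "\<lambda>_. 0" b] that by (simp add: T_def)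
    then have "x - y = 0" using nd[OF xyW] ext by blast
    then show "x = y" by simp
  qed
  have TW: "T ` W \<subseteq> W" unfolding T_def using BW W by (auto intro!: subspace_sum subspace_scale)
  have "independent (T ` B)" using T.independent_injective_image[OF iB] inj sB by simp
  moreover have "card (T ` B) = card B" using inj BW by (intro card_image) (auto intro: inj_on_subset)
  moreover have "span (T ` B) = T ` W" using T.span_image[of B] sB by simp
  ultimately have "basis_of (T ` W) (T ` B)" "dim (T ` W) = dim W"
    using fB basis_of_dim[OF B] basis_of_dim[of "T ` W" "T ` B"] by (auto simp: basis_of_def)
  then have "T ` W = W" using dim_subset_fdim(2)[OF _ W fdim_any TW] basis_of_subspace by force
  moreover have "(\<Sum>b\<in>B. scale (g b) b) \<in> W" using BW W by (auto intro!: subspace_sum subspace_scale)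
  ultimately obtain x where "x \<in> W" "T x = (\<Sum>b\<in>B. scale (g b) b)" by (metis imageE)
  then show ?thesis using coeff[of "\<beta> x" g] unfolding T_def by blast
qed

end

context semisimple_lie_algebra
begin

text \<open>A basis of \<open>K\<close> extends to one of the whole algebra; a dual vector, for the
  Killing form, of one of the added basis vectors is orthogonal to \<open>K\<close>.\<close>

lemma killing_perp_nonzero:
  assumes K: "subspace K" "K \<noteq> UNIV"
  obtains x where "x \<noteq> 0" "\<And>k. k \<in> K \<Longrightarrow> ad.form x k = 0"
proof -
  obtain C where C: "basis_of K C" using basis_of_exists[OF K(1) fdim_any] .
  obtain B where B: "basis_of UNIV B" "C \<subseteq> B"
    using basis_of_extend[OF _ fdim_UNIV, of C] C unfolding basis_of_def by auto
  have "C \<noteq> B" using B C K by (auto simp: basis_of_def)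
  then obtain b0 where b0: "b0 \<in> B" "b0 \<notin> C" using B by blast
  have "\<exists>x\<in>UNIV. \<forall>b\<in>B. ad.form x b = (if b = b0 then 1 else 0)"
    by (rule nondegenerate_dual[OF B(1)])
      (use killing_nondegenerate in \<open>auto simp: ad.form_linear ad.form_linear_right\<close>)
  then obtain x where x: "\<And>b. b \<in> B \<Longrightarrow> ad.form x b = (if b = b0 then 1 else 0)" by blast
  have "ad.form x k = 0" if "k \<in> K" for k
  proof -
    have "k \<in> span C" using that C by (simp add: basis_of_def)
    then show ?thesis
    proof (induction rule: span_induct_alt)
      case (step c y z)
      then have "ad.form x y = 0" using x[of y] B(2) b0 by auto
      with step show ?case by (simp add: ad.form_linear_right)
    qed simp
  qed
  moreover have "x \<noteq> 0" using x[OF b0(1)] by auto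
  ultimately show ?thesis using that by blast
qed

text \<open>An element x orthogonal to all brackets is central, because form([x, y], z) = form(x,
  [y, z]) = 0 for all z and the Killing form is nondegenerate.\<close>

lemma derived_UNIV: "derived UNIV = UNIV"
proof (rule ccontr)
  assume "derived UNIV \<noteq> UNIV"
  then obtain x where x: "x \<noteq> 0" "\<And>k. k \<in> derived UNIV \<Longrightarrow> ad.form x k = 0"
    using killing_perp_nonzero[OF derived_subspace] by blast
  have "br y z \<in> derived UNIV" for y z unfolding derived_def by (intro span_base) blast
  then have "ad.form (br x y) z = 0" for y z using x(2) ad.form_invariant by simp
  then have "br x y = 0" for y using killing_nondegenerate by blast
  then show False using x(1) center_zero by blast
qed

end

locale semisimple_lie_module_on = lie_module_on sL br sV M \<psi> + L: semisimple_lie_algebra sL br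
  for sL :: "'f::field_char_0 \<Rightarrow> 'l::ab_group_add \<Rightarrow> 'l" and br
    and sV :: "'f \<Rightarrow> 'm::ab_group_add \<Rightarrow> 'm" and M \<psi>
begin

text \<open>The trace form of \<open>M\<close> can be degenerate because \<psi> can have a kernel
  \<open>K\<close>. It is nondegenerate on the Killing complement \<open>I\<close> of
  \<open>K\<close>, and a basis \<open>B\<close> of \<open>I\<close> with its dual family
  \<open>u\<close> gives the Casimir tensor \<Sum> b \<otimes> u b. Its invariance under ad x is
  expressed against every bilinear \<open>F\<close>, so that it serves for the Casimir operator as
  well as for a cocycle.\<close>

lemma casimir:
  assumes "m0 \<in> M" "\<psi> x0 m0 \<noteq> 0"
  obtains B u where "finite B" "B \<noteq> {}" "\<And>b. b \<in> B \<Longrightarrow> form b (u b) = 1"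
    "\<And>F x. (\<And>a. Vector_Spaces.linear sL sV (F a)) \<Longrightarrow> (\<And>b. Vector_Spaces.linear sL sV (\<lambda>a. F a b))
      \<Longrightarrow> (\<Sum>b\<in>B. F (br x b) (u b) + F b (br x (u b))) = 0"
proof -
  define K where "K = {x. \<forall>m\<in>M. \<psi> x m = 0}"
  have K: "L.lie_ideal K" unfolding L.lie_ideal_def
  proof
    show "L.subspace K" unfolding K_def by (rule L.subspaceI) (auto simp: rep_zero rep_add rep_scale)
    show "\<forall>x. \<forall>y\<in>K. br x y \<in> K" by (auto simp: K_def rep_br rep_mem)
  qed
  have K': "L.subspace K" using K unfolding L.lie_ideal_def by blast
  have "x0 \<notin> K" using assms by (auto simp: K_def)
  then have "K \<noteq> UNIV" by auto
  define I where "I = {x \<in> UNIV. \<forall>k\<in>K. L.ad.form x k = 0}"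
  have I: "L.lie_ideal I" unfolding I_def by (rule L.lie_ideal_perp[OF L.adjoint_module K L.ideal_UNIV])
  then have I': "L.subspace I" and Ibr: "\<And>x y. y \<in> I \<Longrightarrow> br x y \<in> I" unfolding L.lie_ideal_def by auto
  obtain x1 where x1: "x1 \<noteq> 0" "\<And>k. k \<in> K \<Longrightarrow> L.ad.form x1 k = 0"
    using L.killing_perp_nonzero[OF K' \<open>K \<noteq> UNIV\<close>] by metis
  then have "x1 \<in> I" unfolding I_def by auto
  \<comment> \<open>This intersection is an ideal on which the Killing form vanishes, so the result
    for the faithful adjoint representation removes it. Consequently \<psi> is faithful on
    \<open>I\<close>.\<close>
  have "{x \<in> K. \<forall>k\<in>K. L.ad.form x k = 0} = {0}"
    by (rule L.ad.ideal_form_zero[OF L.ss L.lie_ideal_perp[OF L.adjoint_module K K]])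
      (use L.center_zero in auto)
  then have IK: "x = 0" if "x \<in> I" "x \<in> K" for x using that unfolding I_def by auto
  have Q: "{x \<in> I. \<forall>y\<in>I. form x y = 0} = {0}"
    by (rule ideal_form_zero[OF L.ss L.lie_ideal_perp[OF lie_module_on_axioms I I]])
      (use IK in \<open>auto simp: K_def\<close>)
  have nd: "x = 0" if "x \<in> I" "\<And>y. y \<in> I \<Longrightarrow> form x y = 0" for x using that Q by auto
  obtain B where B: "L.basis_of I B" using L.basis_of_exists[OF I' L.fdim_any] .
  have fB: "finite B" and iB: "L.independent B" and BI: "B \<subseteq> I" and sB: "L.span B = I"
    using B L.basis_of_subset by (auto simp: L.basis_of_def)
  have "\<exists>x\<in>I. \<forall>c\<in>B. form x c = (if c = b then 1 else 0)" for b
    by (rule L.nondegenerate_dual[OF B]) (use nd in \<open>auto simp: form_linear form_linear_right\<close>)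
  then obtain u where u: "\<And>b. u b \<in> I" "\<And>b c. c \<in> B \<Longrightarrow> form (u b) c = (if c = b then 1 else 0)" by metis
  have ext: "form x y = 0" if "\<And>b. b \<in> B \<Longrightarrow> form x b = 0" "y \<in> I" for x y
  proof -
    have "y \<in> L.span B" using that sB by simp
    then show ?thesis by (induction rule: L.span_induct_alt) (auto simp: form_linear_right that)
  qed
  have form_diff: "form (x - y) z = form x z - form y z" for x y z
    using form_linear(1)[of x "- y" z] by (simp add: form_neg)
  have e1: "y = (\<Sum>c\<in>B. sL (form (u c) y) c)" if y: "y \<in> I" for y
  proof -
    have yB: "y = (\<Sum>c\<in>B. sL (L.representation B y c) c)" using L.representation_expand[OF B y] by simp
    have "form (u c) y = L.representation B y c" if c: "c \<in> B" for c
    proof -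
      have "form (u c) y = (\<Sum>d\<in>B. L.representation B y d * form (u c) d)"
        by (subst yB) (simp add: form_sum form_linear_right)
      also have "\<dots> = (\<Sum>d\<in>B. if d = c then L.representation B y d else 0)"
        by (intro sum.cong) (auto simp: u)
      finally show ?thesis using c fB by (simp add: sum.delta)
    qed
    then show ?thesis using yB by simp
  qed
  have e2: "y = (\<Sum>c\<in>B. sL (form y c) (u c))" if y: "y \<in> I" for y
  proof -
    let ?d = "y - (\<Sum>c\<in>B. sL (form y c) (u c))"
    have dI: "?d \<in> I" using y u I' by (intro L.subspace_diff L.subspace_sum L.subspace_scale) auto
    have "form ?d b = 0" if b: "b \<in> B" for b
    proof -
      have "(\<Sum>c\<in>B. form y c * form (u c) b) = (\<Sum>c\<in>B. if c = b then form y c else 0)"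
        using b by (intro sum.cong) (auto simp: u)
      then show ?thesis using b fB by (simp add: form_diff form_sum form_linear sum.delta)
    qed
    then have "?d = 0" using nd[OF dI] ext by blast
    then show ?thesis by simp
  qed
  show ?thesis
  proof (rule that[of B u])
    show "finite B" by (rule fB)
    show "B \<noteq> {}" using sB \<open>x1 \<in> I\<close> x1(1) by auto
    show "form b (u b) = 1" if "b \<in> B" for b using u(2)[OF that] form_commute by metis
    fix F :: "'l \<Rightarrow> 'l \<Rightarrow> 'm" and x
    assume F: "\<And>a. Vector_Spaces.linear sL sV (F a)" "\<And>b. Vector_Spaces.linear sL sV (\<lambda>a. F a b)"
    have 1: "F (br x b) (u b) = (\<Sum>c\<in>B. sV (form (u c) (br x b)) (F c (u b)))" if b: "b \<in> B" for b
    proof -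
      interpret f: Vector_Spaces.linear sL sV "\<lambda>a. F a (u b)" by (rule F)
      have "br x b \<in> I" using b BI Ibr by auto
      from e1[OF this] have "F (br x b) (u b) = F (\<Sum>c\<in>B. sL (form (u c) (br x b)) c) (u b)" by simp
      then show ?thesis by (simp add: f.sum f.scale)
    qed
    have 2: "F b (br x (u b)) = (\<Sum>c\<in>B. sV (- form (u b) (br x c)) (F b (u c)))" for b
    proof -
      interpret f: Vector_Spaces.linear sL sV "F b" by (rule F)
      have "F b (br x (u b)) = F b (\<Sum>c\<in>B. sL (form (br x (u b)) c) (u c))"
        using e2[OF Ibr[OF u(1)], of x b] by simp
      also have "\<dots> = (\<Sum>c\<in>B. sV (form (br x (u b)) c) (F b (u c)))" by (simp add: f.sum f.scale)
      also have "\<dots> = (\<Sum>c\<in>B. sV (- form (u b) (br x c)) (F b (u c)))"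
        using L.br_anticommute[of x "u b"] by (simp add: form_neg form_invariant)
      finally show ?thesis .
    qed
    \<comment> \<open>The dual family transforms under ad x by the negative transposed matrix, so
      the two halves cancel after an exchange of summation indices.\<close>
    have "(\<Sum>b\<in>B. F (br x b) (u b)) = (\<Sum>b\<in>B. \<Sum>c\<in>B. sV (form (u c) (br x b)) (F c (u b)))"
      using 1 by simp
    also have "\<dots> = (\<Sum>b\<in>B. \<Sum>c\<in>B. sV (form (u b) (br x c)) (F b (u c)))" by (rule sum.swap)
    also have "\<dots> = - (\<Sum>b\<in>B. F b (br x (u b)))" by (simp add: 2 sum_negf)
    finally show "(\<Sum>b\<in>B. F (br x b) (u b) + F b (br x (u b))) = 0" by (simp add: sum.distrib)
  qed
qed

end

text \<open>Fitting's argument: a chain of images that never became stationary would lose a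
  dimension at each step.\<close>

lemma (in vspace) image_chain_stable:
  assumes M: "subspace M" "fdim M" and T: "Vector_Spaces.linear scale scale T" "T ` M \<subseteq> M"
  obtains N where "(T ^^ Suc N) ` M = (T ^^ N) ` M"
proof -
  have sub: "subspace ((T ^^ n) ` M)" for n by (rule subspace_linear_image[OF linear_funpow[OF T(1)] M(1)])
  have le: "(T ^^ n) ` M \<subseteq> M" for n using funpow_invariant[OF T(2)] by blast
  have step: "(T ^^ Suc n) ` M \<subseteq> (T ^^ n) ` M" for n
    using T(2) by (auto simp del: funpow.simps simp: funpow_Suc_right)
  have "\<exists>N. (T ^^ Suc N) ` M = (T ^^ N) ` M"
  proof (rule ccontr)
    assume no: "\<not> ?thesis"
    have "dim ((T ^^ n) ` M) + n \<le> dim M" for n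
    proof (induction n)
      case (Suc n)
      have "dim ((T ^^ Suc n) ` M) < dim ((T ^^ n) ` M)"
        using dim_subset_fdim(2)[OF sub sub fdim_mono[OF M(2) le] step] no by blast
      with Suc show ?case by simp
    qed simp
    from this[of "Suc (dim M)"] show False by simp
  qed
  then show ?thesis using that by blast
qed

text \<open>For a cocycle \<open>f\<close> and a Casimir operator \<open>c = \<Sum> \<psi>(b) \<psi>(u b)\<close> the map \<open>c \<circ> f\<close> is
  the coboundary of \<open>\<Sum> \<psi>(b) f(u b)\<close>, so \<open>f\<close> can be moved into the Fitting null space of \<open>c\<close>, which is
  a proper submodule because \<open>tr c \<noteq> 0\<close>.\<close>

lemma whitehead:
  assumes "semisimple_lie_module_on sL br sV M \<psi>"
    and "\<And>x. f x \<in> M" "Vector_Spaces.linear sL sV f" "\<And>x y. f (br x y) = \<psi> x (f y) - \<psi> y (f x)"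
  shows "\<exists>m\<in>M. \<forall>x. f x = \<psi> x m"
  using assms
proof (induction "vector_space.dim sV M" arbitrary: M f rule: less_induct)
  case less
  interpret semisimple_lie_module_on sL br sV M \<psi> by fact
  note fM = less.prems(2) and fl = less.prems(3) and fc = less.prems(4)
  interpret f: Vector_Spaces.linear sL sV f by (rule fl)
  have psi_diff: "\<psi> x (v - w) = \<psi> x v - \<psi> x w" and psi_add: "\<psi> x (v + w) = \<psi> x v + \<psi> x w"
    and psi_sum: "\<psi> x (\<Sum>i\<in>A. h i) = (\<Sum>i\<in>A. \<psi> x (h i))" and psi_scale: "\<psi> x (sV r v) = sV r (\<psi> x v)"
    for x v w r and A :: "'b set" and h
  proof -
    interpret x: Vector_Spaces.linear sV sV "\<psi> x" by (rule rep_linear)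
    show "\<psi> x (v - w) = \<psi> x v - \<psi> x w" "\<psi> x (v + w) = \<psi> x v + \<psi> x w"
      "\<psi> x (\<Sum>i\<in>A. h i) = (\<Sum>i\<in>A. \<psi> x (h i))" "\<psi> x (sV r v) = sV r (\<psi> x v)"
      by (rule x.diff x.add x.sum x.scale)+
  qed
  show ?case
  proof (cases "\<forall>x. \<forall>m\<in>M. \<psi> x m = 0")
    case True
    \<comment> \<open>A cocycle for the trivial action vanishes on brackets, and these span the Lie
      algebra.\<close>
    have "f x = 0" for x
    proof -
      have "x \<in> L.span {br a b | a b. a \<in> UNIV \<and> b \<in> UNIV}"
        using L.derived_UNIV unfolding L.derived_def by auto
      then show ?thesis
        by (induction rule: L.span_induct_alt) (use True fM in \<open>auto simp: f.add f.scale fc f.zero\<close>)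
    qed
    then show ?thesis using True V.subspace_0[OF M(1)] by (intro bexI[of _ 0]) auto
  next
    case False
    then obtain x0 m0 where nz: "m0 \<in> M" "\<psi> x0 m0 \<noteq> 0" by blast
    obtain B u where fB: "finite B" and B0: "B \<noteq> {}" and fu: "\<And>b. b \<in> B \<Longrightarrow> form b (u b) = 1"
      and inv: "\<And>F x. (\<And>a. Vector_Spaces.linear sL sV (F a)) \<Longrightarrow> (\<And>b. Vector_Spaces.linear sL sV (\<lambda>a. F a b))
      \<Longrightarrow> (\<Sum>b\<in>B. F (br x b) (u b) + F b (br x (u b))) = 0"
      using casimir[OF nz] by metis
    define c where "c m = (\<Sum>b\<in>B. \<psi> b (\<psi> (u b) m))" for m
    \<comment> \<open>Each dual pair contributes trace 1. The number of pairs is positive and stays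
      nonzero in characteristic 0, so \<open>c\<close> is not nilpotent and its null space
      \<open>M0\<close> is proper.\<close>
    have cl: "Vector_Spaces.linear sV sV c" and ctr: "V.trace_on M c = of_nat (card B)"
      unfolding c_def using V.trace_on_sum[OF M fB rep_comp] fu by (auto simp: form_def)
    have cM: "c ` M \<subseteq> M" unfolding c_def using rep_mem M(1) by (auto intro!: V.subspace_sum)
    interpret c: Vector_Spaces.linear sV sV c by (rule cl)
    have cpsi: "c (\<psi> x m) = \<psi> x (c m)" if m: "m \<in> M" for x m
    proof -
      have l: "Vector_Spaces.linear sL sV (\<lambda>b. \<psi> a (\<psi> b m))" "Vector_Spaces.linear sL sV (\<lambda>a. \<psi> a (\<psi> b m))" for a b
        using Vector_Spaces.linear_compose[OF rep_linear_left[OF m] rep_linear[of a]]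
          rep_linear_left[OF rep_mem[OF m]] by (auto simp: comp_def)
      have "\<psi> x (c m) - c (\<psi> x m)
          = (\<Sum>b\<in>B. \<psi> (br x b) (\<psi> (u b) m) + \<psi> b (\<psi> (br x (u b)) m))"
        unfolding c_def psi_sum sum_subtractf[symmetric]
        using m by (intro sum.cong) (auto simp: rep_br rep_mem psi_diff)
      then show ?thesis using inv[of "\<lambda>a b. \<psi> a (\<psi> b m)" x, OF l] by simp
    qed
    have ckM: "(c ^^ k) m \<in> M" if "m \<in> M" for k m by (rule funpow_invariant[OF cM that])
    have ckpsi: "(c ^^ k) (\<psi> x m) = \<psi> x ((c ^^ k) m)" if m: "m \<in> M" for k x m
      by (induction k) (auto simp: cpsi ckM m)
    define m1 where "m1 = (\<Sum>b\<in>B. \<psi> b (f (u b)))"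
    have m1M: "m1 \<in> M" unfolding m1_def using rep_mem fM M(1) by (auto intro!: V.subspace_sum)
    have cf: "c (f x) = \<psi> x m1" for x
    proof -
      have l: "Vector_Spaces.linear sL sV (\<lambda>b. \<psi> a (f b))" "Vector_Spaces.linear sL sV (\<lambda>a. \<psi> a (f b))" for a b
        using Vector_Spaces.linear_compose[OF fl rep_linear[of a]] rep_linear_left[OF fM] by (auto simp: comp_def)
      have "\<psi> x m1 - c (f x) = (\<Sum>b\<in>B. \<psi> (br x b) (f (u b)) + \<psi> b (f (br x (u b))))"
        unfolding c_def m1_def psi_sum sum_subtractf[symmetric]
        by (intro sum.cong) (auto simp: rep_br fM psi_diff fc)
      then show ?thesis using inv[of "\<lambda>a b. \<psi> a (f b)" x, OF l] by simp
    qed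
    obtain N where N: "(c ^^ Suc N) ` M = (c ^^ N) ` M" using V.image_chain_stable[OF M cl cM] .
    \<comment> \<open>Since \<open>c\<close> composed with \<open>f\<close> is the coboundary of
      \<open>m1\<close>, the value c^(N+1) (f x) is \<psi> x (c^N m1) = c^(N+1) (\<psi> x m2).
      Subtracting the coboundary of \<open>m2\<close> therefore moves the cocycle into the kernel of
      c^(N+1).\<close>
    obtain m2 where m2: "m2 \<in> M" "(c ^^ N) m1 = (c ^^ Suc N) m2" using N m1M by blast
    interpret cN: Vector_Spaces.linear sV sV "c ^^ Suc N" by (rule linear_funpow[OF cl])
    define M0 where "M0 = {m \<in> M. (c ^^ Suc N) m = 0}"
    have M0: "V.subspace M0" unfolding M0_def
      by (rule V.subspaceI) (use M(1) in \<open>auto simp del: funpow.simps simp: V.subspace_0 V.subspace_add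
        V.subspace_scale cN.add cN.scale\<close>)
    have M0M: "M0 \<subseteq> M" by (auto simp: M0_def)
    have "M0 \<noteq> M"
    proof
      assume "M0 = M"
      then have "\<exists>k. (c ^^ k) m = 0" if "m \<in> M" for m using that unfolding M0_def by blast
      then show False using V.trace_on_nilpotent[OF M cl cM] ctr fB B0 by simp
    qed
    then have dim: "V.dim M0 < V.dim M" using V.dim_subset_fdim(2)[OF M0 M M0M] by simp
    have mod0: "semisimple_lie_module_on sL br sV M0 \<psi>"
    proof unfold_locales
      show "V.subspace M0" "V.fdim M0" using M0 V.fdim_mono[OF M(2) M0M] by auto
      show "\<psi> a m \<in> M0" if "m \<in> M0" for a m
        using that ckpsi[of m "Suc N" a] unfolding M0_def by (auto simp del: funpow.simps simp: rep_mem)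
    qed (use M0M in \<open>auto simp: rep_add rep_scale rep_br psi_add psi_scale\<close>)
    define f' where "f' x = f x - \<psi> x m2" for x
    have f'M: "f' x \<in> M0" for x
    proof -
      have "(c ^^ Suc N) (f x) = (c ^^ N) (\<psi> x m1)" by (simp only: funpow_Suc_right comp_apply cf)
      also have "\<dots> = (c ^^ Suc N) (\<psi> x m2)" using m2 ckpsi m1M by metis
      finally show ?thesis unfolding M0_def f'_def
        using fM rep_mem[OF m2(1)] M(1) by (simp del: funpow.simps add: cN.diff V.subspace_diff)
    qed
    have f'l: "Vector_Spaces.linear sL sV f'"
      unfolding f'_def using fl rep_linear_left[OF m2(1)] by (auto simp: Vector_Spaces.linear_iff algebra_simps)
    have "f' (br x y) = \<psi> x (f' y) - \<psi> y (f' x)" for x y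
      by (simp add: f'_def fc rep_br m2 psi_diff)
    from less.hyps[OF dim mod0 f'M f'l this] obtain m3 where m3: "m3 \<in> M0" "\<And>x. f' x = \<psi> x m3" by blast
    have "f x = \<psi> x (m3 + m2)" for x using m3(2)[of x] by (simp add: f'_def psi_add algebra_simps)
    moreover have "m3 + m2 \<in> M" using m3 m2 M0M M(1) by (auto intro: V.subspace_add)
    ultimately show ?thesis by blast
  qed
qed

text \<open>The difference of two projections onto \<open>W\<close> is an element of \<open>Hom(V/W, W)\<close>, and \<open>x \<mapsto> [\<psi> x, p]\<close> is a
  cocycle with values in this module for every projection \<open>p\<close>.\<close>

theorem weyl_projection:
  fixes sL :: "'f::field_char_0 \<Rightarrow> 'l::ab_group_add \<Rightarrow> 'l" and sV :: "'f \<Rightarrow> 'v::ab_group_add \<Rightarrow> 'v"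
  assumes L: "semisimple_lie_algebra sL br" and rep: "lie_representation sL br sV \<psi>"
    and fd: "vspace.fdim sV UNIV" and W: "lie_representation.lie_submodule sV \<psi> W"
  obtains p where "Vector_Spaces.linear sV sV p" "\<And>v. p v \<in> W" "\<And>w. w \<in> W \<Longrightarrow> p w = w"
    "\<And>x v. p (\<psi> x v) = \<psi> x (p v)"
proof -
  interpret L: semisimple_lie_algebra sL br by fact
  interpret lie_representation sL br sV \<psi> by fact
  interpret V: vspace sV by unfold_locales
  interpret F: vspace "fun_scale sV :: _ \<Rightarrow> ('v \<Rightarrow> 'v) \<Rightarrow> _" by (rule vspace_fun_scale[OF V.vspace_axioms])
  have Ws: "V.subspace W" and Wpsi: "\<And>x w. w \<in> W \<Longrightarrow> \<psi> x w \<in> W" using W by (auto simp: lie_submodule_def)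
  have psi_l: "Vector_Spaces.linear sV sV (\<psi> x)" "Vector_Spaces.linear sL sV (\<lambda>x. \<psi> x v)" for x v
    using rep_bilinear by (auto simp: bilinear_map_def)
  have psi: "\<psi> x (v + w) = \<psi> x v + \<psi> x w" "\<psi> x (sV c v) = sV c (\<psi> x v)" "\<psi> x (v - w) = \<psi> x v - \<psi> x w"
    "\<psi> (x + y) v = \<psi> x v + \<psi> y v" "\<psi> (sL c x) v = sV c (\<psi> x v)" for x y v w c
    using psi_l module_hom.diff[OF psi_l(1)[unfolded linear_iff_module_hom]] by (auto simp: Vector_Spaces.linear_iff)
  obtain C where C: "V.basis_of W C" using V.basis_of_exists[OF Ws V.fdim_mono[OF fd]] by auto
  obtain B where B: "V.basis_of UNIV B" "C \<subseteq> B"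
    using V.basis_of_extend[OF _ fd, of C] C unfolding V.basis_of_def by auto
  have fB: "finite B" using B by (simp add: V.basis_of_def)
  obtain p where p: "Vector_Spaces.linear sV sV p" "\<And>b. b \<in> B \<Longrightarrow> p b = (if b \<in> C then b else 0)"
    using V.linear_on_basis[OF B(1), of "\<lambda>b. if b \<in> C then b else 0"] by blast
  have pW: "p v \<in> W" for v
  proof -
    have "p ` UNIV \<subseteq> W"
      by (rule V.linear_image_on_basis[OF B(1) p(1) _ Ws])
        (use p(2) V.basis_of_subset[OF C] V.subspace_0[OF Ws] in auto)
    then show ?thesis by auto
  qed
  have pid: "p w = w" if "w \<in> W" for w
    by (rule V.linear_eq_on_basis[OF C p(1) V.linear_identity _ that]) (use p(2) B in auto)
  define M where "M = {h. Vector_Spaces.linear sV sV h \<and> (\<forall>v. h v \<in> W) \<and> (\<forall>w\<in>W. h w = 0)}"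
  have lin_comm: "Vector_Spaces.linear sV sV (commutator a b)"
    if "Vector_Spaces.linear sV sV a" "Vector_Spaces.linear sV sV b" for a b
    using that by (auto simp: Vector_Spaces.linear_iff commutator_def algebra_simps)
  have mod: "semisimple_lie_module_on sL br (fun_scale sV) M (\<lambda>x. commutator (\<psi> x))"
  proof unfold_locales
    show "F.subspace M"
      unfolding M_def by (rule F.subspaceI) (use Ws in \<open>auto simp: Vector_Spaces.linear_iff V.vector_space_axioms
        V.subspace_0 V.subspace_add V.subspace_scale algebra_simps\<close>)
    \<comment> \<open>Matrix units in the basis \<open>B\<close>. They need not lie in
      \<open>M\<close>, but their span contains every linear operator, which bounds
      \<open>M\<close>.\<close>
    let ?E = "\<lambda>(b, b') v. sV (V.representation B v b) b'"
    have "M \<subseteq> F.span (?E ` (B \<times> B))"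
    proof
      fix h assume "h \<in> M"
      then have h: "Vector_Spaces.linear sV sV h" by (simp add: M_def)
      interpret h: Vector_Spaces.linear sV sV h by (rule h)
      have "h = (\<Sum>b\<in>B. \<Sum>b'\<in>B. fun_scale sV (V.representation B (h b) b') (?E (b, b')))"
      proof
        fix v
        have "h v = h (\<Sum>b\<in>B. sV (V.representation B v b) b)" using V.representation_expand[OF B(1), of v] by simp
        also have "\<dots> = (\<Sum>b\<in>B. sV (V.representation B v b) (h b))" by (simp add: h.sum h.scale)
        also have "\<dots> = (\<Sum>b\<in>B. sV (V.representation B v b) (\<Sum>b'\<in>B. sV (V.representation B (h b) b') b'))"
          using V.representation_expand[OF B(1)] by simp
        also have "\<dots> = (\<Sum>b\<in>B. \<Sum>b'\<in>B. fun_scale sV (V.representation B (h b) b') (?E (b, b'))) v"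
          by (simp add: V.scale_sum_right mult.commute)
        finally show "h v = (\<Sum>b\<in>B. \<Sum>b'\<in>B. fun_scale sV (V.representation B (h b) b') (?E (b, b'))) v" .
      qed
      also have "\<dots> \<in> F.span (?E ` (B \<times> B))"
        by (intro F.span_sum F.span_scale F.span_base imageI) auto
      finally show "h \<in> F.span (?E ` (B \<times> B))" .
    qed
    moreover have "finite (?E ` (B \<times> B))" using fB by simp
    ultimately show "F.fdim M" using F.fdim_mono[OF F.fdim_span] by metis
    show "commutator (\<psi> a) h \<in> M" if h: "h \<in> M" for a h
    proof -
      have "\<psi> a 0 = 0" using psi(2)[of a 0 0] by simp
      then show ?thesis using h lin_comm[OF psi_l(1)] Wpsi Ws
        by (auto simp: M_def commutator_def V.subspace_diff)
    qed
    fix h a b c assume "h \<in> M"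
    then have h: "h (v + w) = h v + h w" "h (sV c v) = sV c (h v)" "h (v - w) = h v - h w" for v w c
      using module_hom.diff[of sV sV h] by (auto simp: M_def Vector_Spaces.linear_iff module_hom_iff_linear)
    show "commutator (\<psi> (a + b)) h = commutator (\<psi> a) h + commutator (\<psi> b) h"
      "commutator (\<psi> (sL c a)) h = fun_scale sV c (commutator (\<psi> a) h)"
      "commutator (\<psi> (br a b)) h = commutator (\<psi> a) (commutator (\<psi> b) h) - commutator (\<psi> b) (commutator (\<psi> a) h)"
      by (auto simp: commutator_def fun_eq_iff psi h rep_bracket algebra_simps)
  qed (auto simp: commutator_def fun_eq_iff psi algebra_simps)
  interpret p: Vector_Spaces.linear sV sV p by (rule p(1))
  have "\<exists>m\<in>M. \<forall>x. commutator (\<psi> x) p = commutator (\<psi> x) m"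
  proof (rule whitehead[OF mod])
    show "commutator (\<psi> x) p \<in> M" for x
      unfolding M_def using lin_comm[OF psi_l(1) p(1)] pW pid Wpsi Ws by (auto simp: commutator_def V.subspace_diff)
    show "Vector_Spaces.linear sL (fun_scale sV) (\<lambda>x. commutator (\<psi> x) p)"
      by (auto simp: Vector_Spaces.linear_iff L.vector_space_axioms F.vector_space_axioms commutator_def fun_eq_iff
        psi p.add p.scale algebra_simps)
    show "commutator (\<psi> (br x y)) p = commutator (\<psi> x) (commutator (\<psi> y) p) - commutator (\<psi> y) (commutator (\<psi> x) p)" for x y
      by (auto simp: commutator_def fun_eq_iff psi p.diff rep_bracket algebra_simps)
  qed
  then obtain m where m: "m \<in> M" "\<And>x. commutator (\<psi> x) p = commutator (\<psi> x) m" by blast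
  have ml: "Vector_Spaces.linear sV sV m" "\<And>v. m v \<in> W" "\<And>w. w \<in> W \<Longrightarrow> m w = 0" using m(1) by (auto simp: M_def)
  show ?thesis
  \<comment> \<open>Equality of the two coboundaries says that p - m commutes with every \<psi> x.
    As \<open>m\<close> maps into \<open>W\<close> and vanishes on \<open>W\<close>, the difference
    is still a projection onto \<open>W\<close>.\<close>
  proof (rule that[of "\<lambda>v. p v - m v"])
    show "Vector_Spaces.linear sV sV (\<lambda>v. p v - m v)"
      using p(1) ml(1) by (auto simp: Vector_Spaces.linear_iff algebra_simps)
    show "p v - m v \<in> W" for v using pW ml Ws by (simp add: V.subspace_diff)
    show "p w - m w = w" if "w \<in> W" for w using pid ml that by simp
    show "p (\<psi> x v) - m (\<psi> x v) = \<psi> x (p v - m v)" for x v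
      using fun_cong[OF m(2), of x v] by (simp add: commutator_def psi algebra_simps)
  qed
qed

section \<open>Averaging over a Hopf algebra\<close>

lemma sum_rotate3: "(\<Sum>a\<in>A. \<Sum>b\<in>B. \<Sum>c\<in>C. f a b c) = (\<Sum>c\<in>C. \<Sum>a\<in>A. \<Sum>b\<in>B. f a b c)"
  by (rule trans[OF sum.cong[OF refl sum.swap] sum.swap])

lemma sum_rotate5: "(\<Sum>a\<in>A. \<Sum>b\<in>B. \<Sum>c\<in>C. \<Sum>d\<in>D. \<Sum>e\<in>E. f a b c d e)
    = (\<Sum>e\<in>E. \<Sum>a\<in>A. \<Sum>b\<in>B. \<Sum>c\<in>C. \<Sum>d\<in>D. f a b c d e)"
proof -
  have "(\<Sum>a\<in>A. \<Sum>b\<in>B. \<Sum>c\<in>C. \<Sum>d\<in>D. \<Sum>e\<in>E. f a b c d e)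
    = (\<Sum>a\<in>A. \<Sum>b\<in>B. \<Sum>e\<in>E. \<Sum>c\<in>C. \<Sum>d\<in>D. f a b c d e)"
    by (rule sum.cong[OF refl], rule sum.cong[OF refl], rule sum_rotate3)
  also have "\<dots> = (\<Sum>e\<in>E. \<Sum>a\<in>A. \<Sum>b\<in>B. \<Sum>c\<in>C. \<Sum>d\<in>D. f a b c d e)"
    by (rule sum_rotate3)
  finally show ?thesis .
qed

lemma sum_swap_2_2: "(\<Sum>a\<in>A. \<Sum>b\<in>B. \<Sum>c\<in>C. \<Sum>d\<in>D. f a b c d) = (\<Sum>c\<in>C. \<Sum>d\<in>D. \<Sum>a\<in>A. \<Sum>b\<in>B. f a b c d)"
  by (rule trans[OF sum_rotate3], rule sum.cong[OF refl], rule sum_rotate3)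

lemma sum_swap_4_2: "(\<Sum>a\<in>A. \<Sum>b\<in>B. \<Sum>c\<in>C. \<Sum>d\<in>D. \<Sum>e\<in>E. \<Sum>g\<in>G. f a b c d e g)
    = (\<Sum>e\<in>E. \<Sum>g\<in>G. \<Sum>a\<in>A. \<Sum>b\<in>B. \<Sum>c\<in>C. \<Sum>d\<in>D. f a b c d e g)"
  by (rule trans[OF sum_rotate5], rule sum.cong[OF refl], rule sum_rotate5)

text \<open>A finite dimensional coalgebra given by the structure constants \<open>d k i j\<close> of its comultiplication and
  the counit \<open>e\<close>, acting through the convolution of operator-valued families.\<close>

locale coalgebra_constants = vspace s for s :: "'f::field \<Rightarrow> 'v::ab_group_add \<Rightarrow> 'v" +
  fixes J :: "'j set" and d :: "'j \<Rightarrow> 'j \<Rightarrow> 'j \<Rightarrow> 'f" and e :: "'j \<Rightarrow> 'f"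
  assumes fin: "finite J"
    and coassoc: "k \<in> J \<Longrightarrow> i \<in> J \<Longrightarrow> j \<in> J \<Longrightarrow> n \<in> J \<Longrightarrow>
      (\<Sum>l\<in>J. d k l n * d l i j) = (\<Sum>l\<in>J. d k i l * d l j n)"
    and counit_l: "k \<in> J \<Longrightarrow> j \<in> J \<Longrightarrow> (\<Sum>i\<in>J. d k i j * e i) = (if k = j then 1 else 0)"
    and counit_r: "k \<in> J \<Longrightarrow> i \<in> J \<Longrightarrow> (\<Sum>j\<in>J. d k i j * e j) = (if k = i then 1 else 0)"
begin

definition conv :: "('j \<Rightarrow> 'v \<Rightarrow> 'v) \<Rightarrow> ('j \<Rightarrow> 'v \<Rightarrow> 'v) \<Rightarrow> 'j \<Rightarrow> 'v \<Rightarrow> 'v" where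
  "conv f g k v = (\<Sum>i\<in>J. \<Sum>j\<in>J. s (d k i j) (f i (g j v)))"

lemma conv_cong: "(\<And>i v. i \<in> J \<Longrightarrow> f i v = f' i v) \<Longrightarrow> (\<And>i. i \<in> J \<Longrightarrow> g i v = g' i v) \<Longrightarrow> conv f g k v = conv f' g' k v"
  unfolding conv_def by (intro sum.cong) auto

lemma conv_assoc:
  assumes f: "\<And>i. i \<in> J \<Longrightarrow> Vector_Spaces.linear s s (f i)" and k: "k \<in> J"
  shows "conv (conv f g) h k v = conv f (conv g h) k v"
proof -
  have "conv (conv f g) h k v
      = (\<Sum>l\<in>J. \<Sum>n\<in>J. \<Sum>i\<in>J. \<Sum>j\<in>J. s (d k l n * d l i j) (f i (g j (h n v))))"
    by (simp add: conv_def scale_sum_right)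
  also have "\<dots> = (\<Sum>l\<in>J. \<Sum>i\<in>J. \<Sum>n\<in>J. \<Sum>j\<in>J. s (d k l n * d l i j) (f i (g j (h n v))))"
    by (rule sum.cong[OF refl], rule sum.swap)
  also have "\<dots> = (\<Sum>i\<in>J. \<Sum>l\<in>J. \<Sum>n\<in>J. \<Sum>j\<in>J. s (d k l n * d l i j) (f i (g j (h n v))))"
    by (rule sum.swap)
  also have "\<dots> = (\<Sum>i\<in>J. \<Sum>n\<in>J. \<Sum>j\<in>J. s (\<Sum>l\<in>J. d k l n * d l i j) (f i (g j (h n v))))"
    unfolding scale_sum_left by (rule sum.cong[OF refl], rule sum_rotate3[symmetric])
  also have "\<dots> = (\<Sum>i\<in>J. \<Sum>n\<in>J. \<Sum>j\<in>J. s (\<Sum>l\<in>J. d k i l * d l j n) (f i (g j (h n v))))"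
    by (intro sum.cong refl) (simp add: coassoc k)
  also have "\<dots> = (\<Sum>i\<in>J. \<Sum>l\<in>J. \<Sum>n\<in>J. \<Sum>j\<in>J. s (d k i l * d l j n) (f i (g j (h n v))))"
    unfolding scale_sum_left by (rule sum.cong[OF refl], rule sum_rotate3)
  also have "\<dots> = (\<Sum>i\<in>J. \<Sum>l\<in>J. \<Sum>j\<in>J. \<Sum>n\<in>J. s (d k i l * d l j n) (f i (g j (h n v))))"
    by (rule sum.cong[OF refl], rule sum.cong[OF refl], rule sum.swap)
  also have "\<dots> = conv f (conv g h) k v"
    unfolding conv_def
  proof (intro sum.cong refl)
    fix i l assume i: "i \<in> J"
    interpret f: Vector_Spaces.linear s s "f i" by (rule f[OF i])
    show "(\<Sum>j\<in>J. \<Sum>n\<in>J. s (d k i l * d l j n) (f i (g j (h n v))))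
        = s (d k i l) (f i (\<Sum>j\<in>J. \<Sum>n\<in>J. s (d l j n) (g j (h n v))))"
      by (simp add: f.sum f.scale scale_sum_right)
  qed
  finally show ?thesis .
qed

lemma conv_unit_left: "k \<in> J \<Longrightarrow> conv (\<lambda>i v. s (e i) v) g k v = g k v"
proof -
  assume k: "k \<in> J"
  have "conv (\<lambda>i v. s (e i) v) g k v = (\<Sum>j\<in>J. s (\<Sum>i\<in>J. d k i j * e i) (g j v))"
    unfolding conv_def by (subst sum.swap) (simp add: scale_sum_left)
  also have "\<dots> = (\<Sum>j\<in>J. if k = j then g j v else 0)"
    by (intro sum.cong refl) (simp add: counit_l k)
  finally show ?thesis using fin k by (simp add: sum.delta)
qed

lemma conv_unit_right:
  assumes f: "\<And>i. i \<in> J \<Longrightarrow> Vector_Spaces.linear s s (f i)" and k: "k \<in> J"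
  shows "conv f (\<lambda>j v. s (e j) (p v)) k v = f k (p v)"
proof -
  have "conv f (\<lambda>j v. s (e j) (p v)) k v = (\<Sum>i\<in>J. s (\<Sum>j\<in>J. d k i j * e j) (f i (p v)))"
    unfolding conv_def
  proof (rule sum.cong[OF refl])
    fix i assume i: "i \<in> J"
    interpret f: Vector_Spaces.linear s s "f i" by (rule f[OF i])
    show "(\<Sum>j\<in>J. s (d k i j) (f i (s (e j) (p v)))) = s (\<Sum>j\<in>J. d k i j * e j) (f i (p v))"
      by (simp add: f.scale scale_sum_left)
  qed
  also have "\<dots> = (\<Sum>i\<in>J. if k = i then f i (p v) else 0)"
    by (intro sum.cong refl) (simp add: counit_r k)
  finally show ?thesis using fin k by (simp add: sum.delta)
qed

text \<open>By associativity, a left and a right convolution inverse of \<open>g\<close>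
  agree.\<close>

lemma conv_inverse_unique:
  assumes f: "\<And>i. i \<in> J \<Longrightarrow> Vector_Spaces.linear s s (f i)"
    and fg: "\<And>k v. k \<in> J \<Longrightarrow> conv f g k v = s (e k) v" and gh: "\<And>k v. k \<in> J \<Longrightarrow> conv g h k v = s (e k) v"
    and k: "k \<in> J"
  shows "f k v = h k v"
proof -
  have "f k v = conv f (conv g h) k v"
    using conv_unit_right[OF f k, where p = "\<lambda>v. v" and v = v] conv_cong[of f f "conv g h" v "\<lambda>j v. s (e j) v" k] gh by simp
  also have "\<dots> = conv (conv f g) h k v" by (rule conv_assoc[OF f k, symmetric])
  also have "\<dots> = h k v"
    using conv_unit_left[OF k, of h v] conv_cong[of "conv f g" "\<lambda>i v. s (e i) v" h v h k] fg by simp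
  finally show ?thesis .
qed

end

text \<open>These are the constants of the tensor square of the coalgebra. Families indexed by pairs
  are maps out of H \<otimes> H, where uniqueness of convolution inverses can be applied to
  products.\<close>

lemma product_constants:
  fixes s :: "'f::field \<Rightarrow> 'v::ab_group_add \<Rightarrow> 'v" and J :: "'j set"
  assumes "coalgebra_constants s J d e"
  shows "coalgebra_constants s (J \<times> J)
    (\<lambda>(k, k') (i, i') (j, j'). d k i j * d k' i' j') (\<lambda>(k, k'). e k * e k')"
proof -
  interpret coalgebra_constants s J d e by fact
  have prod: "(\<Sum>x\<in>J \<times> J. f (fst x) * g (snd x)) = (\<Sum>x\<in>J. f x) * (\<Sum>y\<in>J. g y)" for f g :: "'j \<Rightarrow> 'f"
    by (simp add: sum_product sum.cartesian_product split_beta)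
  show ?thesis
  proof unfold_locales
    show "finite (J \<times> J)" using fin by simp
  next
    fix k i j n assume "k \<in> J \<times> J" "i \<in> J \<times> J" "j \<in> J \<times> J" "n \<in> J \<times> J"
    then show "(\<Sum>l\<in>J \<times> J. (case k of (k, k') \<Rightarrow> \<lambda>(i, i') (j, j'). d k i j * d k' i' j') l n *
           (case l of (k, k') \<Rightarrow> \<lambda>(i, i') (j, j'). d k i j * d k' i' j') i j) =
      (\<Sum>l\<in>J \<times> J. (case k of (k, k') \<Rightarrow> \<lambda>(i, i') (j, j'). d k i j * d k' i' j') i l *
           (case l of (k, k') \<Rightarrow> \<lambda>(i, i') (j, j'). d k i j * d k' i' j') j n)"
      using prod[of "\<lambda>l. d (fst k) l (fst n) * d l (fst i) (fst j)" "\<lambda>l. d (snd k) l (snd n) * d l (snd i) (snd j)"]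
        prod[of "\<lambda>l. d (fst k) (fst i) l * d l (fst j) (fst n)" "\<lambda>l. d (snd k) (snd i) l * d l (snd j) (snd n)"]
      by (auto simp: split_beta coassoc mult.assoc mult.left_commute)
  next
    fix k j assume "k \<in> J \<times> J" "j \<in> J \<times> J"
    then show "(\<Sum>i\<in>J \<times> J. (case k of (k, k') \<Rightarrow> \<lambda>(i, i') (j, j'). d k i j * d k' i' j') i j *
       (case i of (k, k') \<Rightarrow> e k * e k')) = (if k = j then 1 else 0)"
      using prod[of "\<lambda>l. d (fst k) l (fst j) * e l" "\<lambda>l. d (snd k) l (snd j) * e l"]
      by (auto simp: split_beta counit_l mult.assoc mult.left_commute prod_eq_iff)
  next
    fix k i assume "k \<in> J \<times> J" "i \<in> J \<times> J"
    then show "(\<Sum>j\<in>J \<times> J. (case k of (k, k') \<Rightarrow> \<lambda>(i, i') (j, j'). d k i j * d k' i' j') i j *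
       (case j of (k, k') \<Rightarrow> e k * e k')) = (if k = i then 1 else 0)"
      using prod[of "\<lambda>l. d (fst k) (fst i) l * e l" "\<lambda>l. d (snd k) (snd i) l * e l"]
      by (auto simp: split_beta counit_r mult.assoc mult.left_commute prod_eq_iff)
  qed
qed

text \<open>A representation \<open>A\<close> of a finite dimensional Hopf algebra with structure constants \<open>m\<close> (multiplication) and \<open>d\<close>
  (comultiplication); \<open>R k\<close> is the action of the antipode of the \<open>k\<close>-th basis vector.\<close>

locale hopf_constants = coalgebra_constants s J d e
  for s :: "'f::field \<Rightarrow> 'v::ab_group_add \<Rightarrow> 'v" and J :: "'j set" and d e +
  fixes m :: "'j \<Rightarrow> 'j \<Rightarrow> 'j \<Rightarrow> 'f" and A R :: "'j \<Rightarrow> 'v \<Rightarrow> 'v"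
  assumes compat: "k \<in> J \<Longrightarrow> l \<in> J \<Longrightarrow> i \<in> J \<Longrightarrow> j \<in> J \<Longrightarrow> (\<Sum>n\<in>J. m k l n * d n i j) =
      (\<Sum>a\<in>J. \<Sum>b\<in>J. \<Sum>a'\<in>J. \<Sum>b'\<in>J. d k a b * d l a' b' * m a a' i * m b b' j)"
    and counit_m: "k \<in> J \<Longrightarrow> l \<in> J \<Longrightarrow> (\<Sum>n\<in>J. m k l n * e n) = e k * e l"
    and A_linear: "Vector_Spaces.linear s s (A i)"
    and R_linear: "Vector_Spaces.linear s s (R i)"
    and A_m: "i \<in> J \<Longrightarrow> j \<in> J \<Longrightarrow> A i (A j v) = (\<Sum>n\<in>J. s (m i j n) (A n v))"
    and R_A: "k \<in> J \<Longrightarrow> (\<Sum>i\<in>J. \<Sum>j\<in>J. s (d k i j) (R i (A j v))) = s (e k) v"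
    and A_R: "k \<in> J \<Longrightarrow> (\<Sum>i\<in>J. \<Sum>j\<in>J. s (d k i j) (A i (R j v))) = s (e k) v"
begin

text \<open>Multiplicativity of the comultiplication, \<Delta>(k l) = \<Delta>(k) \<Delta>(l),
  evaluated on the bilinear extension of \<open>T\<close>.\<close>

lemma sum4_compat:
  fixes T :: "'j \<Rightarrow> 'j \<Rightarrow> 'v"
  assumes kl: "k \<in> J" "l \<in> J"
  shows "(\<Sum>a\<in>J. \<Sum>b\<in>J. \<Sum>a'\<in>J. \<Sum>b'\<in>J. s (d k a b * d l a' b')
      (\<Sum>i\<in>J. s (m a a' i) (\<Sum>j\<in>J. s (m b b' j) (T i j)))) = (\<Sum>n\<in>J. s (m k l n) (\<Sum>i\<in>J. \<Sum>j\<in>J. s (d n i j) (T i j)))"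
    (is "?L = ?R")
proof -
  let ?c = "\<lambda>a b a' b' i j. d k a b * d l a' b' * m a a' i * m b b' j"
  have "?L = (\<Sum>a\<in>J. \<Sum>b\<in>J. \<Sum>a'\<in>J. \<Sum>b'\<in>J. \<Sum>i\<in>J. \<Sum>j\<in>J. s (?c a b a' b' i j) (T i j))"
    by (simp add: scale_sum_right mult.assoc)
  also have "\<dots> = (\<Sum>i\<in>J. \<Sum>j\<in>J. \<Sum>a\<in>J. \<Sum>b\<in>J. \<Sum>a'\<in>J. \<Sum>b'\<in>J. s (?c a b a' b' i j) (T i j))"
    (is "_ = ?M")
    by (rule sum_swap_4_2)
  also have "\<dots> = (\<Sum>i\<in>J. \<Sum>j\<in>J. s (\<Sum>n\<in>J. m k l n * d n i j) (T i j))"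
    by (intro sum.cong refl) (simp add: compat kl scale_sum_left)
  also have "\<dots> = (\<Sum>i\<in>J. \<Sum>j\<in>J. \<Sum>n\<in>J. s (m k l n * d n i j) (T i j))"
    by (simp add: scale_sum_left)
  also have "\<dots> = ?R"
    by (simp add: scale_sum_right) (rule sum_rotate3)
  finally show ?thesis .
qed

text \<open>On H \<otimes> H the maps (k, l) \<mapsto> S(k l) and (k, l) \<mapsto> S(l) S(k), read
  as operators, are a left and a right convolution inverse of (k, l) \<mapsto> k l.\<close>

lemma R_antimult:
  assumes "k \<in> J" "l \<in> J"
  shows "(\<Sum>n\<in>J. s (m k l n) (R n v)) = R l (R k v)"
proof -
  interpret P: coalgebra_constants s "J \<times> J"
    "\<lambda>(k, k') (i, i') (j, j'). d k i j * d k' i' j'" "\<lambda>(k, k'). e k * e k'"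
    by (rule product_constants) unfold_locales
  define f where "f = (\<lambda>(k, l) v. \<Sum>n\<in>J. s (m k l n) (R n v))"
  define g where "g = (\<lambda>(k, l) v. A k (A l v))"
  define h where "h = (\<lambda>(k, l) v. R l (R k v))"
  have conv4: "P.conv f g (k, l) v = (\<Sum>a\<in>J. \<Sum>a'\<in>J. \<Sum>b\<in>J. \<Sum>b'\<in>J. s (d k a b * d l a' b') (f (a, a') (g (b, b') v)))"
    for f g k l v by (simp add: P.conv_def sum.cartesian_product')
  have "f (k, l) v = h (k, l) v"
  proof (rule P.conv_inverse_unique[where f = f and g = g and h = h and k = "(k, l)"])
    show "Vector_Spaces.linear s s (f x)" if "x \<in> J \<times> J" for x
      using R_linear by (cases x) (auto simp: f_def Vector_Spaces.linear_iff scale_sum_right sum.distrib algebra_simps)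
    show "P.conv f g x v = s (case x of (k, k') \<Rightarrow> e k * e k') v" if x: "x \<in> J \<times> J" for x v
    proof -
      obtain k l where kl: "x = (k, l)" "k \<in> J" "l \<in> J" using x by auto
      have "P.conv f g (k, l) v = (\<Sum>a\<in>J. \<Sum>a'\<in>J. \<Sum>b\<in>J. \<Sum>b'\<in>J. s (d k a b * d l a' b')
        (\<Sum>i\<in>J. s (m a a' i) (\<Sum>j\<in>J. s (m b b' j) (R i (A j v)))))"
        unfolding conv4
      proof (intro sum.cong refl)
        fix a a' b b' assume "a \<in> J" "a' \<in> J" "b \<in> J" "b' \<in> J"
        have "R i (\<Sum>j\<in>J. s (m b b' j) (A j v)) = (\<Sum>j\<in>J. s (m b b' j) (R i (A j v)))" for i
        proof -
          interpret Ri: Vector_Spaces.linear s s "R i" by (rule R_linear)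
          show ?thesis by (simp add: Ri.sum Ri.scale)
        qed
        then show "s (d k a b * d l a' b') (f (a, a') (g (b, b') v)) = s (d k a b * d l a' b')
          (\<Sum>i\<in>J. s (m a a' i) (\<Sum>j\<in>J. s (m b b' j) (R i (A j v))))"
          using \<open>b \<in> J\<close> \<open>b' \<in> J\<close> by (simp add: f_def g_def A_m)
      qed
      also have "\<dots> = (\<Sum>a\<in>J. \<Sum>b\<in>J. \<Sum>a'\<in>J. \<Sum>b'\<in>J. s (d k a b * d l a' b')
        (\<Sum>i\<in>J. s (m a a' i) (\<Sum>j\<in>J. s (m b b' j) (R i (A j v)))))"
        by (rule sum.cong[OF refl], rule sum.swap)
      also have "\<dots> = (\<Sum>n\<in>J. s (m k l n) (s (e n) v))"
        unfolding sum4_compat[OF kl(2,3)] by (intro sum.cong refl) (simp add: R_A)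
      also have "\<dots> = s (\<Sum>n\<in>J. m k l n * e n) v" by (simp add: scale_sum_left)
      finally show ?thesis using kl by (simp add: counit_m)
    qed
    show "P.conv g h x v = s (case x of (k, k') \<Rightarrow> e k * e k') v" if x: "x \<in> J \<times> J" for x v
    proof -
      obtain k l where kl: "x = (k, l)" "k \<in> J" "l \<in> J" using x by auto
      have "P.conv g h (k, l) v = (\<Sum>a\<in>J. \<Sum>b\<in>J. \<Sum>a'\<in>J. \<Sum>b'\<in>J. s (d k a b * d l a' b') (A a (A a' (R b' (R b v)))))"
        unfolding conv4 g_def h_def by simp (rule sum.cong[OF refl], rule sum.swap)
      also have "\<dots> = (\<Sum>a\<in>J. \<Sum>b\<in>J. s (d k a b) (A a (\<Sum>a'\<in>J. \<Sum>b'\<in>J. s (d l a' b') (A a' (R b' (R b v))))))"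
      proof (intro sum.cong refl)
        fix a b
        interpret Aa: Vector_Spaces.linear s s "A a" by (rule A_linear)
        show "(\<Sum>a'\<in>J. \<Sum>b'\<in>J. s (d k a b * d l a' b') (A a (A a' (R b' (R b v)))))
          = s (d k a b) (A a (\<Sum>a'\<in>J. \<Sum>b'\<in>J. s (d l a' b') (A a' (R b' (R b v)))))"
          by (simp add: Aa.sum Aa.scale scale_sum_right)
      qed
      also have "\<dots> = (\<Sum>a\<in>J. \<Sum>b\<in>J. s (e l) (s (d k a b) (A a (R b v))))"
      proof (intro sum.cong refl)
        fix a b
        interpret Aa: Vector_Spaces.linear s s "A a" by (rule A_linear)
        show "s (d k a b) (A a (\<Sum>a'\<in>J. \<Sum>b'\<in>J. s (d l a' b') (A a' (R b' (R b v))))) = s (e l) (s (d k a b) (A a (R b v)))"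
          by (simp add: A_R kl Aa.scale mult.commute)
      qed
      also have "\<dots> = s (e l) (s (e k) v)" unfolding scale_sum_right[symmetric] by (simp add: A_R kl)
      finally show ?thesis using kl by (simp add: mult.commute)
    qed
    show "(k, l) \<in> J \<times> J" using assms by simp
  qed
  then show ?thesis by (simp add: f_def h_def)
qed

text \<open>In Sweedler notation this is v \<mapsto> S(k_1) p(k_2 v), the adjoint action of
  \<open>k\<close> on the operator \<open>p\<close> from the right.\<close>

definition Phi :: "('v \<Rightarrow> 'v) \<Rightarrow> 'j \<Rightarrow> 'v \<Rightarrow> 'v" where
  "Phi p = conv R (\<lambda>j v. p (A j v))"

lemma Phi_linear: "Vector_Spaces.linear s s p \<Longrightarrow> Vector_Spaces.linear s s (Phi p k)"
  using A_linear R_linear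
  by (auto simp: Phi_def conv_def Vector_Spaces.linear_iff scale_sum_right sum.distrib algebra_simps)

text \<open>The antipode reverses products, so S(l_1) S(k_1) p(k_2 l_2 v) is the value for the
  product k l. Thus \<open>Phi\<close> is a right action, and a right integral makes its average
  invariant.\<close>

lemma Phi_Phi:
  assumes p: "Vector_Spaces.linear s s p" and kl: "k \<in> J" "l \<in> J"
  shows "Phi (Phi p k) l v = (\<Sum>n\<in>J. s (m k l n) (Phi p n v))"
proof -
  interpret p: Vector_Spaces.linear s s p by (rule p)
  have "Phi (Phi p k) l v = (\<Sum>a'\<in>J. \<Sum>b'\<in>J. \<Sum>a\<in>J. \<Sum>b\<in>J. s (d k a b * d l a' b') (R a' (R a (p (A b (A b' v))))))"
    unfolding Phi_def conv_def
  proof (intro sum.cong refl)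
    fix a' b'
    interpret Ra: Vector_Spaces.linear s s "R a'" by (rule R_linear)
    show "s (d l a' b') (R a' (\<Sum>a\<in>J. \<Sum>b\<in>J. s (d k a b) (R a (p (A b (A b' v))))))
      = (\<Sum>a\<in>J. \<Sum>b\<in>J. s (d k a b * d l a' b') (R a' (R a (p (A b (A b' v))))))"
      by (simp add: Ra.sum Ra.scale scale_sum_right mult.commute)
  qed
  also have "\<dots> = (\<Sum>a\<in>J. \<Sum>b\<in>J. \<Sum>a'\<in>J. \<Sum>b'\<in>J. s (d k a b * d l a' b') (R a' (R a (p (A b (A b' v))))))"
    by (rule sum_swap_2_2)
  also have "\<dots> = (\<Sum>a\<in>J. \<Sum>b\<in>J. \<Sum>a'\<in>J. \<Sum>b'\<in>J. s (d k a b * d l a' b')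
      (\<Sum>i\<in>J. s (m a a' i) (\<Sum>j\<in>J. s (m b b' j) (R i (p (A j v))))))"
  proof (intro sum.cong refl)
    fix a b a' b' assume J: "a \<in> J" "b \<in> J" "a' \<in> J" "b' \<in> J"
    have "R i (p (\<Sum>j\<in>J. s (m b b' j) (A j v))) = (\<Sum>j\<in>J. s (m b b' j) (R i (p (A j v))))" for i
    proof -
      interpret Ri: Vector_Spaces.linear s s "R i" by (rule R_linear)
      show ?thesis by (simp add: Ri.sum Ri.scale p.sum p.scale)
    qed
    moreover have "R a' (R a (p (A b (A b' v)))) = (\<Sum>i\<in>J. s (m a a' i) (R i (p (A b (A b' v)))))"
      using R_antimult J by simp
    ultimately show "s (d k a b * d l a' b') (R a' (R a (p (A b (A b' v))))) = s (d k a b * d l a' b')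
      (\<Sum>i\<in>J. s (m a a' i) (\<Sum>j\<in>J. s (m b b' j) (R i (p (A j v)))))"
      using J by (simp add: A_m)
  qed
  also have "\<dots> = (\<Sum>n\<in>J. s (m k l n) (Phi p n v))"
    unfolding sum4_compat[OF kl] by (simp add: Phi_def conv_def)
  finally show ?thesis .
qed

text \<open>Averaging with an integral makes \<open>p\<close> invariant under the Hopf algebra, because \<open>A l \<circ> q\<close> and
  \<open>q \<circ> A l\<close> are both the convolution of \<open>A\<close> with \<open>k \<mapsto> \<Phi> q k\<close> when \<open>\<Phi> q k = \<epsilon>\<^sub>k q\<close>.\<close>

lemma averaged_commutes:
  assumes p: "Vector_Spaces.linear s s p"
    and tau: "\<And>l n. l \<in> J \<Longrightarrow> n \<in> J \<Longrightarrow> (\<Sum>k\<in>J. \<tau> k * m k l n) = e l * \<tau> n"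
    and q: "\<And>v. q v = (\<Sum>k\<in>J. s (\<tau> k) (Phi p k v))" and l: "l \<in> J"
  shows "A l (q v) = q (A l v)"
proof -
  have Phi_sum: "Phi q l v = (\<Sum>k\<in>J. s (\<tau> k) (Phi (Phi p k) l v))" for l v
  proof -
    have "Phi q l v = (\<Sum>i\<in>J. \<Sum>j\<in>J. \<Sum>k\<in>J. s (\<tau> k) (s (d l i j) (R i (Phi p k (A j v)))))"
      unfolding Phi_def[of q] conv_def
    proof (intro sum.cong refl)
      fix i j
      interpret Ri: Vector_Spaces.linear s s "R i" by (rule R_linear)
      show "s (d l i j) (R i (q (A j v))) = (\<Sum>k\<in>J. s (\<tau> k) (s (d l i j) (R i (Phi p k (A j v)))))"
        unfolding q by (simp add: Ri.sum Ri.scale scale_sum_right mult.commute)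
    qed
    also have "\<dots> = (\<Sum>k\<in>J. \<Sum>i\<in>J. \<Sum>j\<in>J. s (\<tau> k) (s (d l i j) (R i (Phi p k (A j v)))))"
      by (subst (2) sum.swap, subst sum.swap) simp
    also have "\<dots> = (\<Sum>k\<in>J. s (\<tau> k) (Phi (Phi p k) l v))"
      by (simp add: Phi_def[of "Phi p _"] conv_def scale_sum_right)
    finally show ?thesis .
  qed
  have Phi_q: "Phi q l v = s (e l) (q v)" if l: "l \<in> J" for l v
  proof -
    have "Phi q l v = (\<Sum>k\<in>J. \<Sum>n\<in>J. s (\<tau> k * m k l n) (Phi p n v))"
      unfolding Phi_sum using l by (intro sum.cong refl) (simp add: Phi_Phi[OF p] scale_sum_right)
    also have "\<dots> = (\<Sum>n\<in>J. s (\<Sum>k\<in>J. \<tau> k * m k l n) (Phi p n v))"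
      by (subst sum.swap) (simp add: scale_sum_left)
    also have "\<dots> = (\<Sum>n\<in>J. s (e l * \<tau> n) (Phi p n v))" using tau l by simp
    also have "\<dots> = s (e l) (q v)" by (simp add: q scale_sum_right)
    finally show ?thesis .
  qed
  have "A l (q v) = conv A (\<lambda>j v. s (e j) (q v)) l v" by (rule conv_unit_right[OF A_linear l, symmetric])
  also have "\<dots> = conv A (conv R (\<lambda>j v. q (A j v))) l v"
    using Phi_q by (intro conv_cong) (auto simp: Phi_def)
  also have "\<dots> = conv (conv A R) (\<lambda>j v. q (A j v)) l v" by (rule conv_assoc[OF A_linear l, symmetric])
  also have "\<dots> = conv (\<lambda>i v. s (e i) v) (\<lambda>j v. q (A j v)) l v"
    by (intro conv_cong) (auto simp: conv_def A_R)
  also have "\<dots> = q (A l v)" by (rule conv_unit_left[OF l])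
  finally show ?thesis .
qed

text \<open>Averaging preserves linearity over the Lie algebra: if \<open>A \<psi>(a) = L * A\<close>, where the operators \<open>L i\<close> again come
  from the Lie algebra, then \<open>R * L = R * L * A * R = R * A \<psi>(a) * R = \<psi>(a) R\<close>.\<close>

lemma Phi_commutes:
  assumes p: "Vector_Spaces.linear s s p" and x: "Vector_Spaces.linear s s x"
    and L: "\<And>i. Vector_Spaces.linear s s (L i)"
    and pL: "\<And>i v. p (L i v) = L i (p v)"
    and xA: "\<And>k v. k \<in> J \<Longrightarrow> A k (x v) = (\<Sum>i\<in>J. \<Sum>j\<in>J. s (d k i j) (L i (A j v)))" and k: "k \<in> J"
  shows "Phi p k (x v) = x (Phi p k v)"
proof -
  interpret p: Vector_Spaces.linear s s p by (rule p)
  interpret x: Vector_Spaces.linear s s x by (rule x)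
  have xconv: "conv (\<lambda>i v. x (f i v)) g k v = x (conv f g k v)" for f g k v
    by (simp add: conv_def x.sum x.scale)
  have RL: "conv R L k v = x (R k v)" if k: "k \<in> J" for k v
  proof -
    have lRL: "Vector_Spaces.linear s s (conv R L i)" for i
      using L R_linear by (auto simp: conv_def Vector_Spaces.linear_iff scale_sum_right sum.distrib algebra_simps)
    have "conv R L k v = conv (conv R L) (\<lambda>j v. s (e j) v) k v"
      using conv_unit_right[OF lRL k, where p = "\<lambda>v. v" and v = v] by simp
    also have "\<dots> = conv (conv R L) (conv A R) k v" by (intro conv_cong) (auto simp: conv_def A_R)
    also have "\<dots> = conv R (conv L (conv A R)) k v" by (rule conv_assoc[OF R_linear k])
    also have "\<dots> = conv R (conv (conv L A) R) k v"
      by (rule conv_cong[OF refl], simp add: conv_assoc[OF L])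
    also have "\<dots> = conv R (conv (\<lambda>j v. A j (x v)) R) k v"
      by (rule conv_cong[OF refl], rule conv_cong[OF _ refl]) (simp add: conv_def[of L A] xA)
    also have "\<dots> = conv R (conv A (\<lambda>j v. x (R j v))) k v" by (simp add: conv_def)
    also have "\<dots> = conv (conv R A) (\<lambda>j v. x (R j v)) k v" by (rule conv_assoc[OF R_linear k, symmetric])
    also have "\<dots> = conv (\<lambda>i v. s (e i) v) (\<lambda>j v. x (R j v)) k v"
      by (intro conv_cong) (auto simp: conv_def R_A)
    also have "\<dots> = x (R k v)" by (rule conv_unit_left[OF k])
    finally show ?thesis .
  qed
  have "Phi p k (x v) = conv R (conv L (\<lambda>j v. p (A j v))) k v"
  proof -
    have "p (A j (x v)) = conv L (\<lambda>j v. p (A j v)) j v" if "j \<in> J" for j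
      using xA[OF that, of v] by (simp add: conv_def p.sum p.scale pL)
    then show ?thesis unfolding Phi_def by (simp add: conv_def[of R])
  qed
  also have "\<dots> = conv (conv R L) (\<lambda>j v. p (A j v)) k v" by (rule conv_assoc[OF R_linear k, symmetric])
  also have "\<dots> = conv (\<lambda>i v. x (R i v)) (\<lambda>j v. p (A j v)) k v" by (intro conv_cong RL) auto
  also have "\<dots> = x (Phi p k v)" unfolding xconv Phi_def ..
  finally show ?thesis .
qed

text \<open>\<open>\<tau>\<close> holds the coordinates of an element t with t l = \<epsilon>(l) t
  and \<epsilon>(t) = 1, and \<open>B\<close> is the action on the Lie algebra. Working with
  structure constants covers modules over H and over its dual alike.\<close>

theorem averaged_projection:
  assumes p: "Vector_Spaces.linear s s p" "\<And>v. p v \<in> W" "\<And>w. w \<in> W \<Longrightarrow> p w = w"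
    and W: "subspace W" "\<And>i w. i \<in> J \<Longrightarrow> w \<in> W \<Longrightarrow> A i w \<in> W" "\<And>i w. i \<in> J \<Longrightarrow> w \<in> W \<Longrightarrow> R i w \<in> W"
    and psi: "\<And>a. Vector_Spaces.linear s s (\<psi> a)" "\<And>a v. p (\<psi> a v) = \<psi> a (p v)"
    and psiA: "\<And>k a v. k \<in> J \<Longrightarrow> A k (\<psi> a v) = (\<Sum>i\<in>J. \<Sum>j\<in>J. s (d k i j) (\<psi> (B i a) (A j v)))"
    and tau: "\<And>l n. l \<in> J \<Longrightarrow> n \<in> J \<Longrightarrow> (\<Sum>k\<in>J. \<tau> k * m k l n) = e l * \<tau> n" "(\<Sum>k\<in>J. \<tau> k * e k) = 1"
  obtains q where "Vector_Spaces.linear s s q" "\<And>v. q v \<in> W" "\<And>w. w \<in> W \<Longrightarrow> q w = w"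
    "\<And>a v. q (\<psi> a v) = \<psi> a (q v)" "\<And>i v. i \<in> J \<Longrightarrow> q (A i v) = A i (q v)"
proof -
  define q where "q v = (\<Sum>k\<in>J. s (\<tau> k) (Phi p k v))" for v
  show ?thesis
  proof (rule that[of q])
    show "Vector_Spaces.linear s s q"
      using Phi_linear[OF p(1)] by (auto simp: q_def Vector_Spaces.linear_iff scale_sum_right sum.distrib algebra_simps)
    have "Phi p k v \<in> W" for k v
      unfolding Phi_def conv_def using W p(2) by (intro subspace_sum subspace_scale) auto
    then show "q v \<in> W" for v unfolding q_def using W(1) by (intro subspace_sum subspace_scale)
    show "q w = w" if w: "w \<in> W" for w
    proof -
      \<comment> \<open>On \<open>W\<close> the projection is the identity, so only the antipode
        identity S(k_1) k_2 = \<epsilon>(k) remains.\<close>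
      have "Phi p k w = s (e k) w" if k: "k \<in> J" for k
      proof -
        have "Phi p k w = (\<Sum>i\<in>J. \<Sum>j\<in>J. s (d k i j) (R i (A j w)))"
          unfolding Phi_def conv_def using W p(3) w by (intro sum.cong refl) auto
        then show ?thesis by (simp add: R_A k)
      qed
      then have "q w = s (\<Sum>k\<in>J. \<tau> k * e k) w" by (simp add: q_def scale_sum_left)
      then show ?thesis by (simp add: tau)
    qed
    show "q (\<psi> a v) = \<psi> a (q v)" for a v
    proof -
      interpret a: Vector_Spaces.linear s s "\<psi> a" by (rule psi(1))
      have "Phi p k (\<psi> a v) = \<psi> a (Phi p k v)" if "k \<in> J" for k
        using Phi_commutes[OF p(1) psi(1)[of a], of "\<lambda>i. \<psi> (B i a)"] psi psiA that by blast
      then show ?thesis by (simp add: q_def a.sum a.scale)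
    qed
    show "q (A i v) = A i (q v)" if "i \<in> J" for i v
      using averaged_commutes[OF p(1) tau(1) q_def that] by simp
  qed
qed

end

section \<open>Structure constants and integrals of a Hopf algebra\<close>

lemma vspace_iff: "vspace s \<longleftrightarrow> vector_space s"
  by (simp add: vspace_def)

lemma sweedler_linear: "vector_space s \<Longrightarrow> Vector_Spaces.linear free_scale s (sweedler s \<beta>)"
  unfolding sweedler_def by (rule linear_free_ext)

lemma free_ext_gen: "vector_space s \<Longrightarrow> free_ext s g (gen x) = g x"
  by (simp add: free_ext_def vector_space_def)

lemma sweedler_gen: "vector_space s \<Longrightarrow> sweedler s \<beta> (gen (a, b)) = \<beta> a b"
  by (simp add: sweedler_def free_ext_gen)

lemma sweedler_apply:
  assumes "Vector_Spaces.linear s s' \<Lambda>"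
  shows "\<Lambda> (sweedler s \<beta> t) = sweedler s' (\<lambda>a b. \<Lambda> (\<beta> a b)) t"
proof -
  interpret l: Vector_Spaces.linear s s' \<Lambda> by fact
  show ?thesis by (simp add: sweedler_def free_ext_def l.sum l.scale split_beta)
qed

lemma sweedler_sum:
  assumes "vector_space s"
  shows "sweedler s (\<lambda>a b. \<Sum>i\<in>I. \<beta> i a b) t = (\<Sum>i\<in>I. sweedler s (\<beta> i) t)"
proof -
  interpret vector_space s by fact
  show ?thesis unfolding sweedler_def free_ext_def split_beta scale_sum_right by (rule sum.swap)
qed

lemma sweedler_eq_0:
  assumes "vector_space s" "\<And>a b. (a, b) \<in> Poly_Mapping.keys t \<Longrightarrow> \<beta> a b = 0"
  shows "sweedler s \<beta> t = 0"
proof -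
  interpret vector_space s by fact
  show ?thesis unfolding sweedler_def free_ext_def by (intro sum.neutral) (auto simp: assms(2))
qed

lemma bilinear_mapI:
  assumes "vector_space sA" "vector_space sB" "vector_space sW"
    "\<And>a a' b. \<beta> (a + a') b = \<beta> a b + \<beta> a' b" "\<And>a b b'. \<beta> a (b + b') = \<beta> a b + \<beta> a b'"
    "\<And>c a b. \<beta> (sA c a) b = sW c (\<beta> a b)" "\<And>c a b. \<beta> a (sB c b) = sW c (\<beta> a b)"
  shows "bilinear_map sA sB sW \<beta>"
  using assms by (simp add: bilinear_map_def Vector_Spaces.linear_iff)

lemma bilinear_mapD:
  assumes "bilinear_map sA sB sW \<beta>"
  shows "\<beta> (a + a') b = \<beta> a b + \<beta> a' b" "\<beta> a (b + b') = \<beta> a b + \<beta> a b'"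
    "\<beta> (sA c a) b = sW c (\<beta> a b)" "\<beta> a (sB c b) = sW c (\<beta> a b)"
    "vector_space sA" "vector_space sB" "vector_space sW"
  using assms by (auto simp: bilinear_map_def Vector_Spaces.linear_iff)

text \<open>A trilinear map annihilates the generating relations, so it sees only the class of a
  tensor. Coassociativity, which is an equality of classes, is exploited through such maps.\<close>

lemma free_ext_cong3:
  assumes W: "vector_space sW"
    and "\<And>a a' b c. g (a + a', b, c) = g (a, b, c) + g (a', b, c)" "\<And>a b b' c. g (a, b + b', c) = g (a, b, c) + g (a, b', c)"
    "\<And>a b c c'. g (a, b, c + c') = g (a, b, c) + g (a, b, c')" "\<And>r a b c. g (sA r a, b, c) = sW r (g (a, b, c))"
    "\<And>r a b c. g (a, sB r b, c) = sW r (g (a, b, c))" "\<And>r a b c. g (a, b, sC r c) = sW r (g (a, b, c))"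
    and eq: "tensor3_eq sA sB sC t u"
  shows "free_ext sW g t = free_ext sW g u"
proof -
  interpret W: vector_space sW by (rule W)
  interpret E: Vector_Spaces.linear free_scale sW "free_ext sW g" by (rule linear_free_ext[OF W])
  have "free_ext sW g r = 0" if "r \<in> tensor3_relations sA sB sC" for r
    using that assms(2-7) unfolding tensor3_relations_def by (auto simp: E.diff E.scale free_ext_gen[OF W])
  then have "free_ext sW g (t - u) = 0" using eq E.eq_0_on_span unfolding tensor3_eq_def by blast
  then show ?thesis by (simp add: E.diff)
qed

lemma free_ext_apply_left:
  assumes "vector_space sW"
  shows "free_ext sW g (apply_left \<rho> t) = sweedler sW (\<lambda>a b. sweedler sW (\<lambda>d e. g (d, e, b)) (\<rho> a)) t"
  unfolding apply_left_def sweedler_apply[OF linear_free_ext[OF assms]] free_ext_gen[OF assms] ..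

lemma free_ext_apply_right:
  assumes "vector_space sW"
  shows "free_ext sW g (apply_right \<rho> t) = sweedler sW (\<lambda>a b. sweedler sW (\<lambda>d e. g (a, d, e)) (\<rho> b)) t"
  unfolding apply_right_def sweedler_apply[OF linear_free_ext[OF assms]] free_ext_gen[OF assms] ..

lemma sweedler_tensor_combine:
  assumes "vector_space sW"
  shows "sweedler sW \<beta> (tensor_combine f g t u)
    = sweedler sW (\<lambda>a b. sweedler sW (\<lambda>c d. \<beta> (f a c) (g b d)) u) t"
  unfolding tensor_combine_def sweedler_apply[OF sweedler_linear[OF assms]] sweedler_gen[OF assms] ..

context vspace
begin

lemma representation_linear:
  assumes "basis_of UNIV I"
  shows "representation I (x + y) i = representation I x i + representation I y i"
    "representation I (scale c x) i = c * representation I x i"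
  using assms by (auto simp: basis_of_def representation_add representation_scale)

text \<open>Expanding the right leg in the basis writes the tensor as \<Sum> t_i \<otimes> i, where
  t_i contracts that leg with the i-th coordinate. For a coaction the t_i become the operators
  \<open>coact i\<close>.\<close>

lemma sweedler_expand_right:
  assumes I: "basis_of UNIV I" and \<beta>: "bilinear_map sA scale sW \<beta>"
  shows "sweedler sW \<beta> t = (\<Sum>i\<in>I. \<beta> (sweedler sA (\<lambda>a b. sA (representation I b i) a) t) i)"
proof -
  note W = bilinear_mapD(7)[OF \<beta>]
  have "\<beta> a b = (\<Sum>i\<in>I. \<beta> (sA (representation I b i) a) i)" for a b
  proof -
    interpret b: Vector_Spaces.linear scale sW "\<beta> a" using \<beta> by (simp add: bilinear_map_def)
    have "\<beta> a b = \<beta> a (\<Sum>i\<in>I. scale (representation I b i) i)" using representation_expand[OF I] by simp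
    also have "\<dots> = (\<Sum>i\<in>I. \<beta> (sA (representation I b i) a) i)"
      by (simp add: b.sum b.scale bilinear_mapD[OF \<beta>])
    finally show ?thesis .
  qed
  then have "\<beta> = (\<lambda>a b. \<Sum>i\<in>I. \<beta> (sA (representation I b i) a) i)" by (intro ext)
  then have "sweedler sW \<beta> t = sweedler sW (\<lambda>a b. \<Sum>i\<in>I. \<beta> (sA (representation I b i) a) i) t" by (rule arg_cong)
  also have "\<dots> = (\<Sum>i\<in>I. sweedler sW (\<lambda>a b. \<beta> (sA (representation I b i) a) i) t)"
    by (rule sweedler_sum[OF W])
  also have "\<dots> = (\<Sum>i\<in>I. \<beta> (sweedler sA (\<lambda>a b. sA (representation I b i) a) t) i)"
  proof (rule sum.cong[OF refl])
    fix i
    have "Vector_Spaces.linear sA sW (\<lambda>a. \<beta> a i)" using \<beta> by (simp add: bilinear_map_def)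
    from sweedler_apply[OF this, of "\<lambda>a b. sA (representation I b i) a" t] show "sweedler sW (\<lambda>a b. \<beta> (sA (representation I b i) a) i) t
      = \<beta> (sweedler sA (\<lambda>a b. sA (representation I b i) a) t) i" by (rule sym)
  qed
  finally show ?thesis .
qed

end

section \<open>A finite dimensional Hopf algebra in coordinates\<close>

locale fd_hopf = hopf_algebra scale \<Delta> \<epsilon> S + vspace scale
  for scale :: "'f::field \<Rightarrow> 'h::ring_1 \<Rightarrow> 'h" and \<Delta> \<epsilon> S +
  fixes I :: "'h set"
  assumes I: "basis_of UNIV I"
begin

abbreviation r :: "'h \<Rightarrow> 'h \<Rightarrow> 'f" where "r \<equiv> representation I"

lemma finI: "finite I" and indI: "independent I"
  using I by (auto simp: basis_of_def)

lemma r_add: "r (x + y) i = r x i + r y i" and r_scale: "r (scale c x) i = c * r x i"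
  using representation_linear[OF I] by auto

lemma r_linear: "Vector_Spaces.linear scale (*) (\<lambda>x. r x i)"
  using vspace_mult by (simp add: Vector_Spaces.linear_iff vspace_iff vector_space_axioms r_add r_scale)

lemma r_sum: "r (\<Sum>a\<in>A. g a) i = (\<Sum>a\<in>A. r (g a) i)"
  using module_hom.sum[OF r_linear[unfolded linear_iff_module_hom]] by simp

lemma r_basis: "b \<in> I \<Longrightarrow> r b i = (if i = b then 1 else 0)"
  using representation_basis[OF indI] by simp

lemma expand: "(\<Sum>i\<in>I. scale (r x i) i) = x"
  using representation_expand[OF I] by simp

lemma linear_expand:
  assumes "Vector_Spaces.linear scale s g" shows "g x = (\<Sum>i\<in>I. s (r x i) (g i))"
proof -
  interpret g: Vector_Spaces.linear scale s g by fact
  have "g x = g (\<Sum>i\<in>I. scale (r x i) i)" by (simp only: expand)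
  then show ?thesis by (simp add: g.sum g.scale)
qed

lemma sum_r_right: "j \<in> I \<Longrightarrow> (\<Sum>q\<in>I. g q * r q j) = g j" "j \<in> I \<Longrightarrow> (\<Sum>q\<in>I. r q j * g q) = g j" for g :: "'h \<Rightarrow> 'f"
proof -
  assume j: "j \<in> I"
  have "(\<Sum>q\<in>I. g q * r q j) = (\<Sum>q\<in>I. if j = q then g q else 0)"
    by (intro sum.cong refl) (simp add: r_basis)
  then show "(\<Sum>q\<in>I. g q * r q j) = g j" using j finI by (simp add: sum.delta)
  then show "(\<Sum>q\<in>I. r q j * g q) = g j" by (simp add: mult.commute)
qed

lemma vmult: "vector_space ((*) :: 'f \<Rightarrow> 'f \<Rightarrow> 'f)"
  using vspace_mult by (simp add: vspace_iff)

text \<open>The coefficient of i \<otimes> j in \<Delta> x. Being the value of a bilinear form, it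
  is independent of the representative of \<Delta> x.\<close>

definition D :: "'h \<Rightarrow> 'h \<Rightarrow> 'h \<Rightarrow> 'f" where
  "D x i j = sweedler (*) (\<lambda>a b. r a i * r b j) (\<Delta> x)"

lemma functional_bilinear:
  assumes "Vector_Spaces.linear scale (*) f" "Vector_Spaces.linear scale (*) g"
  shows "bilinear_map scale scale (*) (\<lambda>a b. f a * g b)"
  using assms by (auto intro!: bilinear_mapI simp: Vector_Spaces.linear_iff algebra_simps)

lemma rr_bilinear: "bilinear_map scale scale (*) (\<lambda>a b. r a i * r b j)"
  by (rule functional_bilinear[OF r_linear r_linear])

lemma sweedler_comult_linear:
  assumes \<beta>: "bilinear_map scale scale sW \<beta>"
  shows "Vector_Spaces.linear scale sW (\<lambda>x. sweedler sW \<beta> (\<Delta> x))"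
proof -
  note W = bilinear_mapD(7)[OF \<beta>]
  interpret l: Vector_Spaces.linear free_scale sW "sweedler sW \<beta>" by (rule sweedler_linear[OF W])
  show ?thesis
    by (simp add: Vector_Spaces.linear_iff vector_space_axioms W sweedler_cong[OF \<beta> comult_add]
      sweedler_cong[OF \<beta> comult_scale] l.add l.scale)
qed

lemma D_linear: "Vector_Spaces.linear scale (*) (\<lambda>x. D x i j)"
  unfolding D_def by (rule sweedler_comult_linear[OF rr_bilinear])

lemma D_add: "D (x + y) i j = D x i j + D y i j" and D_scale: "D (scale c x) i j = c * D x i j"
  using D_linear[of i j] by (auto simp: Vector_Spaces.linear_iff)

lemma sweedler_expand:
  assumes \<beta>: "bilinear_map scale scale sW \<beta>"
  shows "sweedler sW \<beta> t = (\<Sum>i\<in>I. \<Sum>j\<in>I. sW (sweedler (*) (\<lambda>a b. r a i * r b j) t) (\<beta> i j))"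
proof -
  let ?P = "\<lambda>j. sweedler scale (\<lambda>a b. scale (r b j) a) t"
  have rP: "r (?P j) i = sweedler (*) (\<lambda>a b. r a i * r b j) t" for i j
    using sweedler_apply[OF r_linear[of i], of "\<lambda>a b. scale (r b j) a" t] by (simp add: r_scale mult.commute)
  have "sweedler sW \<beta> t = (\<Sum>j\<in>I. \<beta> (?P j) j)" by (rule sweedler_expand_right[OF I \<beta>])
  also have "\<dots> = (\<Sum>j\<in>I. \<Sum>i\<in>I. sW (r (?P j) i) (\<beta> i j))"
    using \<beta> by (intro sum.cong refl linear_expand) (simp add: bilinear_map_def)
  also have "\<dots> = (\<Sum>i\<in>I. \<Sum>j\<in>I. sW (sweedler (*) (\<lambda>a b. r a i * r b j) t) (\<beta> i j))"
    unfolding rP by (rule sum.swap)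
  finally show ?thesis .
qed

lemma comult_expand:
  "bilinear_map scale scale sW \<beta> \<Longrightarrow> sweedler sW \<beta> (\<Delta> x) = (\<Sum>i\<in>I. \<Sum>j\<in>I. sW (D x i j) (\<beta> i j))"
  unfolding D_def by (rule sweedler_expand)

lemma sweedler_mult_left: "sweedler (*) (\<lambda>a b. c * \<beta> a b) t = c * sweedler (*) \<beta> t"
  for c :: 'f and t :: "'h \<times> 'h \<Rightarrow>\<^sub>0 'f"
  unfolding sweedler_def free_ext_def split_beta sum_distrib_left by (intro sum.cong refl mult.left_commute)

text \<open>Coassociativity evaluated on the product of three coordinate functionals.\<close>

lemma D_coassoc:
  assumes "k \<in> I" "i \<in> I" "j \<in> I" "n \<in> I"
  shows "(\<Sum>l\<in>I. D k l n * D l i j) = (\<Sum>l\<in>I. D k i l * D l j n)"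
proof -
  let ?g = "\<lambda>(a, b, c). r a i * r b j * r c n"
  note sl = sweedler_mult_left
  have "free_ext (*) ?g (apply_left \<Delta> (\<Delta> k)) = free_ext (*) ?g (apply_right \<Delta> (\<Delta> k))"
    by (rule free_ext_cong3[OF vmult _ _ _ _ _ _ coassoc]) (auto simp: r_add r_scale algebra_simps)
  moreover have "free_ext (*) ?g (apply_left \<Delta> (\<Delta> k)) = sweedler (*) (\<lambda>a b. D a i j * r b n) (\<Delta> k)"
    unfolding free_ext_apply_left[OF vmult] D_def using sl by (simp add: mult.commute)
  moreover have "free_ext (*) ?g (apply_right \<Delta> (\<Delta> k)) = sweedler (*) (\<lambda>a b. r a i * D b j n) (\<Delta> k)"
    unfolding free_ext_apply_right[OF vmult] D_def using sl by (simp add: mult.assoc)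
  moreover have "bilinear_map scale scale (*) (\<lambda>a b. D a i j * r b n)" "bilinear_map scale scale (*) (\<lambda>a b. r a i * D b j n)"
    by (auto intro!: bilinear_mapI simp: r_add r_scale D_add D_scale algebra_simps vector_space_axioms vmult)
  ultimately have "(\<Sum>p\<in>I. \<Sum>q\<in>I. D k p q * (D p i j * r q n)) = (\<Sum>p\<in>I. \<Sum>q\<in>I. D k p q * (r p i * D q j n))"
    by (simp add: comult_expand)
  moreover have "(\<Sum>p\<in>I. \<Sum>q\<in>I. D k p q * (D p i j * r q n)) = (\<Sum>p\<in>I. D k p n * D p i j)"
    using sum_r_right(1)[OF assms(4), of "\<lambda>q. D k _ q * D _ i j"] by (simp add: mult.assoc)
  moreover have "(\<Sum>p\<in>I. \<Sum>q\<in>I. D k p q * (r p i * D q j n)) = (\<Sum>q\<in>I. D k i q * D q j n)"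
  proof -
    have "(\<Sum>p\<in>I. \<Sum>q\<in>I. D k p q * (r p i * D q j n)) = (\<Sum>p\<in>I. r p i * (\<Sum>q\<in>I. D k p q * D q j n))"
      by (simp add: sum_distrib_left mult.left_commute)
    then show ?thesis by (simp add: sum_r_right(2)[OF assms(2)])
  qed
  ultimately show ?thesis by simp
qed

lemma counit_add: "\<epsilon> (x + y) = \<epsilon> x + \<epsilon> y" and counit_scale: "\<epsilon> (scale c x) = c * \<epsilon> x"
  using counit_linear by (auto simp: Vector_Spaces.linear_iff)

lemma D_counit_left:
  assumes "k \<in> I" "j \<in> I" shows "(\<Sum>i\<in>I. D k i j * \<epsilon> i) = (if k = j then 1 else 0)"
proof -
  have "bilinear_map scale scale scale (\<lambda>a b. scale (\<epsilon> a) b)"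
    by (rule bilinear_mapI) (auto simp: counit_add counit_scale algebra_simps vector_space_axioms)
  from comult_expand[OF this, of k] have "(\<Sum>i\<in>I. \<Sum>q\<in>I. scale (D k i q) (scale (\<epsilon> i) q)) = k"
    by (simp only: counit_left)
  moreover have "r (\<Sum>i\<in>I. \<Sum>q\<in>I. scale (D k i q) (scale (\<epsilon> i) q)) j = (\<Sum>i\<in>I. \<Sum>q\<in>I. D k i q * \<epsilon> i * r q j)"
    by (simp only: r_sum r_scale mult.assoc)
  ultimately have "r k j = (\<Sum>i\<in>I. \<Sum>q\<in>I. D k i q * \<epsilon> i * r q j)" by simp
  also have "\<dots> = (\<Sum>i\<in>I. D k i j * \<epsilon> i)" by (simp add: sum_r_right(1)[OF assms(2)])
  finally show ?thesis using r_basis[OF assms(1)] by auto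
qed

lemma D_counit_right:
  assumes "k \<in> I" "i \<in> I" shows "(\<Sum>j\<in>I. D k i j * \<epsilon> j) = (if k = i then 1 else 0)"
proof -
  have "bilinear_map scale scale scale (\<lambda>a b. scale (\<epsilon> b) a)"
    by (rule bilinear_mapI) (auto simp: counit_add counit_scale algebra_simps vector_space_axioms)
  from comult_expand[OF this, of k] have "(\<Sum>p\<in>I. \<Sum>j\<in>I. scale (D k p j) (scale (\<epsilon> j) p)) = k"
    by (simp only: counit_right)
  moreover have "r (\<Sum>p\<in>I. \<Sum>j\<in>I. scale (D k p j) (scale (\<epsilon> j) p)) i = (\<Sum>p\<in>I. \<Sum>j\<in>I. D k p j * \<epsilon> j * r p i)"
    by (simp only: r_sum r_scale mult.assoc)
  ultimately have "r k i = (\<Sum>p\<in>I. \<Sum>j\<in>I. D k p j * \<epsilon> j * r p i)" by simp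
  also have "\<dots> = (\<Sum>p\<in>I. (\<Sum>j\<in>I. D k p j * \<epsilon> j) * r p i)" by (simp add: sum_distrib_right)
  also have "\<dots> = (\<Sum>j\<in>I. D k i j * \<epsilon> j)" by (simp add: sum_r_right(1)[OF assms(2)])
  finally show ?thesis using r_basis[OF assms(1)] by auto
qed

lemma D_mult:
  "D (x * y) p q = (\<Sum>a\<in>I. \<Sum>b\<in>I. \<Sum>a'\<in>I. \<Sum>b'\<in>I. D x a b * D y a' b' * r (a * a') p * r (b * b') q)"
proof -
  let ?\<beta> = "\<lambda>a b c d. r (a * c) p * r (b * d) q"
  have bl: "bilinear_map scale scale (*) (\<lambda>c d. ?\<beta> a b c d)" for a b
    by (rule bilinear_mapI) (auto simp: r_add r_scale algebra_simps scale_mult_right vector_space_axioms vmult)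
  have "D (x * y) p q = sweedler (*) (\<lambda>a b. r a p * r b q) (tensor_combine (*) (*) (\<Delta> x) (\<Delta> y))"
    unfolding D_def by (rule sweedler_cong[OF rr_bilinear comult_mult])
  also have "\<dots> = sweedler (*) (\<lambda>a b. sweedler (*) (?\<beta> a b) (\<Delta> y)) (\<Delta> x)"
    by (rule sweedler_tensor_combine[OF vmult])
  also have "\<dots> = sweedler (*) (\<lambda>a b. \<Sum>a'\<in>I. \<Sum>b'\<in>I. D y a' b' * ?\<beta> a b a' b') (\<Delta> x)"
    by (simp add: comult_expand[OF bl])
  also have "\<dots> = (\<Sum>a\<in>I. \<Sum>b\<in>I. D x a b * (\<Sum>a'\<in>I. \<Sum>b'\<in>I. D y a' b' * ?\<beta> a b a' b'))"
    by (rule comult_expand, rule bilinear_mapI)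
      (auto simp: r_add r_scale algebra_simps scale_mult_left vector_space_axioms vmult sum.distrib sum_distrib_left)
  finally show ?thesis by (simp add: sum_distrib_left mult.assoc)
qed

lemma D_one: "D 1 p q = r 1 p * r 1 q"
  unfolding D_def using sweedler_cong[OF rr_bilinear comult_one] by (simp add: sweedler_gen[OF vmult])

lemma S_linear: "S (x + y) = S x + S y" "S (scale c x) = scale c (S x)"
  using antipode_linear by (auto simp: Vector_Spaces.linear_iff)

lemma D_antipode_left: "(\<Sum>i\<in>I. \<Sum>j\<in>I. scale (D x i j) (S i * j)) = scale (\<epsilon> x) 1"
proof -
  have "bilinear_map scale scale scale (\<lambda>a b. S a * b)"
    by (rule bilinear_mapI) (auto simp: S_linear algebra_simps scale_mult_left scale_mult_right vector_space_axioms)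
  from comult_expand[OF this, of x] antipode_left show ?thesis by simp
qed

lemma D_antipode_right: "(\<Sum>i\<in>I. \<Sum>j\<in>I. scale (D x i j) (i * S j)) = scale (\<epsilon> x) 1"
proof -
  have "bilinear_map scale scale scale (\<lambda>a b. a * S b)"
    by (rule bilinear_mapI) (auto simp: S_linear algebra_simps scale_mult_left scale_mult_right vector_space_axioms)
  from comult_expand[OF this, of x] antipode_right show ?thesis by simp
qed

lemma module_constants:
  assumes "algebra_module scale sV act"
  shows "hopf_constants sV I D \<epsilon> (\<lambda>k l n. r (k * l) n) act (\<lambda>i. act (S i))"
proof -
  interpret algebra_module scale sV act by fact
  have act_l: "Vector_Spaces.linear sV sV (act h)" and act_l': "Vector_Spaces.linear scale sV (\<lambda>h. act h v)" for h v
    using act_bilinear by (auto simp: bilinear_map_def)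
  interpret a: Vector_Spaces.linear scale sV "\<lambda>h. act h v" for v by (rule act_l')
  show ?thesis
  proof unfold_locales
    show "finite I" by (rule finI)
    fix k i j n assume "k \<in> I" "i \<in> I" "j \<in> I" "n \<in> I"
    then show "(\<Sum>l\<in>I. D k l n * D l i j) = (\<Sum>l\<in>I. D k i l * D l j n)" by (rule D_coassoc)
  next
    fix k j assume "k \<in> I" "j \<in> I"
    then show "(\<Sum>i\<in>I. D k i j * \<epsilon> i) = (if k = j then 1 else 0)" by (rule D_counit_left)
  next
    fix k i assume "k \<in> I" "i \<in> I"
    then show "(\<Sum>j\<in>I. D k i j * \<epsilon> j) = (if k = i then 1 else 0)" by (rule D_counit_right)
  next
    fix k l i j
    show "(\<Sum>n\<in>I. r (k * l) n * D n i j)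
      = (\<Sum>a\<in>I. \<Sum>b\<in>I. \<Sum>a'\<in>I. \<Sum>b'\<in>I. D k a b * D l a' b' * r (a * a') i * r (b * b') j)"
      using linear_expand[OF D_linear, of "k * l" i j] by (simp add: D_mult)
  next
    fix k l
    show "(\<Sum>n\<in>I. r (k * l) n * \<epsilon> n) = \<epsilon> k * \<epsilon> l"
      using linear_expand[OF counit_linear, of "k * l"] by (simp add: counit_mult)
  next
    fix i j v
    show "act i (act j v) = (\<Sum>n\<in>I. sV (r (i * j) n) (act n v))"
      using linear_expand[OF act_l', of "i * j" v] by (simp add: act_mult)
  next
    fix k v
    have "(\<Sum>i\<in>I. \<Sum>j\<in>I. sV (D k i j) (act (S i) (act j v))) = act (\<Sum>i\<in>I. \<Sum>j\<in>I. scale (D k i j) (S i * j)) v"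
      by (simp add: a.sum a.scale act_mult)
    then show "(\<Sum>i\<in>I. \<Sum>j\<in>I. sV (D k i j) (act (S i) (act j v))) = sV (\<epsilon> k) v"
      by (simp add: D_antipode_left a.scale act_one)
    have "(\<Sum>i\<in>I. \<Sum>j\<in>I. sV (D k i j) (act i (act (S j) v))) = act (\<Sum>i\<in>I. \<Sum>j\<in>I. scale (D k i j) (i * S j)) v"
      by (simp add: a.sum a.scale act_mult)
    then show "(\<Sum>i\<in>I. \<Sum>j\<in>I. sV (D k i j) (act i (act (S j) v))) = sV (\<epsilon> k) v"
      by (simp add: D_antipode_right a.scale act_one)
  qed (use act_l in \<open>auto simp: Vector_Spaces.linear_iff\<close>)
qed

text \<open>A minimal left ideal not annihilated by the counit is spanned by an integral \<open>t\<close>; it is two-sided, since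
  \<open>y = t x\<close> with \<open>\<epsilon> x = 0\<close> satisfies \<open>y y = 0\<close> and would span a minimal left ideal containing
  a component of \<open>1\<close>.\<close>

lemma semisimple_integral:
  assumes semisimple
  obtains t where "\<And>h. t * h = scale (\<epsilon> h) t" "\<epsilon> t = 1"
proof -
  obtain n J where J: "\<And>i. i < n \<Longrightarrow> minimal_left_ideal (J i)" and ds: "is_direct_sum scale n J"
    using assms unfolding semisimple_def by blast
  obtain w where w: "\<And>i. i < n \<Longrightarrow> w i \<in> J i" "1 = (\<Sum>i<n. w i)"
    using ds unfolding is_direct_sum_def by metis
  interpret e: Vector_Spaces.linear scale "(*)" \<epsilon> by (rule counit_linear)
  have Jm: "subspace (J i)" "x * y \<in> J i" if "i < n" "y \<in> J i" for i x y
    using J[OF that(1)] that(2) unfolding minimal_left_ideal_def left_ideal_def by auto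
  have Jmin: "K = {0} \<or> K = J i" if "i < n" "subspace K" "\<And>x y. y \<in> K \<Longrightarrow> x * y \<in> K" "K \<subseteq> J i" for i K
    using J[OF that(1)] that(2-4) unfolding minimal_left_ideal_def left_ideal_def by blast
  have "(\<Sum>i<n. \<epsilon> (w i)) = 1" using counit_one w(2) by (simp add: e.sum[symmetric])
  then obtain j where j: "j < n" "\<epsilon> (w j) \<noteq> 0" by (metis (no_types, lifting) lessThan_iff sum.neutral zero_neq_one)
  define t where "t = scale (inverse (\<epsilon> (w j))) (w j)"
  have et: "\<epsilon> t = 1" using j by (simp add: t_def e.scale)
  have tJ: "t \<in> J j" unfolding t_def using Jm(1)[OF j(1)] w(1)[OF j(1)] by (intro subspace_scale) auto
  \<comment> \<open>The kernel of the counit inside the minimal left ideal is a left ideal that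
    misses \<open>t\<close>, hence 0, so the ideal is the line through \<open>t\<close>. As h t -
    \<epsilon>(h) t has counit 0, \<open>t\<close> is a left integral.\<close>
  let ?K = "{x \<in> J j. \<epsilon> x = 0}"
  have "?K = {0} \<or> ?K = J j"
  proof (rule Jmin[OF j(1)])
    show "subspace ?K" using Jm(1)[OF j(1) tJ]
      by (intro subspaceI) (auto simp: subspace_0 subspace_add subspace_scale e.add e.scale)
  qed (auto simp: Jm(2)[OF j(1)] counit_mult)
  moreover have "?K \<noteq> J j"
  proof
    assume "?K = J j"
    then have "t \<in> ?K" using tJ by simp
    then show False using et by simp
  qed
  ultimately have K: "?K = {0}" by blast
  have ht: "h * t = scale (\<epsilon> h) t" for h
  proof -
    have "h * t - scale (\<epsilon> h) t \<in> ?K"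
      using Jm[OF j(1) tJ] tJ et by (auto simp: subspace_diff subspace_scale e.diff e.scale counit_mult)
    then show ?thesis using K by simp
  qed
  have tx: "t * x = 0" if x: "\<epsilon> x = 0" for x
  proof (rule ccontr)
    define y where "y = t * x"
    assume "t * x \<noteq> 0"
    then have y0: "y \<noteq> 0" by (simp add: y_def)
    have hy: "h * y = scale (\<epsilon> h) y" for h
      using ht[of h] by (simp add: y_def mult.assoc[symmetric] scale_mult_left)
    have "\<epsilon> y = 0" by (simp add: y_def counit_mult x)
    then have yy: "y * y = 0" using hy[of y] by simp
    have "y = (\<Sum>i<n. y * w i)" using w(2) by (metis mult.right_neutral sum_distrib_left)
    then obtain i where i: "i < n" "y * w i \<noteq> 0" using y0 by (metis (no_types, lifting) lessThan_iff sum.neutral)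
    let ?z = "y * w i"
    have zJ: "?z \<in> J i" using Jm(2)[OF i(1) w(1)[OF i(1)]] .
    let ?F = "range (\<lambda>c. scale c ?z)"
    have "?F = {0} \<or> ?F = J i"
    proof (rule Jmin[OF i(1)])
      show "subspace ?F"
        by (rule subspaceI) (auto simp: image_iff scale_left_distrib[symmetric] intro: exI[of _ 0] exI)
      show "h * u \<in> ?F" if "u \<in> ?F" for h u
        using that hy[of h] by (auto simp: scale_mult_right mult.assoc[symmetric] scale_mult_left)
      show "?F \<subseteq> J i" using Jm(1)[OF i(1) zJ] zJ by (auto simp: subspace_scale)
    qed
    moreover have "?z \<in> ?F" by (rule range_eqI[of _ _ 1]) simp
    ultimately have "?F = J i" using i(2) by blast
    \<comment> \<open>The line through y w_i fills the minimal ideal, so w_i = c y w_i. Multiplying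
      by y on the left and using y y = 0 gives y w_i = 0.\<close>
    then obtain c where c: "w i = scale c ?z" using w(1)[OF i(1)] by auto
    have "?z = scale c (y * y * w i)" by (subst c) (simp add: scale_mult_right mult.assoc)
    then show False using yy i(2) by simp
  qed
  have "t * h = scale (\<epsilon> h) t" for h
  proof -
    have "\<epsilon> (h - scale (\<epsilon> h) 1) = 0" by (simp add: e.diff e.scale counit_one)
    then have "t * (h - scale (\<epsilon> h) 1) = 0" by (rule tx)
    then show ?thesis by (simp add: right_diff_distrib scale_mult_right)
  qed
  then show ?thesis using that et by blast
qed

text \<open>In a direct sum of simple subcoalgebras the group-like element \<open>1\<close> lies in one summand, which is therefore
  spanned by \<open>1\<close>; the coordinate of \<open>1\<close> is an integral in the dual.\<close>

lemma cosemisimple_integral: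
  assumes cosemisimple
  obtains \<phi> where "Vector_Spaces.linear scale (*) \<phi>" "\<phi> 1 = 1"
    "\<And>x. sweedler scale (\<lambda>a b. scale (\<phi> a) b) (\<Delta> x) = scale (\<phi> x) 1"
proof -
  obtain n C where C: "\<And>i. i < n \<Longrightarrow> simple_subcoalgebra (C i)" and ds: "is_direct_sum scale n C"
    using assms unfolding cosemisimple_def by blast
  have Cs: "subspace (C i)" if "i < n" for i using ds that unfolding is_direct_sum_def by blast
  have dec: "\<exists>w. (\<forall>i<n. w i \<in> C i) \<and> v = (\<Sum>i<n. w i)" for v using ds unfolding is_direct_sum_def by blast
  then obtain cmp where cmp: "\<And>v i. i < n \<Longrightarrow> cmp v i \<in> C i" "\<And>v. v = (\<Sum>i<n. cmp v i)" by metis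
  have unique: "cmp v i = w i" if "\<And>i. i < n \<Longrightarrow> w i \<in> C i" "v = (\<Sum>i<n. w i)" "i < n" for v w i
  proof -
    have "\<forall>i<n. cmp v i - w i = 0"
    proof -
      have s0: "(\<Sum>i<n. cmp v i - w i) = 0" using cmp(2)[of v] that(2) by (simp add: sum_subtractf)
      have s1: "\<forall>i<n. cmp v i - w i \<in> C i" using cmp(1) that(1) Cs by (simp add: subspace_diff)
      have z: "\<And>z. (\<forall>i<n. z i \<in> C i) \<and> (\<Sum>i<n. z i) = 0 \<longrightarrow> (\<forall>i<n. z i = 0)"
        using ds unfolding is_direct_sum_def by simp
      show ?thesis by (rule mp[OF z[of "\<lambda>i. cmp v i - w i"] conjI[OF s1 s0]])
    qed
    then show ?thesis using that(3) by simp
  qed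
  have cmp_lin: "Vector_Spaces.linear scale scale (\<lambda>v. cmp v i)" if i: "i < n" for i
  proof -
    have "cmp (v + w) i = cmp v i + cmp w i" for v w
      by (rule unique[OF _ _ i]) (use cmp Cs in \<open>auto simp: subspace_add sum.distrib\<close>)
    moreover have "cmp (scale c v) i = scale c (cmp v i)" for c v
      by (rule unique[OF _ _ i]) (use cmp Cs in \<open>auto simp: subspace_scale scale_sum_right[symmetric]\<close>)
    ultimately show ?thesis by (simp add: Vector_Spaces.linear_iff vector_space_axioms)
  qed
  have cmp_in: "cmp v i = (if i = k then v else 0)" if "k < n" "v \<in> C k" "i < n" for v i k
    by (rule unique[OF _ _ that(3)]) (use that Cs in \<open>auto simp: subspace_0 sum.delta\<close>)
  let ?w = "cmp 1"
  \<comment> \<open>Whenever 1 has a nonzero component in a summand, some functional normalised at 1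
    is supported on that summand alone.\<close>
  have ex: "\<exists>f. Vector_Spaces.linear scale (*) f \<and> f 1 = 1 \<and> (\<forall>k<n. k \<noteq> i \<longrightarrow> (\<forall>v\<in>C k. f v = 0))"
    if i: "i < n" "?w i \<noteq> 0" for i
  proof -
    interpret p: vector_space_pair scale "(*)" using vector_space_axioms vmult by (simp add: vector_space_pair_def)
    have "independent {?w i}" using i by simp
    from p.linear_independent_extend[OF this, of "\<lambda>_. 1"] obtain g where
      g: "Vector_Spaces.linear scale (*) g" "g (?w i) = 1" by auto
    have "Vector_Spaces.linear scale (*) (\<lambda>v. g (cmp v i))"
      using Vector_Spaces.linear_compose[OF cmp_lin[OF i(1)] g(1)] by (simp add: comp_def)
    moreover have "g 0 = 0" using g(1) by (metis Vector_Spaces.linear_iff mult_zero_left scale_zero_left)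
    then have "\<forall>k<n. k \<noteq> i \<longrightarrow> (\<forall>v\<in>C k. g (cmp v i) = 0)" using cmp_in i(1) by auto
    ultimately show ?thesis using g(2) by blast
  qed
  have "\<exists>j<n. ?w j \<noteq> 0" using cmp(2)[of 1] by (metis lessThan_iff sum.neutral zero_neq_one)
  then obtain j where j: "j < n" "?w j \<noteq> 0" by blast
  obtain \<phi> where \<phi>: "Vector_Spaces.linear scale (*) \<phi>" "\<phi> 1 = 1" "\<And>k v. k < n \<Longrightarrow> k \<noteq> j \<Longrightarrow> v \<in> C k \<Longrightarrow> \<phi> v = 0"
    using ex[OF j] by blast
  interpret phi: Vector_Spaces.linear scale "(*)" \<phi> by (rule \<phi>(1))
  have tens: "\<exists>u. Poly_Mapping.keys u \<subseteq> C i \<times> C i \<and> tensor_eq scale scale (\<Delta> x) u" if "i < n" "x \<in> C i" for i x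
    using C[OF that(1)] that(2) unfolding simple_subcoalgebra_def subcoalgebra_def in_tensor_def by blast
  \<comment> \<open>Pairing \<Delta> 1 = 1 \<otimes> 1 with \<phi> \<otimes> f gives 1. But \<Delta>
    sends each component of 1 into the tensor square of its summand, where one of the two
    functionals vanishes.\<close>
  have w0: "?w k = 0" if k: "k < n" "k \<noteq> j" for k
  proof (rule ccontr)
    assume "?w k \<noteq> 0"
    then obtain f where f: "Vector_Spaces.linear scale (*) f" "f 1 = 1" "\<And>i v. i < n \<Longrightarrow> i \<noteq> k \<Longrightarrow> v \<in> C i \<Longrightarrow> f v = 0"
      using ex[OF k(1)] by blast
    interpret f: Vector_Spaces.linear scale "(*)" f by (rule f(1))
    have bl: "bilinear_map scale scale (*) (\<lambda>a b. \<phi> a * f b)"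
      by (rule functional_bilinear[OF \<phi>(1) f(1)])
    interpret l: Vector_Spaces.linear scale "(*)" "\<lambda>x. sweedler (*) (\<lambda>a b. \<phi> a * f b) (\<Delta> x)"
      by (rule sweedler_comult_linear[OF bl])
    have z: "sweedler (*) (\<lambda>a b. \<phi> a * f b) (\<Delta> (?w i)) = 0" if i: "i < n" for i
    proof -
      obtain u where u: "Poly_Mapping.keys u \<subseteq> C i \<times> C i" "tensor_eq scale scale (\<Delta> (?w i)) u"
        using tens[OF i cmp(1)[OF i]] by blast
      have "sweedler (*) (\<lambda>a b. \<phi> a * f b) u = 0"
      proof (rule sweedler_eq_0[OF vmult])
        fix a b assume "(a, b) \<in> Poly_Mapping.keys u"
        then have "a \<in> C i" "b \<in> C i" using u by auto
        then show "\<phi> a * f b = 0" using \<phi>(3)[OF i] f(3)[OF i] k by (cases "i = j") auto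
      qed
      then show ?thesis using sweedler_cong[OF bl u(2)] by simp
    qed
    have "sweedler (*) (\<lambda>a b. \<phi> a * f b) (\<Delta> 1) = (\<Sum>i<n. sweedler (*) (\<lambda>a b. \<phi> a * f b) (\<Delta> (?w i)))"
      by (subst cmp(2)[of 1]) (rule l.sum)
    also have "\<dots> = 0" using z by simp
    finally show False using sweedler_cong[OF bl comult_one] \<phi>(2) f(2) by (simp add: sweedler_gen[OF vmult])
  qed
  have "1 = ?w j"
    using cmp(2)[of 1] w0 j(1) by (metis (no_types, lifting) finite_lessThan lessThan_iff sum.remove add.right_neutral
      sum.neutral Diff_iff singleton_iff)
  then have oneC: "1 \<in> C j" using cmp(1)[OF j(1)] by metis
  \<comment> \<open>The line through 1 is a nonzero subcoalgebra of the simple summand that contains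
    1, hence all of it.\<close>
  let ?E = "range (\<lambda>c. scale c 1)"
  have "subcoalgebra ?E"
    unfolding subcoalgebra_def
  proof
    show "subspace ?E" by (rule subspaceI) (auto simp: image_iff scale_left_distrib[symmetric] intro: exI[of _ 0] exI)
    interpret F: vector_space "free_scale :: 'f \<Rightarrow> ('h \<times> 'h \<Rightarrow>\<^sub>0 'f) \<Rightarrow> _" by (rule vector_space_free_scale)
    show "\<forall>x\<in>?E. in_tensor scale scale ?E ?E (\<Delta> x)"
    proof
      fix x assume "x \<in> ?E"
      then obtain c where c: "x = scale c 1" by auto
      have "\<Delta> x - free_scale c (\<Delta> 1) \<in> F.span (tensor_relations scale scale)"
        using comult_scale[of c 1] by (simp add: tensor_eq_def c)
      moreover have "free_scale c (\<Delta> 1 - gen (1, 1)) \<in> F.span (tensor_relations scale scale)"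
        using comult_one by (intro F.span_scale) (simp add: tensor_eq_def)
      ultimately have "(\<Delta> x - free_scale c (\<Delta> 1)) + free_scale c (\<Delta> 1 - gen (1, 1)) \<in> F.span (tensor_relations scale scale)"
        by (rule F.span_add)
      then have "tensor_eq scale scale (\<Delta> x) (free_scale c (gen (1, 1)))"
        by (simp add: tensor_eq_def F.scale_right_diff_distrib)
      moreover have "1 \<in> ?E" by (rule range_eqI[of _ _ 1]) simp
      then have "Poly_Mapping.keys (free_scale c (gen (1, 1))) \<subseteq> ?E \<times> ?E"
        by (auto simp: in_keys_iff lookup_single when_def split: if_splits)
      ultimately show "in_tensor scale scale ?E ?E (\<Delta> x)" unfolding in_tensor_def by blast
    qed
  qed
  moreover have "?E \<subseteq> C j" using oneC Cs[OF j(1)] by (auto simp: subspace_scale)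
  moreover have "?E \<noteq> {0}"
  proof
    assume "?E = {0}"
    moreover have "1 \<in> ?E" by (rule range_eqI[of _ _ 1]) simp
    ultimately show False by simp
  qed
  ultimately have CE: "C j = ?E" using C[OF j(1)] unfolding simple_subcoalgebra_def by blast
  have bl: "bilinear_map scale scale scale (\<lambda>a b. scale (\<phi> a) b)"
    using \<phi>(1) by (auto intro!: bilinear_mapI simp: Vector_Spaces.linear_iff scale_left_distrib scale_right_distrib mult.commute)
  interpret l: Vector_Spaces.linear scale scale "\<lambda>x. sweedler scale (\<lambda>a b. scale (\<phi> a) b) (\<Delta> x)"
    by (rule sweedler_comult_linear[OF bl])
  have one: "sweedler scale (\<lambda>a b. scale (\<phi> a) b) (\<Delta> 1) = 1"
    using sweedler_cong[OF bl comult_one] \<phi>(2) by (simp add: sweedler_gen[OF vector_space_axioms])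
  \<comment> \<open>On the line through 1 the identity follows from its value at 1; on any other
    summand \<phi> vanishes on x and on all left legs of \<Delta> x.\<close>
  have comp: "sweedler scale (\<lambda>a b. scale (\<phi> a) b) (\<Delta> x) = scale (\<phi> x) 1" if i: "i < n" and x: "x \<in> C i" for i x
  proof (cases "i = j")
    case True
    then obtain c where "x = scale c 1" using x CE by auto
    then show ?thesis using one \<phi>(2) by (simp add: l.scale phi.scale)
  next
    case False
    obtain u where u: "Poly_Mapping.keys u \<subseteq> C i \<times> C i" "tensor_eq scale scale (\<Delta> x) u"
      using tens[OF i x] by blast
    have "sweedler scale (\<lambda>a b. scale (\<phi> a) b) u = 0"
      by (rule sweedler_eq_0[OF vector_space_axioms]) (use u(1) \<phi>(3)[OF i False] in auto)
    then show ?thesis using sweedler_cong[OF bl u(2)] \<phi>(3)[OF i False x] by simp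
  qed
  have "sweedler scale (\<lambda>a b. scale (\<phi> a) b) (\<Delta> x) = scale (\<phi> x) 1" for x
  proof -
    have "sweedler scale (\<lambda>a b. scale (\<phi> a) b) (\<Delta> x) = (\<Sum>i<n. sweedler scale (\<lambda>a b. scale (\<phi> a) b) (\<Delta> (cmp x i)))"
      by (subst cmp(2)[of x]) (rule l.sum)
    also have "\<dots> = (\<Sum>i<n. scale (\<phi> (cmp x i)) 1)" by (intro sum.cong refl comp) (auto simp: cmp)
    also have "\<dots> = scale (\<phi> (\<Sum>i<n. cmp x i)) 1" by (simp add: phi.sum scale_sum_left)
    finally show ?thesis using cmp(2)[of x] by simp
  qed
  then show ?thesis using that \<phi> by blast
qed

end

section \<open>Comodules over the Hopf algebra\<close>

text \<open>Bilinear forms separate tensors: a functional on the free space that vanishes on the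
  relations but not on t - u restricts on the generators to a bilinear form.\<close>

lemma tensor_eqI:
  assumes A: "vector_space sA" and B: "vector_space sB"
    and eq: "\<And>\<beta>. bilinear_map sA sB (*) \<beta> \<Longrightarrow> sweedler (*) \<beta> t = sweedler (*) \<beta> u"
  shows "tensor_eq sA sB t u"
proof (rule ccontr)
  interpret F: vector_space "free_scale :: 'a \<Rightarrow> ('b \<times> 'c \<Rightarrow>\<^sub>0 'a) \<Rightarrow> _" by (rule vector_space_free_scale)
  have vm: "vector_space ((*) :: 'a \<Rightarrow> 'a \<Rightarrow> 'a)" using vspace_mult by (simp add: vspace_iff)
  assume "\<not> tensor_eq sA sB t u"
  then have no: "t - u \<notin> F.span (tensor_relations sA sB)" by (simp add: tensor_eq_def)
  \<comment> \<open>Values of a functional can be prescribed on an independent set, so the relations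
    are thinned to a basis of their span before t - u is adjoined.\<close>
  obtain C where C: "C \<subseteq> tensor_relations sA sB" "F.independent C" "tensor_relations sA sB \<subseteq> F.span C"
    using F.maximal_independent_subset by metis
  have "F.span (tensor_relations sA sB) = F.span C"
    using C F.span_minimal F.span_mono by (metis F.subspace_span subset_antisym)
  then have no': "t - u \<notin> F.span C" using no by simp
  interpret p: vector_space_pair "free_scale :: 'a \<Rightarrow> ('b \<times> 'c \<Rightarrow>\<^sub>0 'a) \<Rightarrow> _" "(*) :: 'a \<Rightarrow> 'a \<Rightarrow> 'a"
    using F.vector_space_axioms vm by (simp add: vector_space_pair_def)
  have "F.independent (insert (t - u) C)" using no' C(2) by (rule F.independent_insertI)
  from p.linear_independent_extend[OF this, of "\<lambda>x. if x = t - u then 1 else 0"] obtain \<Lambda> where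
    \<Lambda>: "Vector_Spaces.linear free_scale (*) \<Lambda>" "\<Lambda> (t - u) = 1" "\<And>x. x \<in> C \<Longrightarrow> x \<noteq> t - u \<Longrightarrow> \<Lambda> x = 0" by auto
  have "\<Lambda> x = 0" if "x \<in> C" for x
    using that \<Lambda>(3) no' F.span_base[of "t - u" C] by metis
  then have z: "\<Lambda> x = 0" if "x \<in> tensor_relations sA sB" for x
    using module_hom.eq_0_on_span[OF \<Lambda>(1)[unfolded linear_iff_module_hom], of C x] C(3) that by blast
  have lam: "\<Lambda> (x - y) = \<Lambda> x - \<Lambda> y" "\<Lambda> (x + y) = \<Lambda> x + \<Lambda> y" "\<Lambda> (free_scale c x) = c * \<Lambda> x" for x y c
    using module_hom.diff[OF \<Lambda>(1)[unfolded linear_iff_module_hom]] \<Lambda>(1) by (auto simp: Vector_Spaces.linear_iff)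
  have z': "\<Lambda> (x - y - w) = 0 \<Longrightarrow> \<Lambda> x = \<Lambda> y + \<Lambda> w" "\<Lambda> (x - free_scale c y) = 0 \<Longrightarrow> \<Lambda> x = c * \<Lambda> y" for x y w c
    by (simp_all add: lam diff_diff_eq)
  define \<beta> where "\<beta> a b = \<Lambda> (gen (a, b))" for a b
  have "bilinear_map sA sB (*) \<beta>"
  proof (rule bilinear_mapI[OF A B vm])
    show "\<beta> (a + a') b = \<beta> a b + \<beta> a' b" for a a' b
      unfolding \<beta>_def by (rule z'(1)[OF z]) (unfold tensor_relations_def, blast)
    show "\<beta> a (b + b') = \<beta> a b + \<beta> a b'" for a b b'
      unfolding \<beta>_def by (rule z'(1)[OF z]) (unfold tensor_relations_def, blast)
    show "\<beta> (sA c a) b = c * \<beta> a b" for c a b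
      unfolding \<beta>_def by (rule z'(2)[OF z]) (unfold tensor_relations_def, blast)
    show "\<beta> a (sB c b) = c * \<beta> a b" for c a b
      unfolding \<beta>_def by (rule z'(2)[OF z]) (unfold tensor_relations_def, blast)
  qed
  moreover have "\<Lambda> x = sweedler (*) \<beta> x" for x
  proof -
    have "x = sweedler free_scale (\<lambda>a b. gen (a, b)) x"
    proof (rule poly_mapping_eqI)
      fix k
      have "Poly_Mapping.lookup (sweedler free_scale (\<lambda>a b. gen (a, b)) x) k
        = (\<Sum>i\<in>Poly_Mapping.keys x. if i = k then Poly_Mapping.lookup x i else 0)"
        unfolding sweedler_def free_ext_def lookup_sum
        by (intro sum.cong refl) (auto simp: lookup_single when_def)
      then show "Poly_Mapping.lookup x k = Poly_Mapping.lookup (sweedler free_scale (\<lambda>a b. gen (a, b)) x) k"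
        by (auto simp: sum.delta in_keys_iff)
    qed
    then have "\<Lambda> x = \<Lambda> (sweedler free_scale (\<lambda>a b. gen (a, b)) x)" by (rule arg_cong)
    then show ?thesis using sweedler_apply[OF \<Lambda>(1), of "\<lambda>a b. gen (a, b)" x] by (simp add: \<beta>_def[abs_def])
  qed
  ultimately have "\<Lambda> t = \<Lambda> u" using eq by simp
  then show False using \<Lambda>(2) by (simp add: lam)
qed

locale fd_hopf_comodule = fd_hopf scale \<Delta> \<epsilon> S I + V: vspace sV + C: coalgebra_comodule scale \<Delta> \<epsilon> sV \<rho>
  for scale :: "'f::field \<Rightarrow> 'h::ring_1 \<Rightarrow> 'h" and \<Delta> \<epsilon> S I
    and sV :: "'f \<Rightarrow> 'v::ab_group_add \<Rightarrow> 'v" and \<rho>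
begin

text \<open>The dual basis vector at \<open>i\<close> acts by evaluating the H-leg of the coaction;
  this turns the right comodule into a left module over the dual algebra.\<close>

definition coact :: "'h \<Rightarrow> 'v \<Rightarrow> 'v" where
  "coact i v = sweedler sV (\<lambda>w h. sV (r h i) w) (\<rho> v)"

lemma sweedler_coact_linear:
  assumes \<beta>: "bilinear_map sV scale sW \<beta>"
  shows "Vector_Spaces.linear sV sW (\<lambda>v. sweedler sW \<beta> (\<rho> v))"
proof -
  note W = bilinear_mapD(7)[OF \<beta>]
  have "sweedler sW \<beta> (x + y) = sweedler sW \<beta> x + sweedler sW \<beta> y"
    "sweedler sW \<beta> (free_scale c x) = sW c (sweedler sW \<beta> x)" for x y c
    using sweedler_linear[OF W, of \<beta>] by (auto simp: Vector_Spaces.linear_iff)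
  then show ?thesis
    by (simp add: Vector_Spaces.linear_iff V.vector_space_axioms W sweedler_cong[OF \<beta> C.coact_add]
      sweedler_cong[OF \<beta> C.coact_scale])
qed

lemma coordinate_bilinear: 
  assumes "Vector_Spaces.linear scale (*) f" "Vector_Spaces.linear sV sV g"
  shows "bilinear_map sV scale sV (\<lambda>w h. sV (f h) (g w))"
  using assms by (auto intro!: bilinear_mapI simp: Vector_Spaces.linear_iff V.scale_left_distrib V.scale_right_distrib mult.commute)

lemma coact_linear: "Vector_Spaces.linear sV sV (coact i)"
  unfolding coact_def[abs_def] by (rule sweedler_coact_linear[OF coordinate_bilinear[OF r_linear V.linear_identity]])

lemma coact_expand:
  "bilinear_map sV scale sW \<beta> \<Longrightarrow> sweedler sW \<beta> (\<rho> v) = (\<Sum>i\<in>I. \<beta> (coact i v) i)"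
  unfolding coact_def by (rule sweedler_expand_right[OF I])

text \<open>Coassociativity paired with the coordinates at \<open>k\<close> and \<open>l\<close>:
  one side applies the coaction twice, the other splits the H-leg by \<Delta> and so produces the
  product of two dual basis vectors.\<close>

lemma coact_coact:
  assumes "l \<in> I" shows "coact k (coact l v) = (\<Sum>n\<in>I. sV (D n k l) (coact n v))"
proof -
  let ?g = "\<lambda>(w, h, h'). sV (r h k * r h' l) w"
  have sl: "Vector_Spaces.linear sV sV (sV c)" for c
    by (simp add: Vector_Spaces.linear_iff V.vector_space_axioms V.scale_right_distrib mult.commute)
  have sl': "Vector_Spaces.linear (*) sV (\<lambda>c. sV c w)" for w
    by (simp add: Vector_Spaces.linear_iff V.vector_space_axioms vmult V.scale_left_distrib)
  have "free_ext sV ?g (apply_left \<rho> (\<rho> v)) = free_ext sV ?g (apply_right \<Delta> (\<rho> v))"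
    by (rule free_ext_cong3[OF V.vector_space_axioms _ _ _ _ _ _ C.coact_coassoc])
      (auto simp: r_add r_scale V.scale_left_distrib V.scale_right_distrib distrib_left distrib_right mult_ac)
  moreover have "free_ext sV ?g (apply_left \<rho> (\<rho> v)) = sweedler sV (\<lambda>w h'. sV (r h' l) (coact k w)) (\<rho> v)"
    unfolding free_ext_apply_left[OF V.vector_space_axioms] coact_def sweedler_apply[OF sl]
    by (simp add: mult.commute)
  moreover have "free_ext sV ?g (apply_right \<Delta> (\<rho> v)) = sweedler sV (\<lambda>w h. sV (D h k l) w) (\<rho> v)"
    unfolding free_ext_apply_right[OF V.vector_space_axioms] D_def sweedler_apply[OF sl'] by simp
  ultimately have "(\<Sum>i\<in>I. sV (r i l) (coact k (coact i v))) = (\<Sum>n\<in>I. sV (D n k l) (coact n v))"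
    using coact_expand[OF coordinate_bilinear[OF r_linear coact_linear]]
      coact_expand[OF coordinate_bilinear[OF D_linear V.linear_identity]] by simp
  moreover have "(\<Sum>i\<in>I. sV (r i l) (coact k (coact i v))) = (\<Sum>i\<in>I. if l = i then coact k (coact i v) else 0)"
    by (intro sum.cong refl) (simp add: r_basis)
  ultimately show ?thesis using assms finI by (simp add: sum.delta)
qed

lemma coact_counit_expand: "(\<Sum>n\<in>I. sV (\<epsilon> n) (coact n v)) = v"
  using coact_expand[OF coordinate_bilinear[OF counit_linear V.linear_identity], of v] C.coact_counit by simp

text \<open>The comodule is a module over the dual Hopf algebra; in the dual basis the structure constants
  of multiplication and comultiplication change places.\<close>

lemma comodule_constants:
  "hopf_constants sV I (\<lambda>k i j. r (i * j) k) (r 1) (\<lambda>k l n. D n k l) coact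
    (\<lambda>i v. \<Sum>j\<in>I. sV (r (S j) i) (coact j v))"
proof -
  have ml: "Vector_Spaces.linear scale (*) (\<lambda>x. r (x * j) k)" "Vector_Spaces.linear scale (*) (\<lambda>x. r (j * x) k)" for j k
    by (simp_all add: Vector_Spaces.linear_iff vector_space_axioms vmult r_add r_scale distrib_left distrib_right
      scale_mult_left scale_mult_right)
  have coact_sum: "coact i (\<Sum>j\<in>I. sV (g j) (h j)) = (\<Sum>j\<in>I. sV (g j) (coact i (h j)))" for i g h
  proof -
    interpret c: Vector_Spaces.linear sV sV "coact i" by (rule coact_linear)
    show ?thesis by (simp add: c.sum c.scale)
  qed
  \<comment> \<open>\<open>g\<close> stands for an element of the tensor square of the dual,
    multiplied out there. If \<open>g\<close> composed with \<Delta> is c \<epsilon>, the product is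
    c times the unit \<epsilon> of the dual, which acts as the scalar c.\<close>
  have anti: "(\<Sum>p\<in>I. \<Sum>q\<in>I. sV (g p q) (coact p (coact q v))) = sV c v"
    if g: "\<And>n. (\<Sum>p\<in>I. \<Sum>q\<in>I. D n p q * g p q) = \<epsilon> n * c" for g c v
  proof -
    have "(\<Sum>p\<in>I. \<Sum>q\<in>I. sV (g p q) (coact p (coact q v)))
      = (\<Sum>p\<in>I. \<Sum>q\<in>I. \<Sum>n\<in>I. sV (D n p q * g p q) (coact n v))"
      by (intro sum.cong refl) (simp add: coact_coact V.scale_sum_right mult.commute)
    also have "\<dots> = (\<Sum>n\<in>I. \<Sum>p\<in>I. \<Sum>q\<in>I. sV (D n p q * g p q) (coact n v))" by (rule sum_rotate3)
    also have "\<dots> = (\<Sum>n\<in>I. sV (\<Sum>p\<in>I. \<Sum>q\<in>I. D n p q * g p q) (coact n v))" by (simp add: V.scale_sum_left)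
    also have "\<dots> = sV c (\<Sum>n\<in>I. sV (\<epsilon> n) (coact n v))" by (simp only: g V.scale_sum_right V.scale_scale mult.commute[of c])
    finally show ?thesis by (simp add: coact_counit_expand)
  qed
  show ?thesis
  proof unfold_locales
    show "finite I" by (rule finI)
    show "(\<Sum>l\<in>I. r (l * n) k * r (i * j) l) = (\<Sum>l\<in>I. r (i * l) k * r (j * n) l)" for k i j n
    proof -
      have "(\<Sum>l\<in>I. r (l * n) k * r (i * j) l) = (\<Sum>l\<in>I. r (i * j) l * r (l * n) k)"
        by (intro sum.cong refl mult.commute)
      also have "\<dots> = r (i * j * n) k" by (rule linear_expand[OF ml(1), symmetric])
      also have "\<dots> = r (i * (j * n)) k" by (simp only: mult.assoc)
      also have "\<dots> = (\<Sum>l\<in>I. r (j * n) l * r (i * l) k)" by (rule linear_expand[OF ml(2)])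
      also have "\<dots> = (\<Sum>l\<in>I. r (i * l) k * r (j * n) l)" by (intro sum.cong refl mult.commute)
      finally show ?thesis .
    qed
    show "(\<Sum>i\<in>I. r (i * j) k * r 1 i) = (if k = j then 1 else 0)" if "k \<in> I" "j \<in> I" for k j
      using linear_expand[OF ml(1), of 1 j k] r_basis[OF that(2), of k] by (simp add: mult.commute)
    show "(\<Sum>j\<in>I. r (i * j) k * r 1 j) = (if k = i then 1 else 0)" if "k \<in> I" "i \<in> I" for k i
      using linear_expand[OF ml(2), of i 1 k] r_basis[OF that(2), of k] by (simp add: mult.commute)
    show "(\<Sum>n\<in>I. D n k l * r (i * j) n) =
      (\<Sum>a\<in>I. \<Sum>b\<in>I. \<Sum>a'\<in>I. \<Sum>b'\<in>I. r (a * b) k * r (a' * b') l * D i a a' * D j b b')" for k l i j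
    proof -
      have "(\<Sum>n\<in>I. D n k l * r (i * j) n) = D (i * j) k l"
        using linear_expand[OF D_linear, of "i * j" k l] by (simp add: mult.commute)
      also have "\<dots> = (\<Sum>a\<in>I. \<Sum>a'\<in>I. \<Sum>b\<in>I. \<Sum>b'\<in>I. D i a a' * D j b b' * r (a * b) k * r (a' * b') l)"
        by (rule D_mult)
      also have "\<dots> = (\<Sum>a\<in>I. \<Sum>b\<in>I. \<Sum>a'\<in>I. \<Sum>b'\<in>I. D i a a' * D j b b' * r (a * b) k * r (a' * b') l)"
        by (rule sum.cong[OF refl], rule sum.swap)
      finally show ?thesis by (simp add: mult_ac)
    qed
    show "(\<Sum>n\<in>I. D n k l * r 1 n) = r 1 k * r 1 l" for k l
      using linear_expand[OF D_linear, of 1 k l] by (simp add: D_one mult.commute)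
    show "coact i (coact j v) = (\<Sum>n\<in>I. sV (D n i j) (coact n v))" if "i \<in> I" "j \<in> I" for i j v
      by (rule coact_coact[OF that(2)])
    show "(\<Sum>i\<in>I. \<Sum>j\<in>I. sV (r (i * j) k) (\<Sum>n\<in>I. sV (r (S n) i) (coact n (coact j v)))) = sV (r 1 k) v" for k v
    proof -
      have "(\<Sum>i\<in>I. \<Sum>j\<in>I. sV (r (i * j) k) (\<Sum>n\<in>I. sV (r (S n) i) (coact n (coact j v))))
        = (\<Sum>i\<in>I. \<Sum>j\<in>I. \<Sum>n\<in>I. sV (r (S n) i * r (i * j) k) (coact n (coact j v)))"
        by (simp add: V.scale_sum_right mult.commute)
      also have "\<dots> = (\<Sum>n\<in>I. \<Sum>i\<in>I. \<Sum>j\<in>I. sV (r (S n) i * r (i * j) k) (coact n (coact j v)))" by (rule sum_rotate3)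
      also have "\<dots> = (\<Sum>n\<in>I. \<Sum>j\<in>I. \<Sum>i\<in>I. sV (r (S n) i * r (i * j) k) (coact n (coact j v)))"
        by (rule sum.cong[OF refl], rule sum.swap)
      also have "\<dots> = (\<Sum>n\<in>I. \<Sum>j\<in>I. sV (r (S n * j) k) (coact n (coact j v)))"
        unfolding linear_expand[OF ml(1), of "S _"] V.scale_sum_left ..
      also have "\<dots> = sV (r 1 k) v"
      proof (rule anti)
        fix n
        have "r (\<Sum>p\<in>I. \<Sum>q\<in>I. scale (D n p q) (S p * q)) k = \<epsilon> n * r 1 k" by (simp only: D_antipode_left r_scale)
        then show "(\<Sum>p\<in>I. \<Sum>q\<in>I. D n p q * r (S p * q) k) = \<epsilon> n * r 1 k" by (simp only: r_sum r_scale)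
      qed
      finally show ?thesis .
    qed
    show "(\<Sum>i\<in>I. \<Sum>j\<in>I. sV (r (i * j) k) (coact i (\<Sum>n\<in>I. sV (r (S n) j) (coact n v)))) = sV (r 1 k) v" for k v
    proof -
      have "(\<Sum>i\<in>I. \<Sum>j\<in>I. sV (r (i * j) k) (coact i (\<Sum>n\<in>I. sV (r (S n) j) (coact n v))))
        = (\<Sum>i\<in>I. \<Sum>j\<in>I. \<Sum>n\<in>I. sV (r (S n) j * r (i * j) k) (coact i (coact n v)))"
        by (simp add: coact_sum V.scale_sum_right mult.commute)
      also have "\<dots> = (\<Sum>i\<in>I. \<Sum>n\<in>I. \<Sum>j\<in>I. sV (r (S n) j * r (i * j) k) (coact i (coact n v)))"
        by (rule sum.cong[OF refl], rule sum.swap)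
      also have "\<dots> = (\<Sum>i\<in>I. \<Sum>n\<in>I. sV (r (i * S n) k) (coact i (coact n v)))"
        unfolding linear_expand[OF ml(2), of _ "S _"] V.scale_sum_left ..
      also have "\<dots> = sV (r 1 k) v"
      proof (rule anti)
        fix n
        have "r (\<Sum>p\<in>I. \<Sum>q\<in>I. scale (D n p q) (p * S q)) k = \<epsilon> n * r 1 k" by (simp only: D_antipode_right r_scale)
        then show "(\<Sum>p\<in>I. \<Sum>q\<in>I. D n p q * r (p * S q) k) = \<epsilon> n * r 1 k" by (simp only: r_sum r_scale)
      qed
      finally show ?thesis .
    qed
  qed (use coact_linear in \<open>auto simp: Vector_Spaces.linear_iff V.scale_right_distrib sum.distrib V.scale_sum_right mult.commute\<close>)
qed

text \<open>\<rho> v is represented by \<Sum> coact i v \<otimes> i, whose left legs lie in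
  \<open>W\<close> as soon as all \<open>coact i v\<close> do. This makes subcomodules the same as
  subspaces stable under the dual.\<close>

lemma in_tensor_coact:
  assumes "V.subspace W"
  shows "in_tensor sV scale W UNIV (\<rho> v) \<longleftrightarrow> (\<forall>i\<in>I. coact i v \<in> W)"
proof
  assume "in_tensor sV scale W UNIV (\<rho> v)"
  then obtain u where u: "Poly_Mapping.keys u \<subseteq> W \<times> UNIV" "tensor_eq sV scale (\<rho> v) u"
    unfolding in_tensor_def by blast
  have "coact i v = sweedler sV (\<lambda>w h. sV (r h i) w) u" for i
    unfolding coact_def by (rule sweedler_cong[OF coordinate_bilinear[OF r_linear V.linear_identity] u(2)])
  moreover have "sweedler sV (\<lambda>w h. sV (r h i) w) u \<in> W" for i
    unfolding sweedler_def free_ext_def using u(1) assms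
    by (intro V.subspace_sum V.subspace_scale) (auto intro!: V.subspace_scale)
  ultimately show "\<forall>i\<in>I. coact i v \<in> W" by simp
next
  assume W: "\<forall>i\<in>I. coact i v \<in> W"
  let ?u = "\<Sum>i\<in>I. gen (coact i v, i) :: 'v \<times> 'h \<Rightarrow>\<^sub>0 'f"
  have "tensor_eq sV scale (\<rho> v) ?u"
  proof (rule tensor_eqI)
    show "vector_space sV" "vector_space scale" by (rule V.vector_space_axioms vector_space_axioms)+
    fix \<beta> assume \<beta>: "bilinear_map sV scale (*) \<beta>"
    have "sweedler (*) \<beta> ?u = (\<Sum>i\<in>I. sweedler (*) \<beta> (gen (coact i v, i)))"
      using module_hom.sum[OF sweedler_linear[OF vmult, unfolded linear_iff_module_hom]] .
    then show "sweedler (*) \<beta> (\<rho> v) = sweedler (*) \<beta> ?u"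
      by (simp add: coact_expand[OF \<beta>] sweedler_gen[OF vmult])
  qed
  moreover have "Poly_Mapping.keys ?u \<subseteq> (\<Union>i\<in>I. Poly_Mapping.keys (gen (coact i v, i) :: _ \<Rightarrow>\<^sub>0 'f))"
    by (rule keys_sum)
  then have "Poly_Mapping.keys ?u \<subseteq> W \<times> UNIV" using W by auto
  ultimately show "in_tensor sV scale W UNIV (\<rho> v)" unfolding in_tensor_def by blast
qed

end

section \<open>Decomposition into irreducibles\<close>

lemma sum_lessThan_add: "(\<Sum>i<n + k. f i) = (\<Sum>i<n. f i) + (\<Sum>i<k. f (n + i))"
  for f :: "nat \<Rightarrow> 'a::comm_monoid_add"
  by (induction k) (simp_all add: add.assoc)

text \<open>\<open>Q\<close> stands for either kind of submodule. Induction on dimension: a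
  reducible M is split by a proper submodule and a complement, whose decompositions are
  concatenated.\<close>

lemma (in vspace) irreducible_decomposition:
  assumes fd: "fdim UNIV" and sub: "\<And>W. Q W \<Longrightarrow> subspace W" and QU: "Q UNIV"
    and Int: "\<And>W U. Q W \<Longrightarrow> Q U \<Longrightarrow> Q (W \<inter> U)"
    and compl: "\<And>W. Q W \<Longrightarrow> \<exists>C. Q C \<and> W \<inter> C = {0} \<and> (\<forall>v. \<exists>w\<in>W. v - w \<in> C)"
  shows "\<exists>n V. (\<forall>i<n. Q (V i) \<and> V i \<noteq> {0} \<and> (\<forall>U. Q U \<and> U \<subseteq> V i \<longrightarrow> U = {0} \<or> U = V i)) \<and> is_direct_sum scale n V"
proof -
  define irr where "irr W \<longleftrightarrow> Q W \<and> W \<noteq> {0} \<and> (\<forall>U. Q U \<and> U \<subseteq> W \<longrightarrow> U = {0} \<or> U = W)" for W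
  define dec where "dec M n V \<longleftrightarrow> (\<forall>i<n. irr (V i) \<and> V i \<subseteq> M) \<and>
      (\<forall>v\<in>M. \<exists>w. (\<forall>i<n. w i \<in> V i) \<and> v = (\<Sum>i<n. w i)) \<and>
      (\<forall>w. (\<forall>i<n. w i \<in> V i) \<and> (\<Sum>i<n. w i) = 0 \<longrightarrow> (\<forall>i<n. w i = 0))" for M and n :: nat and V
  have "Q M \<Longrightarrow> \<exists>n V. dec M n V" for M
  proof (induction "dim M" arbitrary: M rule: less_induct)
    case less
    consider "M = {0}" | "irr M" | "M \<noteq> {0}" "\<not> irr M" by blast
    then show ?case
    proof cases
      case 1
      then show ?thesis by (intro exI[of _ 0] exI[of _ "\<lambda>_. {}"]) (auto simp: dec_def)
    next
      case 2
      show ?thesis unfolding dec_def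
      proof (intro exI[of _ 1] exI[of _ "\<lambda>_. M"] conjI)
        show "\<forall>v\<in>M. \<exists>w. (\<forall>i<1. w i \<in> M) \<and> v = (\<Sum>i<1::nat. w i)"
        proof
          fix v assume "v \<in> M"
          then show "\<exists>w. (\<forall>i<1. w i \<in> M) \<and> v = (\<Sum>i<1::nat. w i)" by (intro exI[of _ "\<lambda>_. v"]) simp
        qed
      qed (use 2 in auto)
    next
      case 3
      then obtain U where U: "Q U" "U \<subseteq> M" "U \<noteq> {0}" "U \<noteq> M" using less.prems unfolding irr_def by blast
      obtain C where C: "Q C" "U \<inter> C = {0}" "\<And>v. \<exists>w\<in>U. v - w \<in> C" using compl[OF U(1)] by blast
      have fdM: "fdim M" using fd fdim_mono by blast
      note sM = sub[OF less.prems] and sU = sub[OF U(1)]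
      \<comment> \<open>Modular law: since U lies in M, cutting the complement C down to M leaves a
        complement of U inside M.\<close>
      have QC: "Q (C \<inter> M)" using Int C less.prems by blast
      have "C \<inter> M \<noteq> M"
      proof
        assume "C \<inter> M = M"
        then have "U \<inter> C = U" using U(2) by blast
        then show False using C(2) U(3) by simp
      qed
      then have d: "dim U < dim M" "dim (C \<inter> M) < dim M"
        using dim_subset_fdim(2)[OF sU sM fdM U(2) U(4)] dim_subset_fdim(2)[OF sub[OF QC] sM fdM] by auto
      obtain n V where V': "dec U n V" using less.hyps[OF d(1) U(1)] by blast
      obtain k T where T': "dec (C \<inter> M) k T" using less.hyps[OF d(2) QC] by blast
      note V = V'[unfolded dec_def, THEN conjunct1] V'[unfolded dec_def, THEN conjunct2, THEN conjunct1]
        V'[unfolded dec_def, THEN conjunct2, THEN conjunct2]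
      note T = T'[unfolded dec_def, THEN conjunct1] T'[unfolded dec_def, THEN conjunct2, THEN conjunct1]
        T'[unfolded dec_def, THEN conjunct2, THEN conjunct2]
      define Y where "Y i = (if i < n then V i else T (i - n))" for i
      have X: "Y i = V i" if "i < n" for i using that by (simp add: Y_def)
      have X': "Y (n + i) = T i" for i by (simp add: Y_def)
      have split: "(\<forall>i<n + k. P i) \<longleftrightarrow> (\<forall>i<n. P i) \<and> (\<forall>i<k. P (n + i))" for P
      proof safe
        fix i assume P: "\<forall>i<n. P i" "\<forall>i<k. P (n + i)" "i < n + k"
        show "P i"
        proof (cases "i < n")
          case False
          then have "P (n + (i - n))" using P(2,3) by (intro P(2)[rule_format]) simp
          then show ?thesis using False by simp
        qed (use P in simp)
      qed simp_all
      show ?thesis unfolding dec_def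
      proof (intro exI[of _ "n + k"] exI[of _ Y] conjI ballI allI impI)
        fix i assume "i < n + k"
        moreover have "\<forall>i<n + k. irr (Y i) \<and> Y i \<subseteq> M" unfolding split using V(1) T(1) subset_trans[OF _ U(2)] X X' by simp
        ultimately show "irr (Y i)" "Y i \<subseteq> M" by auto
      next
        fix v assume v: "v \<in> M"
        obtain u where u: "u \<in> U" "v - u \<in> C" using C(3) by blast
        have "v - u \<in> C \<inter> M" using u v U(2) sM by (auto intro: subspace_diff)
        then obtain w' where w': "\<forall>i<k. w' i \<in> T i" "v - u = (\<Sum>i<k. w' i)" using T(2) by blast
        obtain w where w: "\<forall>i<n. w i \<in> V i" "u = (\<Sum>i<n. w i)" using V(2) u by blast
        define z where "z i = (if i < n then w i else w' (i - n))" for i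
        have "v = (\<Sum>i<n. w i) + (\<Sum>i<k. w' i)" using w(2) w'(2) by (metis add.commute diff_add_cancel)
        also have "\<dots> = (\<Sum>i<n + k. z i)" unfolding sum_lessThan_add by (simp add: z_def)
        finally have "v = (\<Sum>i<n + k. z i)" .
        moreover have "\<forall>i<n + k. z i \<in> Y i" unfolding split using w(1) w'(1) by (simp add: z_def Y_def)
        ultimately show "\<exists>w. (\<forall>i<n + k. w i \<in> Y i) \<and> v = (\<Sum>i<n + k. w i)" by blast
      next
        fix w i assume w: "(\<forall>i<n + k. w i \<in> Y i) \<and> (\<Sum>i<n + k. w i) = 0" and i: "i < n + k"
        have w1: "\<forall>i<n. w i \<in> V i" and w2: "\<forall>i<k. w (n + i) \<in> T i"
          using w X X' unfolding split by auto
        define a where "a = (\<Sum>i<n. w i)"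
        define b where "b = (\<Sum>i<k. w (n + i))"
        have ab: "a + b = 0" using w by (simp add: a_def b_def sum_lessThan_add)
        have "a \<in> U" unfolding a_def using w1 V(1) sU by (intro subspace_sum) auto
        moreover have "b \<in> C" unfolding b_def using w2 T(1) sub[OF C(1)] by (intro subspace_sum) auto
        then have "a \<in> C" using ab sub[OF C(1)] by (metis eq_neg_iff_add_eq_0 subspace_neg)
        ultimately have "a = 0" using C(2) by blast
        then have "b = 0" using ab by simp
        have "\<forall>i<n. w i = 0" using V(3) w1 \<open>a = 0\<close> unfolding a_def by blast
        moreover have "\<forall>i<k. w (n + i) = 0"
          using T(3)[rule_format, of "\<lambda>i. w (n + i)"] w2 \<open>b = 0\<close> unfolding b_def by blast
        ultimately have "\<forall>i<n + k. w i = 0" unfolding split by blast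
        then show "w i = 0" using i by blast
      qed
    qed
  qed
  from this[OF QU] obtain n V where V: "dec UNIV n V" by blast
  then have "is_direct_sum scale n V" unfolding is_direct_sum_def dec_def irr_def using sub by simp
  moreover have "\<forall>i<n. irr (V i)" using V by (simp add: dec_def)
  ultimately show ?thesis unfolding irr_def by (intro exI[of _ n] exI[of _ V]) simp
qed

lemma (in vspace) kernel_complement:
  assumes q: "Vector_Spaces.linear scale scale q" "\<And>v. q v \<in> W" "\<And>w. w \<in> W \<Longrightarrow> q w = w"
  shows "subspace {v. q v = 0}" "W \<inter> {v. q v = 0} = {0}" "\<exists>w\<in>W. v - w \<in> {v. q v = 0}"
proof -
  interpret q: Vector_Spaces.linear scale scale q by (rule q(1))
  show "subspace {v. q v = 0}" by (rule subspaceI) (auto simp: q.add q.scale q.zero)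
  have "0 \<in> W" using q(2)[of 0] by (simp add: q.zero)
  then show "W \<inter> {v. q v = 0} = {0}" using q(3) by (auto simp: q.zero)
  show "\<exists>w\<in>W. v - w \<in> {v. q v = 0}" using q(2,3) by (intro bexI[of _ "q v"]) (auto simp: q.diff)
qed

lemma finite_dimensional_basis:
  assumes "finite_dimensional s"
  obtains B where "vspace s" "vspace.basis_of s UNIV B"
proof -
  obtain B where "finite_dimensional_vector_space s B" using assms unfolding finite_dimensional_def by blast
  then interpret finite_dimensional_vector_space s B .
  have v: "vspace s" by unfold_locales
  then have "vspace.basis_of s UNIV B"
    using finite_Basis independent_Basis span_Basis by (simp add: vspace.basis_of_def)
  with v show ?thesis using that by blast
qed

theorem module_decomposition:
  fixes sH :: "'f::field_char_0 \<Rightarrow> 'h::ring_1 \<Rightarrow> 'h"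
  assumes fdH: "finite_dimensional sH" and fdL: "finite_dimensional sL" and fdV: "finite_dimensional sV"
    and ss: "lie_algebra.semisimple_lie sL br" and ssH: "unital_algebra.semisimple sH"
    and HL: "HL_module sH \<Delta> \<epsilon> S sL br actL sV actV \<psi>"
  shows "\<exists>s V. (\<forall>i<s. HL_module.irreducible_HL_submodule sV actV \<psi> (V i)) \<and> is_direct_sum sV s V"
proof -
  interpret HL_module sH \<Delta> \<epsilon> S sL br actL sV actV \<psi> by fact
  obtain I where I: "vspace sH" "vspace.basis_of sH UNIV I" using finite_dimensional_basis[OF fdH] by blast
  interpret H: fd_hopf sH \<Delta> \<epsilon> S I using HLie.H.hopf_algebra_axioms I by (simp add: fd_hopf_def fd_hopf_axioms_def)
  interpret V: vspace sV by unfold_locales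
  have fdVU: "V.fdim UNIV" using finite_dimensional_basis[OF fdV] V.basis_of_fdim by metis
  interpret L: vspace sL by unfold_locales
  have "L.fdim UNIV" using finite_dimensional_basis[OF fdL] L.basis_of_fdim by metis
  then interpret L: semisimple_lie_algebra sL br using ss by unfold_locales auto
  have psi_l: "Vector_Spaces.linear sV sV (\<psi> x)" "Vector_Spaces.linear sL sV (\<lambda>x. \<psi> x v)" for x v
    using LV.rep_bilinear by (auto simp: bilinear_map_def)
  have act_l: "Vector_Spaces.linear sV sV (actV h)" "Vector_Spaces.linear sH sV (\<lambda>h. actV h v)" for h v
    using HV.act_bilinear by (auto simp: bilinear_map_def)
  have actL_l: "Vector_Spaces.linear sH sL (\<lambda>h. actL h a)" for a
    using HLie.HL.act_bilinear by (auto simp: bilinear_map_def)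
  interpret A: hopf_constants sV I H.D \<epsilon> "\<lambda>k l n. H.r (k * l) n" actV "\<lambda>i. actV (S i)"
    by (rule H.module_constants) unfold_locales
  obtain t where t: "\<And>h. t * h = sH (\<epsilon> h) t" "\<epsilon> t = 1" using H.semisimple_integral[OF ssH] by blast
  have compl: "\<exists>C. HL_submodule C \<and> W \<inter> C = {0} \<and> (\<forall>v. \<exists>w\<in>W. v - w \<in> C)" if W: "HL_submodule W" for W
  proof -
    have Wl: "LV.lie_submodule W" and Wa: "\<And>h w. w \<in> W \<Longrightarrow> actV h w \<in> W" using W by (auto simp: HL_submodule_def)
    obtain p where p: "Vector_Spaces.linear sV sV p" "\<And>v. p v \<in> W" "\<And>w. w \<in> W \<Longrightarrow> p w = w"
      "\<And>x v. p (\<psi> x v) = \<psi> x (p v)"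
      using weyl_projection[OF L.semisimple_lie_algebra_axioms LV.lie_representation_axioms fdVU Wl] by blast
    obtain q where q: "Vector_Spaces.linear sV sV q" "\<And>v. q v \<in> W" "\<And>w. w \<in> W \<Longrightarrow> q w = w"
      "\<And>a v. q (\<psi> a v) = \<psi> a (q v)" "\<And>i v. i \<in> I \<Longrightarrow> q (actV i v) = actV i (q v)"
    proof (rule A.averaged_projection[OF p(1-3) _ _ _ psi_l(1) p(4), where B = actL and \<tau> = "H.r t"])
      show "HV.V.subspace W" using Wl by (simp add: LV.lie_submodule_def)
      show "actV i w \<in> W" "actV (S i) w \<in> W" if "w \<in> W" for i w using Wa that by auto
      show "actV k (\<psi> a v) = (\<Sum>i\<in>I. \<Sum>j\<in>I. sV (H.D k i j) (\<psi> (actL i a) (actV j v)))" for k a v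
      proof -
        have "bilinear_map sH sH sV (\<lambda>x y. \<psi> (actL x a) (actV y v))"
          using psi_l act_l actL_l by (auto intro!: bilinear_mapI simp: Vector_Spaces.linear_iff)
        from H.comult_expand[OF this] show ?thesis by (simp add: act_rep)
      qed
      \<comment> \<open>The n-th coordinate of the identity t l = \<epsilon>(l) t.\<close>
      show "(\<Sum>k\<in>I. H.r t k * H.r (k * l) n) = \<epsilon> l * H.r t n" for l n
      proof -
        have "Vector_Spaces.linear sH (*) (\<lambda>x. H.r (x * l) n)"
          by (simp add: Vector_Spaces.linear_iff I(1)[unfolded vspace_iff] H.vmult H.r_add H.r_scale distrib_right HLie.H.scale_mult_left)
        from H.linear_expand[OF this, of t] show ?thesis by (simp add: t H.r_scale)
      qed
      show "(\<Sum>k\<in>I. H.r t k * \<epsilon> k) = 1" using H.linear_expand[OF HLie.H.counit_linear, of t] t by simp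
    qed blast+
    let ?C = "{v. q v = 0}"
    have "\<psi> a 0 = 0" for a using psi_l(1)[of a] by (metis Vector_Spaces.linear_iff HV.V.scale_zero_left)
    then have "LV.lie_submodule ?C" unfolding LV.lie_submodule_def
      using V.kernel_complement(1)[OF q(1-3)] q(4) by auto
    \<comment> \<open>The averaged projection is known to commute with the basis of H only;
      linearity of the action in \<open>h\<close> gives the rest.\<close>
    moreover have "q (actV h v) = 0" if "q v = 0" for h v
    proof -
      interpret q: Vector_Spaces.linear sV sV q by (rule q(1))
      have "actV i 0 = 0" for i using act_l(1)[of i] by (metis Vector_Spaces.linear_iff HV.V.scale_zero_left)
      then show ?thesis using H.linear_expand[OF act_l(2), of h v] that by (simp add: q.sum q.scale q(5))
    qed
    ultimately have "HL_submodule ?C" by (simp add: HL_submodule_def)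
    then show ?thesis using V.kernel_complement(2,3)[OF q(1-3)] by blast
  qed
  have "\<exists>n V. (\<forall>i<n. HL_submodule (V i) \<and> V i \<noteq> {0} \<and> (\<forall>U. HL_submodule U \<and> U \<subseteq> V i \<longrightarrow> U = {0} \<or> U = V i))
      \<and> is_direct_sum sV n V"
  proof (rule V.irreducible_decomposition[OF fdVU])
    show "HL_submodule (W \<inter> U)" if "HL_submodule W" "HL_submodule U" for W U
      using that HV.V.subspace_inter by (auto simp: HL_submodule_def LV.lie_submodule_def)
    show "\<exists>C. HL_submodule C \<and> W \<inter> C = {0} \<and> (\<forall>v. \<exists>w\<in>W. v - w \<in> C)" if "HL_submodule W" for W
      by (rule compl[OF that])
  qed (auto simp: HL_submodule_def LV.lie_submodule_def)
  then show ?thesis unfolding irreducible_HL_submodule_def .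
qed

theorem comodule_decomposition:
  fixes sH :: "'f::field_char_0 \<Rightarrow> 'h::ring_1 \<Rightarrow> 'h"
  assumes fdH: "finite_dimensional sH" and fdL: "finite_dimensional sL" and fdV: "finite_dimensional sV"
    and ss: "lie_algebra.semisimple_lie sL br" and ssH: "coalgebra.cosemisimple sH \<Delta>"
    and HL: "HL_comodule sH \<Delta> \<epsilon> S sL br \<rho>L sV \<rho>V \<psi>"
  shows "\<exists>s V. (\<forall>i<s. HL_comodule.irreducible_HL_subcomodule sH sV \<rho>V \<psi> (V i)) \<and> is_direct_sum sV s V"
proof -
  interpret HL_comodule sH \<Delta> \<epsilon> S sL br \<rho>L sV \<rho>V \<psi> by fact
  obtain I where I: "vspace sH" "vspace.basis_of sH UNIV I" using finite_dimensional_basis[OF fdH] by blast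
  interpret H: fd_hopf sH \<Delta> \<epsilon> S I using HLie.H.hopf_algebra_axioms I by (simp add: fd_hopf_def fd_hopf_axioms_def)
  interpret V: vspace sV by unfold_locales
  have fdVU: "V.fdim UNIV" using finite_dimensional_basis[OF fdV] V.basis_of_fdim by metis
  interpret L: vspace sL by unfold_locales
  have "L.fdim UNIV" using finite_dimensional_basis[OF fdL] L.basis_of_fdim by metis
  then interpret L: semisimple_lie_algebra sL br using ss by unfold_locales auto
  have psi_l: "Vector_Spaces.linear sV sV (\<psi> x)" "Vector_Spaces.linear sL sV (\<lambda>x. \<psi> x v)" for x v
    using LV.rep_bilinear by (auto simp: bilinear_map_def)
  interpret CV: fd_hopf_comodule sH \<Delta> \<epsilon> S I sV \<rho>V by unfold_locales
  interpret CL: fd_hopf_comodule sH \<Delta> \<epsilon> S I sL \<rho>L by unfold_locales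
  interpret A: hopf_constants sV I "\<lambda>k i j. H.r (i * j) k" "H.r 1" "\<lambda>k l n. H.D n k l" CV.coact
    "\<lambda>i v. \<Sum>j\<in>I. sV (H.r (S j) i) (CV.coact j v)"
    by (rule CV.comodule_constants)
  obtain \<phi> where \<phi>: "Vector_Spaces.linear sH (*) \<phi>" "\<phi> 1 = 1"
    "\<And>x. sweedler sH (\<lambda>a b. sH (\<phi> a) b) (\<Delta> x) = sH (\<phi> x) 1" using H.cosemisimple_integral[OF ssH] by blast
  have sub_iff: "HL_subcomodule W \<longleftrightarrow> LV.lie_submodule W \<and> (\<forall>w\<in>W. \<forall>i\<in>I. CV.coact i w \<in> W)" for W
    unfolding HL_subcomodule_def using CV.in_tensor_coact LV.lie_submodule_def by auto
  have compl: "\<exists>C. HL_subcomodule C \<and> W \<inter> C = {0} \<and> (\<forall>v. \<exists>w\<in>W. v - w \<in> C)" if W: "HL_subcomodule W" for W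
  proof -
    have Wl: "LV.lie_submodule W" and Wa: "\<And>i w. i \<in> I \<Longrightarrow> w \<in> W \<Longrightarrow> CV.coact i w \<in> W" using W by (auto simp: sub_iff)
    have Ws: "HV.V.subspace W" using Wl by (simp add: LV.lie_submodule_def)
    obtain p where p: "Vector_Spaces.linear sV sV p" "\<And>v. p v \<in> W" "\<And>w. w \<in> W \<Longrightarrow> p w = w"
      "\<And>x v. p (\<psi> x v) = \<psi> x (p v)"
      using weyl_projection[OF L.semisimple_lie_algebra_axioms LV.lie_representation_axioms fdVU Wl] by blast
    obtain q where q: "Vector_Spaces.linear sV sV q" "\<And>v. q v \<in> W" "\<And>w. w \<in> W \<Longrightarrow> q w = w"
      "\<And>a v. q (\<psi> a v) = \<psi> a (q v)" "\<And>i v. i \<in> I \<Longrightarrow> q (CV.coact i v) = CV.coact i (q v)"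
    proof (rule A.averaged_projection[OF p(1-3) Ws _ _ psi_l(1) p(4), where B = CL.coact and \<tau> = \<phi>])
      show "CV.coact i w \<in> W" "(\<Sum>j\<in>I. sV (H.r (S j) i) (CV.coact j w)) \<in> W" if "i \<in> I" "w \<in> W" for i w
        using Wa that Ws by (auto intro!: HV.V.subspace_sum HV.V.subspace_scale)
      show "CV.coact k (\<psi> a v) = (\<Sum>i\<in>I. \<Sum>j\<in>I. sV (H.r (i * j) k) (\<psi> (CL.coact i a) (CV.coact j v)))" for k a v
      proof -
        \<comment> \<open>The two coactions are expanded one after the other, the inner one at the
          vector and the outer one at the Lie element. The product of their H-legs, read at the
          coordinate \<open>k\<close>, is the comultiplication of the dual.\<close>
        let ?\<beta> = "\<lambda>x h y h'. sV (H.r (h * h') k) (\<psi> x y)"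
        have b1: "bilinear_map sV sH sV (\<lambda>y h'. ?\<beta> x h y h')" for x h
          using psi_l by (auto intro!: bilinear_mapI simp: Vector_Spaces.linear_iff I(1)[unfolded vspace_iff]
            distrib_left H.r_add H.r_scale HLie.H.scale_mult_right HV.V.scale_left_distrib HV.V.scale_right_distrib mult.commute)
        have b2: "bilinear_map sL sH sV (\<lambda>x h. \<Sum>j\<in>I. ?\<beta> x h (CV.coact j v) j)"
          using psi_l by (auto intro!: bilinear_mapI simp: Vector_Spaces.linear_iff I(1)[unfolded vspace_iff]
            distrib_right H.r_add H.r_scale HLie.H.scale_mult_left HV.V.scale_left_distrib HV.V.scale_right_distrib mult.commute
            sum.distrib HV.V.scale_sum_right)
        have "CV.coact k (\<psi> a v) = sweedler sV (\<lambda>w h. sV (H.r h k) w) (tensor_combine \<psi> (*) (\<rho>L a) (\<rho>V v))"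
          unfolding CV.coact_def by (rule sweedler_cong[OF CV.coordinate_bilinear[OF H.r_linear V.linear_identity] coact_rep])
        also have "\<dots> = sweedler sV (\<lambda>x h. sweedler sV (?\<beta> x h) (\<rho>V v)) (\<rho>L a)"
          by (rule sweedler_tensor_combine[OF HV.V.vector_space_axioms])
        also have "\<dots> = sweedler sV (\<lambda>x h. \<Sum>j\<in>I. ?\<beta> x h (CV.coact j v) j) (\<rho>L a)"
          by (simp only: CV.coact_expand[OF b1])
        also have "\<dots> = (\<Sum>i\<in>I. \<Sum>j\<in>I. ?\<beta> (CL.coact i a) i (CV.coact j v) j)"
          by (rule CL.coact_expand[OF b2])
        finally show ?thesis .
      qed
      \<comment> \<open>For the dual the counit is evaluation at 1, so the integral condition is
        \<phi>(x_1) x_2 = \<phi>(x) 1 with x = n, read off at the coordinate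
        \<open>l\<close>.\<close>
      show "(\<Sum>k\<in>I. \<phi> k * H.D n k l) = H.r 1 l * \<phi> n" if "l \<in> I" "n \<in> I" for l n
      proof -
        have "bilinear_map sH sH sH (\<lambda>a b. sH (\<phi> a) b)"
          using \<phi>(1) by (auto intro!: bilinear_mapI simp: Vector_Spaces.linear_iff HLie.H.scale_left_distrib
            HLie.H.scale_right_distrib mult.commute)
        from H.comult_expand[OF this, of n] \<phi>(3)[of n]
        have "H.r (\<Sum>i\<in>I. \<Sum>j\<in>I. sH (H.D n i j) (sH (\<phi> i) j)) l = H.r (sH (\<phi> n) 1) l" by simp
        then have "(\<Sum>i\<in>I. \<Sum>j\<in>I. H.D n i j * \<phi> i * H.r j l) = \<phi> n * H.r 1 l"
          by (simp only: H.r_sum H.r_scale mult.assoc)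
        then have "(\<Sum>i\<in>I. H.D n i l * \<phi> i) = \<phi> n * H.r 1 l" by (simp only: H.sum_r_right(1)[OF that(1)])
        then show ?thesis by (simp add: mult.commute)
      qed
      show "(\<Sum>k\<in>I. \<phi> k * H.r 1 k) = 1" using H.linear_expand[OF \<phi>(1), of 1] \<phi>(2) by (simp add: mult.commute)
    qed blast+
    let ?C = "{v. q v = 0}"
    have "\<psi> a 0 = 0" for a using psi_l(1)[of a] by (metis Vector_Spaces.linear_iff HV.V.scale_zero_left)
    then have "LV.lie_submodule ?C" unfolding LV.lie_submodule_def
      using V.kernel_complement(1)[OF q(1-3)] q(4) by auto
    moreover have "CV.coact i 0 = 0" for i
      using CV.coact_linear[of i] by (metis Vector_Spaces.linear_iff HV.V.scale_zero_left)
    ultimately have "HL_subcomodule ?C" unfolding sub_iff by (simp add: q(5))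
    then show ?thesis using V.kernel_complement(2,3)[OF q(1-3)] by blast
  qed
  have "\<exists>n V. (\<forall>i<n. HL_subcomodule (V i) \<and> V i \<noteq> {0} \<and> (\<forall>U. HL_subcomodule U \<and> U \<subseteq> V i \<longrightarrow> U = {0} \<or> U = V i))
      \<and> is_direct_sum sV n V"
  proof (rule V.irreducible_decomposition[OF fdVU])
    show "HL_subcomodule (W \<inter> U)" if "HL_subcomodule W" "HL_subcomodule U" for W U
      using that HV.V.subspace_inter by (auto simp: sub_iff LV.lie_submodule_def)
    show "\<exists>C. HL_subcomodule C \<and> W \<inter> C = {0} \<and> (\<forall>v. \<exists>w\<in>W. v - w \<in> C)" if "HL_subcomodule W" for W
      by (rule compl[OF that])
  qed (auto simp: sub_iff LV.lie_submodule_def)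
  then show ?thesis unfolding irreducible_HL_subcomodule_def .
qed

theorem mainTheorem11:
  fixes sH :: "'f::field_char_0 \<Rightarrow> 'h::ring_1 \<Rightarrow> 'h"
    and \<Delta> :: "'h \<Rightarrow> ('h \<times> 'h \<Rightarrow>\<^sub>0 'f)"
    and \<epsilon> :: "'h \<Rightarrow> 'f"
    and S :: "'h \<Rightarrow> 'h"
    and sL :: "'f \<Rightarrow> 'l::ab_group_add \<Rightarrow> 'l"
    and br :: "'l \<Rightarrow> 'l \<Rightarrow> 'l"
    and sV :: "'f \<Rightarrow> 'v::ab_group_add \<Rightarrow> 'v"
    and \<psi> :: "'l \<Rightarrow> 'v \<Rightarrow> 'v"
  assumes "hopf_algebra sH \<Delta> \<epsilon> S" and "finite_dimensional sH"
    and "lie_algebra sL br" and "finite_dimensional sL" and "lie_algebra.semisimple_lie sL br"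
    and "finite_dimensional sV"
  shows
    "(\<forall>actL actV.
        unital_algebra.semisimple sH \<and>
        module_lie_algebra sH \<Delta> \<epsilon> S sL br actL \<and>
        HL_module sH \<Delta> \<epsilon> S sL br actL sV actV \<psi> \<longrightarrow>
        (\<exists>s V. (\<forall>i<s. HL_module.irreducible_HL_submodule sV actV \<psi> (V i)) \<and>
               is_direct_sum sV s V)) \<and>
     (\<forall>\<rho>L \<rho>V.
        coalgebra.cosemisimple sH \<Delta> \<and>
        comodule_lie_algebra sH \<Delta> \<epsilon> S sL br \<rho>L \<and>
        HL_comodule sH \<Delta> \<epsilon> S sL br \<rho>L sV \<rho>V \<psi> \<longrightarrow>
        (\<exists>s V. (\<forall>i<s. HL_comodule.irreducible_HL_subcomodule sH sV \<rho>V \<psi> (V i)) \<and>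
               is_direct_sum sV s V))"
  using module_decomposition[OF assms(2,4,6,5)] comodule_decomposition[OF assms(2,4,6,5)] by blast

end
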